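(* Let $M$ be an oriented closed connected manifold with fundamental group $\Gamma$, let $(\alpha,\mu)$ be a standard probability action of $\Gamma$ on $X$, and let $\beta\colon X\to \mathrm{Erg}(\alpha)$ be an ergodic decomposition of $(\alpha,\mu)$. Then $$|M|^{(\alpha,\mu)}=\int_X |M|^{(\alpha,\beta_x)}\,d\mu(x),$$ where $|M|^{(\alpha,\nu)}$ denotes the $(\alpha,\nu)$-parametrised simplicial volume of $M$.
   Context: A standard Borel space is a measurable space isomorphic to a Polish space with its Borel $\sigma$-algebra. A standard action is a measurable action $\alpha\colon\Gamma\curvearrowright X$ of a countable group $\Gamma$ on a standard Borel space $X$. A standard probability action is a pair $(\alpha,\mu)$ where $\alpha\colon\Gamma\curvearrowright X$ is a standard action and $\mu$ is an $\alpha$-invariant probability measure on $X$. Parametrised simplicial volume. Let $M$ be an oriented closed connected $n$-manifold with fundamental group $\Gamma$ and universal covering $\pi\colon\widetilde M\to M$; $\Gamma$ acts on singular simplices of $\widetilde M$ by deck transformations. For a right $\mathbb Z\Gamma$-module $A$ put $C_*(M;A):=A\otimes_{\mathbb Z\Gamma}C_*(\widetilde M;\mathbb Z)$ (singular chains) and $H_*(M;A):=H_*(C_*(M;A))$; for $A=\mathbb Z$ (trivial action) this is identified via $\pi$ with the usual singular chain complex of $M$. Let $(\alpha,\nu)$ be a standard probability action of $\Gamma$ on $X$. Let $L^\infty(\alpha,\nu,\mathbb Z)$ be the right $\mathbb Z\Gamma$-module of $\nu$-a.e. equivalence classes of measurable $\nu$-essentially bounded functions $X\to\mathbb Z$, with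 $(f\cdot\gamma)(x)=f(\gamma\cdot x)$. The inclusion of $\mathbb Z$ as constant functions induces a chain map $C_*(M;\mathbb Z)\to C_*(M;L^\infty(\alpha,\nu,\mathbb Z))$; an $(\alpha,\nu)$-parametrised fundamental cycle is a cycle in $C_n(M;L^\infty(\alpha,\nu,\mathbb Z))$ representing the image of the integral fundamental class $[M]_{\mathbb Z}$. A chain $c=\sum_{j=1}^m f_j\otimes\sigma_j$ (with $\sigma_j$ singular simplices of $\widetilde M$) is in reduced form if $\pi\circ\sigma_j\neq\pi\circ\sigma_k$ for all $j\ne k$; for such $c$ set $|c|^{(\alpha,\nu)}:=\sum_{j=1}^m\int_X|f_j|\,d\nu$ (every chain has an essentially unique reduced form). The $(\alpha,\nu)$-parametrised simplicial volume $|M|^{(\alpha,\nu)}$ is the infimum of $|c|^{(\alpha,\nu)}$ over all $(\alpha,\nu)$-parametrised fundamental cycles $c$. Ergodic decomposition. For a standard action $\alpha\colon\Gamma\curvearrowright X$, $\mathrm{Erg}(\alpha)$ is the set of $\alpha$-invariant probability measures $\nu$ on $X$ that are ergodic, i.e. $\nu(A)\in\{0,1\}$ for every measurable $A\subset X$ with $\Gamma\cdot A=A$. An ergodic decomposition of a standard probability action $(\alpha,\mu)$ is a map $\beta\colon X\to\mathrm{Erg}(\alpha)$, $x\mapsto\beta_x$, such that: (1) for every measurable $A\subset X$ the map $X\to[0,1]$, $x\mapsto\beta_x(A)$ is measurable; (2) $\mu(A)=\int_X\beta_x(A)\,d\mu(x)$ for every measurable $A\subset X$; (3) $\beta_{\gamma\cdot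 x}=\beta_x$ for all $x\in X$, $\gamma\in\Gamma$; (4) for every $\nu\in\mathrm{Erg}(\alpha)$, the set $X_\nu:=\beta^{-1}(\nu)$ is measurable and $\nu(X_\nu)=1$. *)

theory Defs
  imports
    "HOL-Homology.Homology"
    "HOL-Probability.Probability"
    "HOL-Algebra.Group_Action"
begin

section \<open>Oriented closed manifolds\<close>

text \<open>A space is a subset, with the subspace topology, of an ambient topological space (which may
  be the space itself), so that the library's \<open>covering_space\<close>, \<open>simply_connected\<close> and
  \<open>homotopic_paths\<close> apply.\<close>

definition closed_manifold :: "nat \<Rightarrow> 'a::topological_space set \<Rightarrow> bool" where
  "closed_manifold n M \<longleftrightarrow>
     compact M \<and> Hausdorff_space (top_of_set M) \<and> second_countable (top_of_set M) \<and>
     (\<forall>x\<in>M. \<exists>U V. x \<in> U \<and> openin (top_of_set M) U \<and> openin (Euclidean_space n) V \<and>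
        top_of_set U homeomorphic_space subtopology (Euclidean_space n) V)"

abbreviation local_homology :: "nat \<Rightarrow> 'a::topological_space set \<Rightarrow> 'a set \<Rightarrow> 'a chain set monoid" where
  "local_homology n M K \<equiv> relative_homology_group (int n) (top_of_set M) (M - K)"

text \<open>A locally consistent choice of generators of the groups \<open>H\<^sub>n(M, M - {x}; \<int>)\<close>.\<close>

definition orientation :: "nat \<Rightarrow> 'a::topological_space set \<Rightarrow> ('a \<Rightarrow> 'a chain set) \<Rightarrow> bool" where
  "orientation n M ori \<longleftrightarrow>
     (\<forall>x\<in>M. ori x \<in> carrier (local_homology n M {x}) \<and>
             subgroup_generated (local_homology n M {x}) {ori x} = local_homology n M {x}) \<and>
     (\<forall>x\<in>M. \<exists>U c. x \<in> U \<and> openin (top_of_set M) U \<and> c \<in> carrier (local_homology n M U) \<and>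
        (\<forall>y\<in>U. hom_induced (int n) (top_of_set M) (M - U) (top_of_set M) (M - {y}) id c = ori y))"

definition fundamental_class ::
  "nat \<Rightarrow> 'a::topological_space set \<Rightarrow> ('a \<Rightarrow> 'a chain set) \<Rightarrow> 'a chain set \<Rightarrow> bool" where
  "fundamental_class n M ori fM \<longleftrightarrow>
     fM \<in> carrier (homology_group (int n) (top_of_set M)) \<and>
     (\<forall>x\<in>M. hom_induced (int n) (top_of_set M) {} (top_of_set M) (M - {x}) id fM = ori x)"


section \<open>Fundamental group, universal covering and deck transformations\<close>

definition path_class :: "'a::topological_space set \<Rightarrow> (real \<Rightarrow> 'a) \<Rightarrow> (real \<Rightarrow> 'a) set" where
  "path_class M g = {h. homotopic_paths M g h}"

definition fundamental_group :: "'a::topological_space set \<Rightarrow> 'a \<Rightarrow> (real \<Rightarrow> 'a) set monoid" where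
  "fundamental_group M x0 =
     \<lparr> carrier = path_class M `
         {g. path g \<and> path_image g \<subseteq> M \<and> pathstart g = x0 \<and> pathfinish g = x0},
       monoid.mult = (\<lambda>A B. \<Union>g\<in>A. \<Union>h\<in>B. path_class M (g +++ h)),
       one = path_class M (\<lambda>_. x0) \<rparr>"

definition universal_covering ::
  "'b::topological_space set \<Rightarrow> ('b \<Rightarrow> 'a::topological_space) \<Rightarrow> 'a set \<Rightarrow> bool" where
  "universal_covering E p M \<longleftrightarrow> covering_space E p M \<and> simply_connected E"

definition deck_transformation ::
  "'b::topological_space set \<Rightarrow> ('b \<Rightarrow> 'a) \<Rightarrow> ('b \<Rightarrow> 'b) \<Rightarrow> bool" where
  "deck_transformation E p D \<longleftrightarrow> (\<exists>D'. homeomorphism E E D D') \<and> (\<forall>e\<in>E. p (D e) = p e)"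

text \<open>The action of \<open>\<pi>\<^sub>1(M, p e0)\<close> by deck transformations: the class of a loop acts by the (unique)
  deck transformation that moves \<open>e0\<close> to the endpoint of the lift of the loop starting at \<open>e0\<close>.
  As \<open>g +++ h\<close> runs through \<open>g\<close> first, this is a left action.\<close>

definition deck_action ::
  "'a::topological_space set \<Rightarrow> 'b::topological_space set \<Rightarrow> ('b \<Rightarrow> 'a) \<Rightarrow> 'b
    \<Rightarrow> ((real \<Rightarrow> 'a) set \<Rightarrow> 'b \<Rightarrow> 'b) \<Rightarrow> bool" where
  "deck_action M E p e0 \<delta> \<longleftrightarrow>
     (\<forall>\<gamma>\<in>carrier (fundamental_group M (p e0)).
        deck_transformation E p (\<delta> \<gamma>) \<and>
        (\<exists>h. path h \<and> path_image h \<subseteq> E \<and> pathstart h = e0 \<and> p \<circ> h \<in> \<gamma> \<and>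
             pathfinish h = \<delta> \<gamma> e0))"


section \<open>Tensor products over integral group rings\<close>

text \<open>A right (left) module over the group ring of \<open>G\<close> is encoded by its underlying additive group,
  written as a \<open>monoid\<close> record, and the right (left) action of \<open>G\<close> on it. The balancing relation
  over the group ring then follows by bilinearity from the one for elements of \<open>G\<close>.\<close>

record ('g, 'm) right_module = "'m monoid" +
  ract :: "'m \<Rightarrow> 'g \<Rightarrow> 'm"

record ('g, 'm) left_module = "'m monoid" +
  lact :: "'g \<Rightarrow> 'm \<Rightarrow> 'm"

definition tensor_relators ::
  "'g monoid \<Rightarrow> ('g, 'a) right_module \<Rightarrow> ('g, 'c) left_module \<Rightarrow> (('a \<times> 'c) \<Rightarrow>\<^sub>0 int) set" where
  "tensor_relators G A C =
     {frag_of (a \<otimes>\<^bsub>A\<^esub> a', c) - frag_of (a, c) - frag_of (a', c) | a a' c.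
        a \<in> carrier A \<and> a' \<in> carrier A \<and> c \<in> carrier C} \<union>
     {frag_of (a, c \<otimes>\<^bsub>C\<^esub> c') - frag_of (a, c) - frag_of (a, c') | a c c'.
        a \<in> carrier A \<and> c \<in> carrier C \<and> c' \<in> carrier C} \<union>
     {frag_of (ract A a g, c) - frag_of (a, lact C g c) | a g c.
        a \<in> carrier A \<and> g \<in> carrier G \<and> c \<in> carrier C}"

definition tensor_relations ::
  "'g monoid \<Rightarrow> ('g, 'a) right_module \<Rightarrow> ('g, 'c) left_module \<Rightarrow> (('a \<times> 'c) \<Rightarrow>\<^sub>0 int) set" where
  "tensor_relations G A C =
     generate (free_Abelian_group (carrier A \<times> carrier C)) (tensor_relators G A C)"

definition tensor ::
  "'g monoid \<Rightarrow> ('g, 'a) right_module \<Rightarrow> ('g, 'c) left_module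
    \<Rightarrow> (('a \<times> 'c) \<Rightarrow>\<^sub>0 int) set monoid" where
  "tensor G A C = free_Abelian_group (carrier A \<times> carrier C) Mod tensor_relations G A C"

text \<open>The element of the tensor product represented by a formal sum of pairs.\<close>

definition tensor_class ::
  "'g monoid \<Rightarrow> ('g, 'a) right_module \<Rightarrow> ('g, 'c) left_module
    \<Rightarrow> (('a \<times> 'c) \<Rightarrow>\<^sub>0 int) \<Rightarrow> (('a \<times> 'c) \<Rightarrow>\<^sub>0 int) set" where
  "tensor_class G A C u =
     tensor_relations G A C #>\<^bsub>free_Abelian_group (carrier A \<times> carrier C)\<^esub> u"

text \<open>The map \<open>\<phi> \<otimes> \<psi>\<close> into the tensor product of \<open>A'\<close> and \<open>C'\<close>; for equivariant homomorphisms
  \<open>\<phi>\<close> and \<open>\<psi>\<close> all sets in the union coincide.\<close>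

definition tensor_map ::
  "'g monoid \<Rightarrow> ('g, 'b) right_module \<Rightarrow> ('g, 'd) left_module \<Rightarrow> ('a \<Rightarrow> 'b) \<Rightarrow> ('c \<Rightarrow> 'd)
    \<Rightarrow> (('a \<times> 'c) \<Rightarrow>\<^sub>0 int) set \<Rightarrow> (('b \<times> 'd) \<Rightarrow>\<^sub>0 int) set" where
  "tensor_map G A' C' \<phi> \<psi> T =
     (\<Union>u\<in>T. tensor_class G A' C' (frag_extend (\<lambda>(a, c). frag_of (\<phi> a, \<psi> c)) u))"


section \<open>Singular chains with twisted coefficients\<close>

definition chain_module ::
  "nat \<Rightarrow> 'b::topological_space set \<Rightarrow> ('g \<Rightarrow> 'b \<Rightarrow> 'b) \<Rightarrow> ('g, 'b chain) left_module" where
  "chain_module q E \<delta> =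
     \<lparr> carrier = carrier (chain_group q (top_of_set E)),
       monoid.mult = monoid.mult (chain_group q (top_of_set E)),
       one = one (chain_group q (top_of_set E)),
       lact = (\<lambda>g. chain_map q (\<delta> g)) \<rparr>"

abbreviation twisted_chains ::
  "nat \<Rightarrow> 'g monoid \<Rightarrow> 'b::topological_space set \<Rightarrow> ('g \<Rightarrow> 'b \<Rightarrow> 'b) \<Rightarrow> ('g, 'm) right_module
    \<Rightarrow> (('m \<times> 'b chain) \<Rightarrow>\<^sub>0 int) set monoid" where
  "twisted_chains q G E \<delta> A \<equiv> tensor G A (chain_module q E \<delta>)"

definition twisted_boundary ::
  "nat \<Rightarrow> 'g monoid \<Rightarrow> 'b::topological_space set \<Rightarrow> ('g \<Rightarrow> 'b \<Rightarrow> 'b) \<Rightarrow> ('g, 'm) right_module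
    \<Rightarrow> (('m \<times> 'b chain) \<Rightarrow>\<^sub>0 int) set \<Rightarrow> (('m \<times> 'b chain) \<Rightarrow>\<^sub>0 int) set" where
  "twisted_boundary q G E \<delta> A = tensor_map G A (chain_module (q - 1) E \<delta>) id (chain_boundary q)"

definition trivial_integers :: "('g, int) right_module" where
  "trivial_integers = \<lparr> carrier = UNIV, monoid.mult = (+), one = 0, ract = (\<lambda>k g. k) \<rparr>"

text \<open>The identification of \<open>\<int> \<otimes> C\<^sub>q(E)\<close> with \<open>C\<^sub>q(M)\<close>, mapping \<open>k \<otimes> \<sigma>\<close> to \<open>k \<cdot> (p \<circ> \<sigma>)\<close>.\<close>

definition untwist :: "nat \<Rightarrow> ('b \<Rightarrow> 'a) \<Rightarrow> ((int \<times> 'b chain) \<Rightarrow>\<^sub>0 int) set \<Rightarrow> 'a chain" where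
  "untwist q p T = the_elem (frag_extend (\<lambda>(k, c). frag_cmul k (chain_map q p c)) ` T)"


section \<open>Standard probability actions\<close>

text \<open>Since a Polish topology can be transported along a bijection, it is no restriction that \<open>T\<close>
  lives on the same type as \<open>X\<close>. Only the measurable structure of \<open>X\<close> matters.\<close>

definition standard_borel :: "'x measure \<Rightarrow> bool" where
  "standard_borel X \<longleftrightarrow>
     (\<exists>(T :: 'x topology) f.
        completely_metrizable_space T \<and> separable_space T \<and>
        bij_betw f (space X) (topspace T) \<and>
        f \<in> X \<rightarrow>\<^sub>M sigma (topspace T) {U. openin T U} \<and>
        the_inv_into (space X) f \<in> sigma (topspace T) {U. openin T U} \<rightarrow>\<^sub>M X)"

definition standard_action :: "'g monoid \<Rightarrow> 'x measure \<Rightarrow> ('g \<Rightarrow> 'x \<Rightarrow> 'x) \<Rightarrow> bool" where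
  "standard_action G X \<alpha> \<longleftrightarrow>
     standard_borel X \<and> countable (carrier G) \<and> group_action G (space X) \<alpha> \<and>
     (\<forall>\<gamma>\<in>carrier G. \<alpha> \<gamma> \<in> X \<rightarrow>\<^sub>M X)"

definition invariant_probability :: "'g monoid \<Rightarrow> 'x measure \<Rightarrow> ('g \<Rightarrow> 'x \<Rightarrow> 'x) \<Rightarrow> 'x measure set" where
  "invariant_probability G X \<alpha> =
     {\<nu>. sets \<nu> = sets X \<and> prob_space \<nu> \<and> (\<forall>\<gamma>\<in>carrier G. distr \<nu> X (\<alpha> \<gamma>) = \<nu>)}"

definition standard_probability_action ::
  "'g monoid \<Rightarrow> 'x measure \<Rightarrow> ('g \<Rightarrow> 'x \<Rightarrow> 'x) \<Rightarrow> 'x measure \<Rightarrow> bool" where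
  "standard_probability_action G X \<alpha> \<mu> \<longleftrightarrow>
     standard_action G X \<alpha> \<and> \<mu> \<in> invariant_probability G X \<alpha>"

definition Erg :: "'g monoid \<Rightarrow> 'x measure \<Rightarrow> ('g \<Rightarrow> 'x \<Rightarrow> 'x) \<Rightarrow> 'x measure set" where
  "Erg G X \<alpha> =
     {\<nu> \<in> invariant_probability G X \<alpha>.
        \<forall>A\<in>sets X. (\<Union>\<gamma>\<in>carrier G. \<alpha> \<gamma> ` A) = A \<longrightarrow> measure \<nu> A \<in> {0, 1}}"

definition ergodic_decomposition ::
  "'g monoid \<Rightarrow> 'x measure \<Rightarrow> ('g \<Rightarrow> 'x \<Rightarrow> 'x) \<Rightarrow> 'x measure \<Rightarrow> ('x \<Rightarrow> 'x measure) \<Rightarrow> bool" where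
  "ergodic_decomposition G X \<alpha> \<mu> \<beta> \<longleftrightarrow>
     \<beta> \<in> space X \<rightarrow> Erg G X \<alpha> \<and>
     (\<forall>A\<in>sets X. (\<lambda>x. measure (\<beta> x) A) \<in> borel_measurable X) \<and>
     (\<forall>A\<in>sets X. measure \<mu> A = (\<integral>x. measure (\<beta> x) A \<partial>\<mu>)) \<and>
     (\<forall>x\<in>space X. \<forall>\<gamma>\<in>carrier G. \<beta> (\<alpha> \<gamma> x) = \<beta> x) \<and>
     (\<forall>\<nu>\<in>Erg G X \<alpha>. {x \<in> space X. \<beta> x = \<nu>} \<in> sets X \<and> measure \<nu> {x \<in> space X. \<beta> x = \<nu>} = 1)"


section \<open>Parametrised simplicial volume\<close>

definition Linf_functions :: "'x measure \<Rightarrow> ('x \<Rightarrow> int) set" where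
  "Linf_functions \<nu> = {f \<in> \<nu> \<rightarrow>\<^sub>M count_space UNIV. \<exists>B. AE x in \<nu>. \<bar>f x\<bar> \<le> B}"

definition Linf_class :: "'x measure \<Rightarrow> ('x \<Rightarrow> int) \<Rightarrow> ('x \<Rightarrow> int) set" where
  "Linf_class \<nu> f = {g \<in> Linf_functions \<nu>. AE x in \<nu>. g x = f x}"

definition Linf :: "('g \<Rightarrow> 'x \<Rightarrow> 'x) \<Rightarrow> 'x measure \<Rightarrow> ('g, ('x \<Rightarrow> int) set) right_module" where
  "Linf \<alpha> \<nu> =
     \<lparr> carrier = Linf_class \<nu> ` Linf_functions \<nu>,
       monoid.mult = (\<lambda>F H. \<Union>f\<in>F. \<Union>h\<in>H. Linf_class \<nu> (\<lambda>x. f x + h x)),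
       one = Linf_class \<nu> (\<lambda>_. 0),
       ract = (\<lambda>F \<gamma>. \<Union>f\<in>F. Linf_class \<nu> (\<lambda>x. f (\<alpha> \<gamma> x))) \<rparr>"

text \<open>In the following, \<open>fM\<close> is the integral fundamental class of the \<open>n\<close>-manifold \<open>M\<close>, and
  \<open>G\<close> acts on the total space \<open>E\<close> of the universal covering \<open>p\<close> of \<open>M\<close> by \<open>\<delta>\<close>. The chain \<open>z\<close> is
  an integral fundamental cycle, whose image under the inclusion of constant functions is
  homologous to \<open>c\<close>.\<close>

definition parametrised_fundamental_cycle ::
  "nat \<Rightarrow> 'a::topological_space set \<Rightarrow> 'a chain set \<Rightarrow> 'g monoid \<Rightarrow> 'b::topological_space set
    \<Rightarrow> ('b \<Rightarrow> 'a) \<Rightarrow> ('g \<Rightarrow> 'b \<Rightarrow> 'b) \<Rightarrow> ('g \<Rightarrow> 'x \<Rightarrow> 'x) \<Rightarrow> 'x measure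
    \<Rightarrow> ((('x \<Rightarrow> int) set \<times> 'b chain) \<Rightarrow>\<^sub>0 int) set \<Rightarrow> bool" where
  "parametrised_fundamental_cycle n M fM G E p \<delta> \<alpha> \<nu> c \<longleftrightarrow>
     c \<in> carrier (twisted_chains n G E \<delta> (Linf \<alpha> \<nu>)) \<and>
     twisted_boundary n G E \<delta> (Linf \<alpha> \<nu>) c = one (twisted_chains (n - 1) G E \<delta> (Linf \<alpha> \<nu>)) \<and>
     (\<exists>z\<in>carrier (twisted_chains n G E \<delta> trivial_integers).
        singular_relcycle n (top_of_set M) {} (untwist n p z) \<and>
        homologous_rel_set n (top_of_set M) {} (untwist n p z) = fM \<and>
        (\<exists>b\<in>carrier (twisted_chains (Suc n) G E \<delta> (Linf \<alpha> \<nu>)).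
           c = tensor_map G (Linf \<alpha> \<nu>) (chain_module n E \<delta>) (\<lambda>k. Linf_class \<nu> (\<lambda>_. k)) id z
               \<otimes>\<^bsub>twisted_chains n G E \<delta> (Linf \<alpha> \<nu>)\<^esub>
               twisted_boundary (Suc n) G E \<delta> (Linf \<alpha> \<nu>) b))"

text \<open>The chain \<open>c\<close> is the sum of the \<open>f j \<otimes> \<sigma> j\<close> over \<open>j < m\<close>, in reduced form.\<close>

definition reduced_form ::
  "nat \<Rightarrow> 'g monoid \<Rightarrow> 'b::topological_space set \<Rightarrow> ('b \<Rightarrow> 'a) \<Rightarrow> ('g \<Rightarrow> 'b \<Rightarrow> 'b) \<Rightarrow> ('g \<Rightarrow> 'x \<Rightarrow> 'x) \<Rightarrow> 'x measure
    \<Rightarrow> ((('x \<Rightarrow> int) set \<times> 'b chain) \<Rightarrow>\<^sub>0 int) set \<Rightarrow> nat \<Rightarrow> (nat \<Rightarrow> 'x \<Rightarrow> int) \<Rightarrow> (nat \<Rightarrow> (nat \<Rightarrow> real) \<Rightarrow> 'b) \<Rightarrow> bool" where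
  "reduced_form n G E p \<delta> \<alpha> \<nu> c m f \<sigma> \<longleftrightarrow>
     (\<forall>j<m. f j \<in> Linf_functions \<nu> \<and> singular_simplex n (top_of_set E) (\<sigma> j)) \<and>
     (\<forall>j<m. \<forall>k<m. j \<noteq> k \<longrightarrow> simplex_map n p (\<sigma> j) \<noteq> simplex_map n p (\<sigma> k)) \<and>
     c = tensor_class G (Linf \<alpha> \<nu>) (chain_module n E \<delta>)
           (\<Sum>j<m. frag_of (Linf_class \<nu> (f j), frag_of (\<sigma> j)))"

definition parametrised_norm ::
  "nat \<Rightarrow> 'g monoid \<Rightarrow> 'b::topological_space set \<Rightarrow> ('b \<Rightarrow> 'a) \<Rightarrow> ('g \<Rightarrow> 'b \<Rightarrow> 'b) \<Rightarrow> ('g \<Rightarrow> 'x \<Rightarrow> 'x) \<Rightarrow> 'x measure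
    \<Rightarrow> ((('x \<Rightarrow> int) set \<times> 'b chain) \<Rightarrow>\<^sub>0 int) set \<Rightarrow> real" where
  "parametrised_norm n G E p \<delta> \<alpha> \<nu> c =
     (THE r. \<exists>m f \<sigma>. reduced_form n G E p \<delta> \<alpha> \<nu> c m f \<sigma> \<and>
        r = (\<Sum>j<m. \<integral>x. real_of_int \<bar>f j x\<bar> \<partial>\<nu>))"

definition parametrised_simplicial_volume ::
  "nat \<Rightarrow> 'a::topological_space set \<Rightarrow> 'a chain set \<Rightarrow> 'g monoid \<Rightarrow> 'b::topological_space set
    \<Rightarrow> ('b \<Rightarrow> 'a) \<Rightarrow> ('g \<Rightarrow> 'b \<Rightarrow> 'b) \<Rightarrow> ('g \<Rightarrow> 'x \<Rightarrow> 'x) \<Rightarrow> 'x measure \<Rightarrow> real" where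
  "parametrised_simplicial_volume n M fM G E p \<delta> \<alpha> \<nu> =
     Inf (parametrised_norm n G E p \<delta> \<alpha> \<nu> `
            {c. parametrised_fundamental_cycle n M fM G E p \<delta> \<alpha> \<nu> c})"

end

theory Submission
  imports Defs
begin

text \<open>Choose a lift to \<open>E\<close> of every simplex of \<open>M\<close>. A chain with \<open>L\<^sup>\<infinity>\<close>-coefficients can then be
  evaluated at a point \<open>x\<close> of \<open>X\<close>, which gives an integral chain of \<open>M\<close>, and the parametrised norm is
  the integral over \<open>x\<close> of the \<open>l\<^sup>1\<close>-norm of this chain. Hence the parametrised simplicial volume for
  \<open>\<nu>\<close> is the infimum of explicit functionals \<open>N\<^sub>u(\<nu>)\<close> that are affine in \<open>\<nu>\<close>, where \<open>u\<close> ranges over the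
  chains of degree \<open>n + 1\<close> whose boundary is added to a fixed integral fundamental cycle. By density the
  coefficients of \<open>u\<close> may be taken from a countable set that is the same for all \<open>\<nu>\<close>. There are
  uncountably many simplices, but \<open>N\<^sub>u\<close> only sees which of the finitely many simplices in the boundary
  of \<open>u\<close> coincide in \<open>M\<close>, so only countably many functionals occur. This yields measurability and
  the inequality \<open>\<ge>\<close>. For \<open>\<le>\<close>, almost optimal chains for the ergodic measures \<open>\<beta>\<^sub>x\<close> are glued along
  finitely many of the sets on which a fixed \<open>u\<close> is almost optimal. These sets are unions of
  fibres of \<open>\<beta>\<close>, so they are invariant and \<open>\<beta>\<^sub>x\<close> gives them measure 0 or 1.\<close>

section \<open>Lifting along coverings of topological spaces\<close>

text \<open>Classes modulo null sets of \<open>\<mu>\<close> and of \<open>\<beta> x\<close> cannot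
  be compared, so every measure is tested against the same honest functions on X. Evaluation at
  points works because the fundamental group acts freely on the simplices of E and transitively on
  the lifts of each simplex of M: the relation F \<otimes> g\<sigma> = F\<cdot>g \<otimes> \<sigma>
  moves a simplex to its chosen lift at the price of translating the coefficient. Translation
  preserves integrals against invariant measures; this makes the norm independent of the lifts and
  gives the estimate behind the density argument. Two obstacles shape the measure theory. An infimum
  of uncountably many measurable functions need not be measurable, whence the insistence on
  countably many functionals, the same for all measures. And chains are finite sums with bounded
  coefficients, so only finitely many almost optimal chains can be glued; on the small set left over
  nothing is added, and there the original cycle has bounded norm.\<close>

lemma covering_space_evenly_covered:
  assumes cov: "covering_space C p S" and y: "y \<in> S"
  obtains U v where "y \<in> U" "openin (top_of_set S) U" "\<Union>v = C \<inter> p -` U"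
    "\<And>u. u \<in> v \<Longrightarrow> openin (top_of_set C) u" "pairwise disjnt v"
    "\<And>u. u \<in> v \<Longrightarrow> \<exists>q. homeomorphism u U p q"
  using assms unfolding covering_space_def by metis

lemma continuous_on_openin_vimage:
  assumes "continuous_on T f" "f \<in> T \<rightarrow> S" "openin (top_of_set S) U"
  shows "openin (top_of_set T) {x \<in> T. f x \<in> U}"
proof -
  have "{x \<in> T. f x \<in> U} = T \<inter> f -` U" by blast
  then show ?thesis
    using continuous_openin_preimage[OF assms] by simp
qed

text \<open>Agreement of two lifts is locally constant: near z they take values in sheets u1 and u2
  over one evenly covered U. Agreement at a single point forces u1 = u2 since the sheets are
  disjoint, and p is injective on a sheet. Connectedness of T does the rest.\<close>

lemma covering_lift_unique:
  fixes p :: "'a::topological_space \<Rightarrow> 'b::topological_space"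
  assumes cov: "covering_space C p S"
    and g1: "continuous_on T g1" "g1 \<in> T \<rightarrow> C" and g2: "continuous_on T g2" "g2 \<in> T \<rightarrow> C"
    and eq: "\<And>x. x \<in> T \<Longrightarrow> p (g1 x) = p (g2 x)"
    and T: "connected T" "a \<in> T" "x \<in> T" and a: "g1 a = g2 a"
  shows "g1 x = g2 x"
proof -
  let ?E = "{x \<in> T. g1 x = g2 x}"
  have *: "\<exists>W. openin (top_of_set T) W \<and> z \<in> W \<and> (\<forall>x\<in>W. \<forall>y\<in>W. g1 x = g2 x \<longrightarrow> g1 y = g2 y)"
    if z: "z \<in> T" for z
  proof -
    have "p (g1 z) \<in> S" using cov g1 z by (auto simp: covering_space_def)
    from covering_space_evenly_covered[OF cov this]
    obtain U v where U: "p (g1 z) \<in> U" "openin (top_of_set S) U" "\<Union>v = C \<inter> p -` U"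
      and v: "\<And>u. u \<in> v \<Longrightarrow> openin (top_of_set C) u" "pairwise disjnt v"
        "\<And>u. u \<in> v \<Longrightarrow> \<exists>q. homeomorphism u U p q" by blast
    have "g1 z \<in> \<Union>v" "g2 z \<in> \<Union>v" using U g1 g2 z eq[OF z] by auto
    then obtain u1 u2 where u: "u1 \<in> v" "u2 \<in> v" "g1 z \<in> u1" "g2 z \<in> u2" by blast
    let ?W = "{x \<in> T. g1 x \<in> u1} \<inter> {x \<in> T. g2 x \<in> u2}"
    have "openin (top_of_set T) ?W"
      by (intro openin_Int continuous_on_openin_vimage[OF g1] continuous_on_openin_vimage[OF g2] v u)
    moreover have "g1 y = g2 y" if "x \<in> ?W" "y \<in> ?W" "g1 x = g2 x" for x y
    proof -
      have "u1 = u2" using that u v(2) by (auto simp: pairwise_def disjnt_def)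
      moreover obtain q where "homeomorphism u1 U p q" using v u by blast
      ultimately show ?thesis using that eq[of y] by (auto simp: homeomorphism_def) metis
    qed
    ultimately show ?thesis using z u by (intro exI[of _ ?W]) blast
  qed
  show ?thesis
    using connected_induction_simple[of T a x "\<lambda>x. g1 x = g2 x"] T a * by blast
qed

text \<open>Connectedness of [0, 1] replaces a subdivision: P r says that a lift exists up to time r
  over some neighbourhood of y0, which may shrink as r grows. Over a short time interval h maps a
  product neighbourhood into one evenly covered set, so a lift up to time s extends by the inverse
  of p on the sheet reached at time s.\<close>

lemma covering_homotopy_local_lift:
  fixes p :: "'a::topological_space \<Rightarrow> 'b::topological_space"
    and h :: "real \<times> 'c::topological_space \<Rightarrow> 'b"
  assumes cov: "covering_space C p S"
    and h: "continuous_on ({0..1} \<times> Y) h" "h \<in> ({0..1} \<times> Y) \<rightarrow> S"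
    and f: "continuous_on Y f" "f \<in> Y \<rightarrow> C" "\<And>y. y \<in> Y \<Longrightarrow> h (0, y) = p (f y)"
    and y0: "y0 \<in> Y"
  shows "\<exists>V k. openin (top_of_set Y) V \<and> y0 \<in> V \<and> continuous_on ({0..1} \<times> V) k \<and>
           k \<in> ({0..1} \<times> V) \<rightarrow> C \<and> (\<forall>y\<in>V. k (0, y) = f y) \<and> (\<forall>z\<in>{0..1} \<times> V. p (k z) = h z)"
proof -
  define P where "P r \<longleftrightarrow> (\<exists>V k. openin (top_of_set Y) V \<and> y0 \<in> V \<and> continuous_on ({0..r} \<times> V) k \<and>
           k \<in> ({0..r} \<times> V) \<rightarrow> C \<and> (\<forall>y\<in>V. k (0, y) = f y) \<and> (\<forall>z\<in>{0..r} \<times> V. p (k z) = h z))" for r :: real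
  have P0: "P 0"
    unfolding P_def
  proof (intro exI[of _ Y] exI[of _ "\<lambda>z. f (snd z)"] conjI)
    show "continuous_on ({0..0} \<times> Y) (\<lambda>z. f (snd z))"
      by (rule continuous_on_compose2[OF f(1)]) (auto intro!: continuous_intros)
  qed (use y0 f in auto)
  have P_mono: "P s" if "P t" "s \<le> t" for s t
  proof -
    obtain V k where Vk: "openin (top_of_set Y) V" "y0 \<in> V" "continuous_on ({0..t} \<times> V) k"
      "k \<in> ({0..t} \<times> V) \<rightarrow> C" "\<forall>y\<in>V. k (0, y) = f y" "\<forall>z\<in>{0..t} \<times> V. p (k z) = h z"
      using \<open>P t\<close> unfolding P_def by blast
    have "{0..s} \<times> V \<subseteq> {0..t} \<times> V" using that by auto
    with Vk show ?thesis unfolding P_def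
      by (intro exI[of _ V] exI[of _ k]) (blast intro: continuous_on_subset)
  qed
  have step: "\<exists>T. openin (top_of_set {0..1}) T \<and> t0 \<in> T \<and> (\<forall>x\<in>T. \<forall>y\<in>T. P x \<longrightarrow> P y)"
    if t0: "t0 \<in> {0..1}" for t0
  proof -
    have "h (t0, y0) \<in> S" using h t0 y0 by auto
    from covering_space_evenly_covered[OF cov this]
    obtain U v where U: "h (t0, y0) \<in> U" "openin (top_of_set S) U" "\<Union>v = C \<inter> p -` U"
      and v: "\<And>u. u \<in> v \<Longrightarrow> openin (top_of_set C) u" "pairwise disjnt v"
        "\<And>u. u \<in> v \<Longrightarrow> \<exists>q. homeomorphism u U p q" by blast
    have "openin (top_of_set ({0..1} \<times> Y)) {z \<in> {0..1} \<times> Y. h z \<in> U}"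
      by (rule continuous_on_openin_vimage[OF h U(2)])
    then obtain A B where AB: "openin (top_of_set {0..1::real}) A" "t0 \<in> A" "openin (top_of_set Y) B" "y0 \<in> B"
      "A \<times> B \<subseteq> {z \<in> {0..1} \<times> Y. h z \<in> U}"
      using Times_in_interior_subtopology[of t0 y0 "{z \<in> {0..1} \<times> Y. h z \<in> U}" "{0..1}" Y] U t0 y0 by auto
    obtain d where d: "d > 0" "{0..1} \<inter> ball t0 d \<subseteq> A"
      using AB(1,2) by (auto simp: openin_contains_ball Int_commute)
    let ?T = "{0..1} \<inter> ball t0 d"
    have "P t" if st: "s \<in> ?T" "t \<in> ?T" "P s" for s t
    proof (cases "t \<le> s")
      case True then show ?thesis using P_mono that by blast
    next
      case False
      obtain V k where V: "openin (top_of_set Y) V" "y0 \<in> V" and k: "continuous_on ({0..s} \<times> V) k"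
        "k \<in> ({0..s} \<times> V) \<rightarrow> C" "\<forall>y\<in>V. k (0, y) = f y" "\<forall>z\<in>{0..s} \<times> V. p (k z) = h z"
        using \<open>P s\<close> unfolding P_def by blast
      have s0: "0 \<le> s" "s \<in> A" using st d by auto
      have "p (k (s, y0)) \<in> U" using k(4) V AB s0 by auto
      moreover have "k (s, y0) \<in> C" using k(2) V s0 by auto
      ultimately obtain u where u: "u \<in> v" "k (s, y0) \<in> u" using U(3) by blast
      obtain q where q: "homeomorphism u U p q" using v u by blast
      have uC: "u \<subseteq> C" using v(1)[OF u(1)] openin_imp_subset by blast
      have ks: "continuous_on V (\<lambda>y. k (s, y))" "(\<lambda>y. k (s, y)) \<in> V \<rightarrow> C"
        using s0 k(1,2) by (auto intro!: continuous_on_compose2[OF k(1)] continuous_intros)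
      \<comment> \<open>On V2 the lift at time s lies in the single sheet u, and h stays in U
        between times s and t. The first makes both halves of \<open>k'\<close> agree at time s, the
        second makes q applicable.\<close>
      define V2 where "V2 = {y \<in> V. k (s, y) \<in> u} \<inter> B"
      have V2: "openin (top_of_set Y) V2" "y0 \<in> V2" "V2 \<subseteq> V" "V2 \<subseteq> B"
      proof -
        have "openin (top_of_set V) {y \<in> V. k (s, y) \<in> u}"
          by (rule continuous_on_openin_vimage[OF ks v(1)[OF u(1)]])
        then show "openin (top_of_set Y) V2" unfolding V2_def
          by (intro openin_Int AB(3)) (use V(1) openin_trans in blast)
      qed (use V u AB in \<open>auto simp: V2_def\<close>)
      define k' where "k' z = (if fst z \<le> s then k z else q (h z))" for z
      have hU: "h (r, y) \<in> U" if "s \<le> r" "r \<le> t" "y \<in> V2" for r y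
      proof -
        have "r \<in> ?T" using st that by (auto simp: dist_real_def)
        then show ?thesis using d AB V2 that by blast
      qed
      have "continuous_on ({0..t} \<times> V2) k'"
        unfolding k'_def
      proof (rule continuous_on_cases_le)
        show "continuous_on {x \<in> {0..t} \<times> V2. fst x \<le> s} k"
          by (rule continuous_on_subset[OF k(1)]) (use V2 in auto)
        have "continuous_on {x \<in> {0..t} \<times> V2. s \<le> fst x} h"
          by (rule continuous_on_subset[OF h(1)]) (use V2 V openin_imp_subset[OF V(1)] st in auto)
        then show "continuous_on {x \<in> {0..t} \<times> V2. s \<le> fst x} (\<lambda>z. q (h z))"
          by (rule continuous_on_compose2[OF homeomorphism_cont2[OF q]]) (use hU in auto)
        show "continuous_on ({0..t} \<times> V2) fst" by (intro continuous_intros)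
        fix z assume z: "z \<in> {0..t} \<times> V2" "fst z = s"
        then obtain y where y: "z = (s, y)" "y \<in> V2" by (cases z) auto
        then have "k z \<in> u" "h z = p (k z)" using k(4) s0 V2 by (auto simp: V2_def)
        then show "k z = q (h z)" using q by (simp add: homeomorphism_def)
      qed
      moreover have "k' \<in> ({0..t} \<times> V2) \<rightarrow> C"
      proof
        fix z assume z: "z \<in> {0..t} \<times> V2"
        have "q w \<in> C" if "w \<in> U" for w using q uC that by (auto simp: homeomorphism_def)
        then show "k' z \<in> C" using z k(2) V2 hU[of "fst z" "snd z"] by (cases z) (auto simp: k'_def)
      qed
      moreover have "\<forall>y\<in>V2. k' (0, y) = f y" using k(3) V2 s0 by (auto simp: k'_def)
      moreover have "p (k' z) = h z" if z: "z \<in> {0..t} \<times> V2" for z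
        using z k(4) V2 hU[of "fst z" "snd z"] q by (cases z) (auto simp: k'_def homeomorphism_def)
      ultimately show "P t" unfolding P_def using V2 by blast
    qed
    moreover have "openin (top_of_set {0..1}) ?T" "t0 \<in> ?T" using t0 d by (auto simp: openin_open)
    ultimately show ?thesis by blast
  qed
  have "P 1"
    by (rule connected_induction_simple[of "{0..1::real}" 0 1 P]) (use P0 step in auto)
  then show ?thesis unfolding P_def by blast
qed

text \<open>For fixed x the path t -> \<open>k y (t, x)\<close> is a lift starting at
  \<open>f x\<close>, whatever y is. Uniqueness of lifts makes the local lifts agree on overlaps, so
  they paste to a continuous map.\<close>

lemma covering_homotopy_lift:
  fixes p :: "'a::topological_space \<Rightarrow> 'b::topological_space"
    and h :: "real \<times> 'c::topological_space \<Rightarrow> 'b"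
  assumes cov: "covering_space C p S"
    and h: "continuous_on ({0..1} \<times> Y) h" "h \<in> ({0..1} \<times> Y) \<rightarrow> S"
    and f: "continuous_on Y f" "f \<in> Y \<rightarrow> C" "\<And>y. y \<in> Y \<Longrightarrow> h (0, y) = p (f y)"
  obtains k where "continuous_on ({0..1} \<times> Y) k" "k \<in> ({0..1} \<times> Y) \<rightarrow> C"
    "\<And>y. y \<in> Y \<Longrightarrow> k (0, y) = f y" "\<And>z. z \<in> {0..1} \<times> Y \<Longrightarrow> p (k z) = h z"
proof -
  have "\<forall>y\<in>Y. \<exists>V k. openin (top_of_set Y) V \<and> y \<in> V \<and> continuous_on ({0..1} \<times> V) k \<and>
           k \<in> ({0..1} \<times> V) \<rightarrow> C \<and> (\<forall>y\<in>V. k (0, y) = f y) \<and> (\<forall>z\<in>{0..1} \<times> V. p (k z) = h z)"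
    using covering_homotopy_local_lift[OF cov h f] by blast
  from bchoice[OF this] obtain V where "\<forall>y\<in>Y. \<exists>k. openin (top_of_set Y) (V y) \<and> y \<in> V y \<and>
      continuous_on ({0..1} \<times> V y) k \<and> k \<in> ({0..1} \<times> V y) \<rightarrow> C \<and> (\<forall>x\<in>V y. k (0, x) = f x) \<and>
      (\<forall>z\<in>{0..1} \<times> V y. p (k z) = h z)" ..
  from bchoice[OF this] obtain k where "\<forall>y\<in>Y. openin (top_of_set Y) (V y) \<and> y \<in> V y \<and>
      continuous_on ({0..1} \<times> V y) (k y) \<and> k y \<in> ({0..1} \<times> V y) \<rightarrow> C \<and> (\<forall>x\<in>V y. k y (0, x) = f x) \<and>
      (\<forall>z\<in>{0..1} \<times> V y. p (k y z) = h z)" ..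
  then have V: "\<And>y. y \<in> Y \<Longrightarrow> openin (top_of_set Y) (V y)" "\<And>y. y \<in> Y \<Longrightarrow> y \<in> V y"
    and k: "\<And>y. y \<in> Y \<Longrightarrow> continuous_on ({0..1} \<times> V y) (k y)"
      "\<And>y. y \<in> Y \<Longrightarrow> k y \<in> ({0..1} \<times> V y) \<rightarrow> C" "\<And>y x. y \<in> Y \<Longrightarrow> x \<in> V y \<Longrightarrow> k y (0, x) = f x"
      "\<And>y z. y \<in> Y \<Longrightarrow> z \<in> {0..1} \<times> V y \<Longrightarrow> p (k y z) = h z"
    by blast+
  have VY: "V y \<subseteq> Y" if "y \<in> Y" for y using V(1)[OF that] openin_imp_subset by blast
  have agree: "k y (t, x) = k y' (t, x)" if "y \<in> Y" "y' \<in> Y" "x \<in> V y" "x \<in> V y'" "t \<in> {0..1}" for y y' x t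
  proof (rule covering_lift_unique[OF cov, of "{0..1}" "\<lambda>t. k y (t, x)" "\<lambda>t. k y' (t, x)" 0 t])
    show "continuous_on {0..1} (\<lambda>t. k y (t, x))" "continuous_on {0..1} (\<lambda>t. k y' (t, x))"
      using that by (auto intro!: continuous_on_compose2[OF k(1)] continuous_intros)
    show "(\<lambda>t. k y (t, x)) \<in> {0..1} \<rightarrow> C" "(\<lambda>t. k y' (t, x)) \<in> {0..1} \<rightarrow> C" using that k(2) by blast+
    show "\<And>t. t \<in> {0..1} \<Longrightarrow> p (k y (t, x)) = p (k y' (t, x))" using that k(4) by simp
  qed (use that k(3) in auto)
  define g where "g z = k (snd z) z" for z
  have g: "g (t, x) = k y (t, x)" if "y \<in> Y" "x \<in> V y" "t \<in> {0..1}" for y x t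
    using that agree[of x y x t] V(2)[of x] VY[of y] by (auto simp: g_def)
  have "continuous_map (top_of_set ({0..1} \<times> Y)) euclidean g"
  proof (rule pasting_lemma[where I=Y and T="\<lambda>y. {0..1} \<times> V y" and f=k])
    fix y assume y: "y \<in> Y"
    show "openin (top_of_set ({0..1} \<times> Y)) ({0..1} \<times> V y)"
      using V(1)[OF y] by (simp add: openin_Times_eq)
    have "({0..1::real} \<times> Y) \<inter> ({0..1} \<times> V y) = {0..1} \<times> V y" using VY[OF y] by auto
    then show "continuous_map (subtopology (top_of_set ({0..1} \<times> Y)) ({0..1} \<times> V y)) euclidean (k y)"
      using k(1)[OF y] by (simp only: subtopology_subtopology continuous_map_iff_continuous)
  next
    fix y y' z assume "y \<in> Y" "y' \<in> Y"
      "z \<in> topspace (top_of_set ({0..1::real} \<times> Y)) \<inter> ({0..1} \<times> V y) \<inter> ({0..1} \<times> V y')"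
    then show "k y z = k y' z" using agree[of y y' "snd z" "fst z"] by (cases z) simp
  next
    fix z assume "z \<in> topspace (top_of_set ({0..1::real} \<times> Y))"
    then show "\<exists>y. y \<in> Y \<and> z \<in> {0..1} \<times> V y \<and> g z = k y z"
      using V(2) by (cases z) (auto simp: g_def)
  qed
  then have "continuous_on ({0..1} \<times> Y) g" by simp
  then show thesis
  proof (rule that)
    show "g \<in> {0..1} \<times> Y \<rightarrow> C" using k(2) V by (auto simp: g_def Pi_iff)
    show "g (0, y) = f y" if "y \<in> Y" for y using that k(3) V by (auto simp: g_def)
    show "p (g z) = h z" if "z \<in> {0..1} \<times> Y" for z using that k(4) V by (auto simp: g_def)
  qed
qed

text \<open>A path is a homotopy between maps from a one-point space.\<close>

lemma covering_path_lift:
  fixes p :: "'a::topological_space \<Rightarrow> 'b::topological_space"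
  assumes cov: "covering_space C p S" and g: "path g" "path_image g \<subseteq> S" and a: "a \<in> C" "pathstart g = p a"
  obtains h where "path h" "path_image h \<subseteq> C" "pathstart h = a" "\<And>t. t \<in> {0..1} \<Longrightarrow> p (h t) = g t"
proof -
  have g': "continuous_on {0..1} g" "g ` {0..1} \<subseteq> S" using g by (auto simp: path_def path_image_def)
  obtain k :: "real \<times> real \<Rightarrow> 'a" where k: "continuous_on ({0..1} \<times> {0}) k" "k \<in> ({0..1} \<times> {0}) \<rightarrow> C"
    "\<And>y. y \<in> {0} \<Longrightarrow> k (0, y) = a" "\<And>z. z \<in> {0..1} \<times> {0} \<Longrightarrow> p (k z) = (\<lambda>z. g (fst z)) z"
  proof (rule covering_homotopy_lift[OF cov, of "{0::real}" "\<lambda>z. g (fst z)" "\<lambda>_. a"])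
    show "continuous_on ({0..1} \<times> {0::real}) (\<lambda>z. g (fst z))"
      by (rule continuous_on_compose2[OF g'(1)]) (auto intro!: continuous_intros)
  qed (use a g' in \<open>auto simp: pathstart_def\<close>)
  show thesis
  proof (rule that[of "\<lambda>t. k (t, 0)"])
    show "path (\<lambda>t. k (t, 0))" unfolding path_def
      by (rule continuous_on_compose2[OF k(1)]) (auto intro!: continuous_intros)
  qed (use k in \<open>auto simp: pathstart_def path_image_def\<close>)
qed

text \<open>Lift the homotopy with h1 as its initial edge. The two constant sides lift to constant
  paths, and the lift of the final edge starts where h2 does, hence is h2; so the endpoints
  agree.\<close>

lemma covering_monodromy:
  fixes p :: "'a::topological_space \<Rightarrow> 'b::topological_space"
  assumes cov: "covering_space C p S" and hom: "homotopic_paths S (p \<circ> h1) (p \<circ> h2)"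
    and h1: "path h1" "path_image h1 \<subseteq> C" and h2: "path h2" "path_image h2 \<subseteq> C"
    and start: "pathstart h1 = pathstart h2"
  shows "pathfinish h1 = pathfinish h2"
proof -
  obtain H :: "real \<times> real \<Rightarrow> 'b" where "continuous_on ({0..1} \<times> {0..1}) H \<and> H \<in> ({0..1} \<times> {0..1}) \<rightarrow> S \<and>
      (\<forall>x\<in>{0..1}. H (0, x) = p (h1 x)) \<and> (\<forall>x\<in>{0..1}. H (1, x) = p (h2 x)) \<and>
      (\<forall>t\<in>{0..1}. H (t, 0) = p (h1 0) \<and> H (t, 1) = p (h1 1))"
    using hom unfolding homotopic_paths pathstart_def pathfinish_def comp_apply ..
  then have H: "continuous_on ({0..1} \<times> {0..1}) H" "H \<in> ({0..1} \<times> {0..1}) \<rightarrow> S"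
    "\<And>x. x \<in> {0..1} \<Longrightarrow> H (0, x) = p (h1 x)" "\<And>x. x \<in> {0..1} \<Longrightarrow> H (1, x) = p (h2 x)"
    "\<And>t. t \<in> {0..1} \<Longrightarrow> H (t, 0) = p (h1 0)" "\<And>t. t \<in> {0..1} \<Longrightarrow> H (t, 1) = p (h1 1)"
    by blast+
  have c1: "continuous_on {0..1} h1" "h1 \<in> {0..1} \<rightarrow> C" "continuous_on {0..1} h2" "h2 \<in> {0..1} \<rightarrow> C"
    using h1 h2 by (auto simp: path_def path_image_def)
  obtain k where k: "continuous_on ({0..1} \<times> {0..1}) k" "k \<in> ({0..1} \<times> {0..1}) \<rightarrow> C"
    "\<And>y. y \<in> {0..1} \<Longrightarrow> k (0, y) = h1 y" "\<And>z. z \<in> {0..1} \<times> {0..1} \<Longrightarrow> p (k z) = H z"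
    using covering_homotopy_lift[OF cov H(1,2) c1(1,2) H(3)] by blast
  have slice: "continuous_on {0..1} (\<lambda>t. k (t, y))" "(\<lambda>t. k (t, y)) \<in> {0..1} \<rightarrow> C"
    "continuous_on {0..1} (\<lambda>t. k (y, t))" "(\<lambda>t. k (y, t)) \<in> {0..1} \<rightarrow> C" if "y \<in> {0..1}" for y
    using that k(2) by (auto intro!: continuous_on_compose2[OF k(1)] continuous_intros)
  have const: "k (1, y) = k (0, y)" if y: "y \<in> {0, 1}" for y
  proof (rule covering_lift_unique[OF cov, of "{0..1}" "\<lambda>t. k (t, y)" "\<lambda>_. k (0, y)" 0 1])
    show "p (k (x, y)) = p (k (0, y))" if "x \<in> {0..1}" for x using that y k(4) H by auto
  qed (use y slice[of y] k(2) in \<open>auto simp: Pi_iff\<close>)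
  have "k (1, 1) = h2 1"
  proof (rule covering_lift_unique[OF cov, of "{0..1}" "\<lambda>t. k (1, t)" h2 0 1])
    show "p (k (1, x)) = p (h2 x)" if "x \<in> {0..1}" for x using that k(4) H by auto
    show "k (1, 0) = h2 0" using const[of 0] k(3)[of 0] start by (simp add: pathstart_def)
  qed (use slice[of 1] c1 in auto)
  then show ?thesis using const[of 1] k(3)[of 1] by (simp add: pathfinish_def)
qed

section \<open>Simply connected spaces\<close>

lemma simply_connected_path_connected:
  fixes S :: "'a::topological_space set"
  assumes "simply_connected S"
  shows "path_connected S"
  unfolding path_connected_def
proof (intro ballI)
  fix x y assume xy: "x \<in> S" "y \<in> S"
  have "homotopic_loops S (\<lambda>_. x) (\<lambda>_. y)"
    using xy assms[unfolded simply_connected_def, rule_format, of "\<lambda>_. x" "\<lambda>_. y"]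
    by (force simp: path_def path_image_def pathstart_def pathfinish_def)
  then obtain h :: "real \<times> real \<Rightarrow> 'a" where h: "continuous_on ({0..1} \<times> {0..1}) h \<and> h \<in> ({0..1} \<times> {0..1}) \<rightarrow> S \<and>
      (\<forall>t\<in>{0..1}. h (0, t) = x) \<and> (\<forall>t\<in>{0..1}. h (1, t) = y) \<and>
      (\<forall>t\<in>{0..1}. pathfinish (h \<circ> Pair t) = pathstart (h \<circ> Pair t))"
    unfolding homotopic_loops ..
  \<comment> \<open>The base point of the moving loop traces a path from x to y.\<close>
  show "\<exists>g. path g \<and> path_image g \<subseteq> S \<and> pathstart g = x \<and> pathfinish g = y"
  proof (intro exI[of _ "\<lambda>s. h (s, 0)"] conjI)
    show "path (\<lambda>s. h (s, 0))" unfolding path_def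
      by (rule continuous_on_compose2[OF conjunct1[OF h]]) (auto intro!: continuous_intros)
  qed (use h in \<open>auto simp: path_image_def pathstart_def pathfinish_def\<close>)
qed

text \<open>Simple connectedness only provides a free homotopy H to a constant loop. The sides s ->
  H (s, 0) and s -> H (s, 1) coincide, so g is homotopic with fixed endpoints to the track of the
  base point run forth and back, and this contracts along itself.\<close>

lemma simply_connected_loop_null:
  fixes S :: "'a::topological_space set"
  assumes S: "simply_connected S" and g: "path g" "path_image g \<subseteq> S" "pathfinish g = pathstart g"
  shows "homotopic_paths S g (\<lambda>_. pathstart g)"
proof -
  let ?a = "pathstart g"
  have aS: "?a \<in> S" using g by (meson pathstart_in_path_image subsetD)
  have "homotopic_loops S g (\<lambda>_. ?a)"
    using g aS S[unfolded simply_connected_def, rule_format, of g "\<lambda>_. pathstart g"]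
    by (force simp: path_def path_image_def pathstart_def pathfinish_def)
  then obtain H :: "real \<times> real \<Rightarrow> 'a" where "continuous_on ({0..1} \<times> {0..1}) H \<and> H \<in> ({0..1} \<times> {0..1}) \<rightarrow> S \<and>
    (\<forall>t\<in>{0..1}. H (0, t) = g t) \<and> (\<forall>t\<in>{0..1}. H (1, t) = ?a) \<and> (\<forall>s\<in>{0..1}. H (s, 1) = H (s, 0))"
    unfolding homotopic_loops pathstart_def pathfinish_def comp_apply ..
  then have H: "continuous_on ({0..1} \<times> {0..1}) H" "H \<in> ({0..1} \<times> {0..1}) \<rightarrow> S"
    "\<And>t. t \<in> {0..1} \<Longrightarrow> H (0, t) = g t" "\<And>t. t \<in> {0..1} \<Longrightarrow> H (1, t) = ?a"
    "\<And>s. s \<in> {0..1} \<Longrightarrow> H (s, 0) = H (s, 1)"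
    by simp_all
  \<comment> \<open>In the convex square, the side \<open>{0} \<times> [0, 1]\<close> is homotopic to the path along the three other sides.\<close>
  define \<psi> :: "real \<Rightarrow> real \<times> real" where
    "\<psi> t = (min (min (3 * t) 1) (3 - 3 * t), max 0 (min (3 * t - 1) 1))" for t
  define \<tau> :: "real \<Rightarrow> real" where "\<tau> t = min (min (3 * t) 1) (3 - 3 * t)" for t
  have "homotopic_paths ({0..1} \<times> {0..1}) (\<lambda>t. (0, t)) \<psi>"
  proof (rule homotopic_paths_linear)
    show "path (\<lambda>t::real. (0::real, t))" "path \<psi>" unfolding path_def \<psi>_def by (intro continuous_intros)+
    fix t :: real assume t: "t \<in> {0..1}"
    have "convex ({0..1::real} \<times> {0..1::real})" by (intro convex_Times) auto
    then show "closed_segment (0, t) (\<psi> t) \<subseteq> {0..1} \<times> {0..1}"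
      using t by (intro closed_segment_subset) (auto simp: \<psi>_def)
  qed (auto simp: \<psi>_def pathstart_def pathfinish_def)
  from homotopic_paths_continuous_image[OF this H(1,2)]
  have 1: "homotopic_paths S (\<lambda>t. H (0, t)) (H \<circ> \<psi>)" by (simp add: comp_def)
  have 0: "homotopic_paths S g (\<lambda>t. H (0, t))" using g H(3) by (intro homotopic_paths_eq) auto
  have c: "continuous_on {0..1} (\<lambda>s. H (s, 0))" "(\<lambda>s. H (s, 0)) \<in> {0..1} \<rightarrow> S"
    using H(2) by (auto intro!: continuous_on_compose2[OF H(1)] continuous_intros)
  \<comment> \<open>\<open>\<tau>\<close> runs from 0 to 1, waits and returns to 0, so it contracts
    linearly to 0 inside [0, 1].\<close>
  have "homotopic_paths {0..1} \<tau> (\<lambda>_. 0)"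
  proof (rule homotopic_paths_linear)
    show "path \<tau>" "path (\<lambda>_::real. 0::real)" unfolding path_def \<tau>_def by (intro continuous_intros)+
    fix t :: real assume t: "t \<in> {0..1}"
    have "convex {0..1::real}" by auto
    then show "closed_segment (\<tau> t) 0 \<subseteq> {0..1}"
      using t by (intro closed_segment_subset) (auto simp: \<tau>_def)
  qed (auto simp: \<tau>_def pathstart_def pathfinish_def)
  from homotopic_paths_continuous_image[OF this c]
  have 2: "homotopic_paths S (\<lambda>t. H (\<tau> t, 0)) (\<lambda>_. H (0, 0))" by (simp add: comp_def)
  have eq: "(H \<circ> \<psi>) t = H (\<tau> t, 0)" if t: "t \<in> {0..1}" for t
  proof -
    consider "3 * t \<le> 1" | "1 \<le> 3 * t" "3 * t \<le> 2" | "3 * t \<ge> 2" by linarith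
    then show ?thesis
    proof cases
      case 1 then show ?thesis using t by (simp add: \<psi>_def \<tau>_def)
    next
      case 2
      then have "\<psi> t = (1, 3 * t - 1)" "\<tau> t = 1" by (auto simp: \<psi>_def \<tau>_def)
      then show ?thesis using 2 H(4)[of 0] H(4)[of "3 * t - 1"] by simp
    next
      case 3
      then have "\<psi> t = (3 - 3 * t, 1)" "\<tau> t = 3 - 3 * t" by (auto simp: \<psi>_def \<tau>_def)
      then show ?thesis using 3 t H(5)[of "3 - 3 * t"] by simp
    qed
  qed
  have "homotopic_paths S (H \<circ> \<psi>) (\<lambda>t. H (\<tau> t, 0))"
    using homotopic_paths_imp_path[OF 1] homotopic_paths_imp_subset[OF 1] eq by (intro homotopic_paths_eq) auto
  moreover have "H (0, 0) = ?a" using H(3)[of 0] by (simp add: pathstart_def)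
  ultimately show ?thesis using 0 1 2 by (metis homotopic_paths_trans)
qed

section \<open>Lifting singular simplices and chains\<close>

lemma singular_simplex_top_of_set:
  "singular_simplex q (top_of_set S) \<sigma> \<longleftrightarrow>
     continuous_on (standard_simplex q) \<sigma> \<and> \<sigma> \<in> standard_simplex q \<rightarrow> S \<and>
     \<sigma> \<in> extensional (standard_simplex q)"
  by (simp add: singular_simplex_def euclidean_product_topology continuous_map_in_subtopology image_subset_iff_funcset conj_assoc)

lemma connected_standard_simplex: "connected (standard_simplex q)"
  using connectedin_standard_simplex[of q] by (simp add: euclidean_product_topology)

text \<open>A simplex contracts linearly to one of its points v: c (0, y) = v and c (1, y) = y. Thus
  s \<circ> c is a homotopy that starts at the constant map with value s v, which lifts to e, and
  the end of the lifted homotopy lifts s.\<close>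

lemma covering_simplex_lift:
  fixes p :: "'a::topological_space \<Rightarrow> 'b::topological_space"
  assumes cov: "covering_space E p M" and s: "singular_simplex q (top_of_set M) s"
  obtains \<sigma> where "singular_simplex q (top_of_set E) \<sigma>" "simplex_map q p \<sigma> = s"
proof -
  have s': "continuous_on (standard_simplex q) s" "s \<in> standard_simplex q \<rightarrow> M" "s \<in> extensional (standard_simplex q)"
    using s by (auto simp: singular_simplex_top_of_set)
  obtain v where v: "v \<in> standard_simplex q" using nonempty_standard_simplex by blast
  have "s v \<in> p ` E" using covering_space_imp_surjective[OF cov] s'(2) v by blast
  then obtain e where e: "e \<in> E" "p e = s v" by force
  define c :: "real \<times> (nat \<Rightarrow> real) \<Rightarrow> nat \<Rightarrow> real" where "c z = (\<lambda>i. (1 - fst z) * v i + fst z * snd z i)" for z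
  have c: "continuous_on ({0..1} \<times> standard_simplex q) c"
  proof (rule continuous_on_coordinatewise_then_product)
    fix i
    have "continuous_on ({0..1} \<times> standard_simplex q) (\<lambda>z. snd z i)"
      by (rule continuous_on_compose2[of UNIV "\<lambda>x. x i" _ snd])
         (auto intro!: continuous_on_snd continuous_on_id)
    then show "continuous_on ({0..1} \<times> standard_simplex q) (\<lambda>x. c x i)"
      unfolding c_def by (intro continuous_intros)
  qed
  have cim: "c \<in> ({0..1} \<times> standard_simplex q) \<rightarrow> standard_simplex q"
    using v convex_standard_simplex by (auto simp: c_def)
  obtain k where k: "continuous_on ({0..1} \<times> standard_simplex q) k" "k \<in> ({0..1} \<times> standard_simplex q) \<rightarrow> E"
     "\<And>z. z \<in> {0..1} \<times> standard_simplex q \<Longrightarrow> p (k z) = s (c z)"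
  proof (rule covering_homotopy_lift[OF cov, of "standard_simplex q" "\<lambda>z. s (c z)" "\<lambda>_. e"])
    show "continuous_on ({0..1} \<times> standard_simplex q) (\<lambda>z. s (c z))"
      by (rule continuous_on_compose2[OF s'(1) c]) (use cim in auto)
    show "(\<lambda>z. s (c z)) \<in> {0..1} \<times> standard_simplex q \<rightarrow> M" using cim s'(2) by blast
    show "s (c (0, y)) = p e" for y using e by (simp add: c_def)
  qed (use e in auto)
  define \<sigma> where "\<sigma> = restrict (\<lambda>x. k (1, x)) (standard_simplex q)"
  show thesis
  proof
    have "continuous_on (standard_simplex q) (\<lambda>x. k (1, x))"
      by (rule continuous_on_compose2[OF k(1)]) (auto intro!: continuous_intros)
    then have "continuous_on (standard_simplex q) \<sigma>"
      by (rule continuous_on_eq) (simp add: \<sigma>_def)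
    moreover have "\<sigma> \<in> standard_simplex q \<rightarrow> E" using k(2) by (auto simp: \<sigma>_def Pi_iff)
    ultimately show "singular_simplex q (top_of_set E) \<sigma>"
      by (simp add: singular_simplex_top_of_set \<sigma>_def)
    have "p (\<sigma> x) = s x" if "x \<in> standard_simplex q" for x
      using that k(3)[of "(1, x)"] by (simp add: \<sigma>_def c_def)
    then show "simplex_map q p \<sigma> = s"
      using s'(3) by (auto simp: simplex_map_def fun_eq_iff restrict_def extensional_def)
  qed
qed

lemma covering_chain_lift:
  fixes p :: "'a::topological_space \<Rightarrow> 'b::topological_space"
  assumes cov: "covering_space E p M" and c: "singular_chain q (top_of_set M) c"
  shows "\<exists>c'. singular_chain q (top_of_set E) c' \<and> chain_map q p c' = c"
  using c[unfolded singular_chain_def]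
proof (induction c rule: frag_induction)
  case zero
  then show ?case by (intro exI[of _ 0]) simp
next
  case (one s)
  then obtain \<sigma> where "singular_simplex q (top_of_set E) \<sigma>" "simplex_map q p \<sigma> = s"
    using covering_simplex_lift[OF cov] by blast
  then show ?case by (intro exI[of _ "frag_of \<sigma>"]) (simp add: singular_chain_of)
next
  case (diff a b)
  then obtain a' b' where "singular_chain q (top_of_set E) a'" "chain_map q p a' = a"
    "singular_chain q (top_of_set E) b'" "chain_map q p b' = b" by blast
  then show ?case by (intro exI[of _ "a' - b'"]) (simp add: singular_chain_diff chain_map_diff)
qed

section \<open>The action of the fundamental group by deck transformations\<close>

text \<open>\<open>G\<close> is tied to the fundamental group by an equation. Its group laws are
  assumed here because the given \<open>group_action\<close> on X supplies them.\<close>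

locale deck_group =
  fixes M :: "'a::topological_space set" and E :: "'b::topological_space set" and p e0 \<delta>
    and G :: "(real \<Rightarrow> 'a) set monoid"
  assumes G_def: "G = fundamental_group M (p e0)" and cov: "covering_space E p M" and sc: "simply_connected E" and e0: "e0 \<in> E"
    and deck: "deck_action M E p e0 \<delta>" and grp: "group G"
begin

lemma continuous_p: "continuous_on E p" "p \<in> E \<rightarrow> M"
  using cov by (auto simp: covering_space_def)

lemma deck_maps:
  assumes "\<gamma> \<in> carrier G"
  shows "continuous_on E (\<delta> \<gamma>)" "\<delta> \<gamma> \<in> E \<rightarrow> E" "\<And>e. e \<in> E \<Longrightarrow> p (\<delta> \<gamma> e) = p e"
proof -
  have "deck_transformation E p (\<delta> \<gamma>)" using deck assms by (simp add: deck_action_def G_def)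
  then show "continuous_on E (\<delta> \<gamma>)" "\<delta> \<gamma> \<in> E \<rightarrow> E" "\<And>e. e \<in> E \<Longrightarrow> p (\<delta> \<gamma> e) = p e"
    by (auto simp: deck_transformation_def homeomorphism_def)
qed

lemma in_class:
  assumes "\<gamma> \<in> carrier G" "g \<in> \<gamma>"
  shows "\<gamma> = path_class M g" "path g" "path_image g \<subseteq> M"
proof -
  obtain g0 where g0: "\<gamma> = path_class M g0" using assms(1) by (auto simp: G_def fundamental_group_def)
  then have "homotopic_paths M g0 g" using assms(2) by (simp add: path_class_def)
  then show "\<gamma> = path_class M g" "path g" "path_image g \<subseteq> M"
    unfolding g0 path_class_def
    by (auto dest: homotopic_paths_imp_path homotopic_paths_imp_subset intro: homotopic_paths_trans homotopic_paths_sym)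
qed

lemma class_closed:
  assumes "\<gamma> \<in> carrier G" "g \<in> \<gamma>" "homotopic_paths M g h"
  shows "h \<in> \<gamma>"
  using in_class(1)[OF assms(1,2)] assms(3) by (simp add: path_class_def)

lemma path_comp_p:
  assumes "path h" "path_image h \<subseteq> E"
  shows "path (p \<circ> h)" "path_image (p \<circ> h) \<subseteq> M"
  using assms continuous_p
  by (auto intro!: path_continuous_image elim: continuous_on_subset simp: path_image_compose)

text \<open>\<open>deck_action\<close> asserts this for some lift of some loop in the class; the
  monodromy argument extends it to all of them.\<close>

lemma deck_e0:
  assumes \<gamma>: "\<gamma> \<in> carrier G" and h: "path h" "path_image h \<subseteq> E" "pathstart h = e0" "p \<circ> h \<in> \<gamma>"
  shows "\<delta> \<gamma> e0 = pathfinish h"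
proof -
  obtain k where k: "path k" "path_image k \<subseteq> E" "pathstart k = e0" "p \<circ> k \<in> \<gamma>" "pathfinish k = \<delta> \<gamma> e0"
    using deck \<gamma> by (auto simp: deck_action_def G_def)
  have "homotopic_paths M (p \<circ> k) (p \<circ> h)"
    using in_class(1)[OF \<gamma> k(4)] h(4) by (simp add: path_class_def)
  then show ?thesis using covering_monodromy[OF cov] h k by metis
qed

text \<open>Deck transformations are lifts of p along p itself, so on the connected space E they
  agree everywhere once they agree at one point.\<close>

lemma deck_eq:
  assumes "\<gamma> \<in> carrier G" "\<gamma>' \<in> carrier G" "e \<in> E" "x \<in> E" "\<delta> \<gamma> e = \<delta> \<gamma>' e"
  shows "\<delta> \<gamma> x = \<delta> \<gamma>' x"
  by (rule covering_lift_unique[OF cov, of E "\<delta> \<gamma>" "\<delta> \<gamma>'" e x])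
     (use assms deck_maps simply_connected_path_connected[OF sc] path_connected_imp_connected in auto)

text \<open>If h and k start at e0 and lift loops of \<open>\<gamma>\<close> and
  \<open>\<gamma>'\<close>, then h followed by the translate of k under
  \<open>\<delta> \<gamma>\<close> lifts the product of the loops, and it ends at
  \<open>\<delta> \<gamma> (\<delta> \<gamma>' e0)\<close>. Agreement at e0 spreads over E by
  uniqueness of lifts.\<close>

lemma deck_mult:
  assumes \<gamma>: "\<gamma> \<in> carrier G" "\<gamma>' \<in> carrier G" and x: "x \<in> E"
  shows "\<delta> (\<gamma> \<otimes>\<^bsub>G\<^esub> \<gamma>') x = \<delta> \<gamma> (\<delta> \<gamma>' x)"
proof -
  let ?m = "\<gamma> \<otimes>\<^bsub>G\<^esub> \<gamma>'"
  have m: "?m \<in> carrier G" using grp \<gamma> by (simp add: group.is_monoid monoid.m_closed)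
  obtain h where h: "path h" "path_image h \<subseteq> E" "pathstart h = e0" "p \<circ> h \<in> \<gamma>" "pathfinish h = \<delta> \<gamma> e0"
    using deck \<gamma> by (auto simp: deck_action_def G_def)
  obtain k where k: "path k" "path_image k \<subseteq> E" "pathstart k = e0" "p \<circ> k \<in> \<gamma>'" "pathfinish k = \<delta> \<gamma>' e0"
    using deck \<gamma> by (auto simp: deck_action_def G_def)
  have pk: "p (pathfinish h) = p e0" using h(5) deck_maps(3)[OF \<gamma>(1) e0] by simp
  have k': "path (\<delta> \<gamma> \<circ> k)" "path_image (\<delta> \<gamma> \<circ> k) \<subseteq> E" "pathstart (\<delta> \<gamma> \<circ> k) = pathfinish h"
    using k h deck_maps[OF \<gamma>(1)]
    by (auto intro!: path_continuous_image elim: continuous_on_subset simp: path_image_compose pathstart_compose)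
  let ?j = "h +++ (\<delta> \<gamma> \<circ> k)"
  have j: "path ?j" "path_image ?j \<subseteq> E" "pathstart ?j = e0" "pathfinish ?j = \<delta> \<gamma> (\<delta> \<gamma>' e0)"
    using h k k' by (auto simp: path_image_join pathfinish_compose)
  have pj: "p \<circ> ?j = (p \<circ> h) +++ (p \<circ> (\<delta> \<gamma> \<circ> k))" by (simp add: path_compose_join)
  have hom: "homotopic_paths M ((p \<circ> h) +++ (p \<circ> k)) ((p \<circ> h) +++ (p \<circ> (\<delta> \<gamma> \<circ> k)))"
  proof (rule homotopic_paths_join)
    show "homotopic_paths M (p \<circ> h) (p \<circ> h)" using path_comp_p[OF h(1,2)] by simp
    show "homotopic_paths M (p \<circ> k) (p \<circ> (\<delta> \<gamma> \<circ> k))"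
    proof (rule homotopic_paths_eq)
      fix t :: real assume "t \<in> {0..1}"
      then have "k t \<in> E" using k(2) by (auto simp: path_image_def)
      then show "(p \<circ> k) t = (p \<circ> (\<delta> \<gamma> \<circ> k)) t" using deck_maps(3)[OF \<gamma>(1)] by simp
    qed (use path_comp_p[OF k(1,2)] in auto)
    show "pathfinish (p \<circ> h) = pathstart (p \<circ> k)" using pk k(3) by (simp add: pathfinish_compose pathstart_compose)
  qed
  have "homotopic_paths M ((p \<circ> h) +++ (p \<circ> k)) ((p \<circ> h) +++ (p \<circ> k))"
    using hom homotopic_paths_trans homotopic_paths_sym by blast
  then have "(p \<circ> h) +++ (p \<circ> k) \<in> path_class M ((p \<circ> h) +++ (p \<circ> k))"
    by (simp add: path_class_def)
  moreover have "?m = (\<Union>g\<in>\<gamma>. \<Union>g'\<in>\<gamma>'. path_class M (g +++ g'))"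
    by (simp add: G_def fundamental_group_def)
  ultimately have "(p \<circ> h) +++ (p \<circ> k) \<in> ?m" using h(4) k(4) by blast
  then have "p \<circ> ?j \<in> ?m" using class_closed[OF m _ hom] pj by simp
  then have e: "\<delta> ?m e0 = \<delta> \<gamma> (\<delta> \<gamma>' e0)" using deck_e0[OF m j(1,2,3)] j(4) by simp
  have "continuous_on E (\<lambda>x. \<delta> \<gamma> (\<delta> \<gamma>' x))"
    by (rule continuous_on_compose2[OF deck_maps(1)[OF \<gamma>(1)] deck_maps(1)[OF \<gamma>(2)]])
       (use deck_maps(2)[OF \<gamma>(2)] in auto)
  moreover have "(\<lambda>x. \<delta> \<gamma> (\<delta> \<gamma>' x)) \<in> E \<rightarrow> E" using deck_maps(2) \<gamma> by blast
  moreover have "p (\<delta> ?m y) = p (\<delta> \<gamma> (\<delta> \<gamma>' y))" if "y \<in> E" for y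
    using that deck_maps[OF m] deck_maps[OF \<gamma>(1)] deck_maps[OF \<gamma>(2)] by (simp add: Pi_iff)
  ultimately show ?thesis
    using covering_lift_unique[OF cov deck_maps(1,2)[OF m], of "\<lambda>x. \<delta> \<gamma> (\<delta> \<gamma>' x)" e0 x]
      e e0 x simply_connected_path_connected[OF sc] path_connected_imp_connected by blast
qed

text \<open>Two elements agreeing at x agree at e0, so their quotient fixes e0. The lift of a loop
  in the class of the quotient is then closed, hence null-homotopic in E, and projecting the
  null-homotopy shows that the class is trivial.\<close>

lemma deck_free:
  assumes \<gamma>: "\<gamma> \<in> carrier G" "\<gamma>' \<in> carrier G" and x: "x \<in> E" and eq: "\<delta> \<gamma> x = \<delta> \<gamma>' x"
  shows "\<gamma> = \<gamma>'"
proof -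
  interpret group G by (rule grp)
  have one: "\<one>\<^bsub>G\<^esub> = path_class M (\<lambda>_. p e0)" by (simp add: G_def fundamental_group_def)
  have c: "path (\<lambda>_::real. p e0)" "path_image (\<lambda>_::real. p e0) \<subseteq> M"
    using continuous_p e0 by (auto simp: path_def path_image_def)
  have "p \<circ> (\<lambda>_. e0) \<in> \<one>\<^bsub>G\<^esub>" using c by (simp add: one path_class_def comp_def)
  then have \<delta>1: "\<delta> \<one>\<^bsub>G\<^esub> e0 = e0"
    using deck_e0[of "\<one>\<^bsub>G\<^esub>" "\<lambda>_. e0"] e0 by (auto simp: path_def path_image_def pathstart_def pathfinish_def)
  let ?d = "inv\<^bsub>G\<^esub> \<gamma>' \<otimes>\<^bsub>G\<^esub> \<gamma>"
  have d: "?d \<in> carrier G" using \<gamma> by simp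
  have "\<delta> ?d e0 = \<delta> (inv\<^bsub>G\<^esub> \<gamma>' \<otimes>\<^bsub>G\<^esub> \<gamma>') e0"
    using \<gamma> e0 deck_eq[OF \<gamma> x e0 eq] by (simp only: deck_mult inv_closed)
  then have de: "\<delta> ?d e0 = e0" using \<gamma> \<delta>1 by simp
  obtain h where h: "path h" "path_image h \<subseteq> E" "pathstart h = e0" "p \<circ> h \<in> ?d" "pathfinish h = e0"
    using deck d de by (auto simp: deck_action_def G_def)
  have "homotopic_paths M (p \<circ> h) (p \<circ> (\<lambda>_. e0))"
    using homotopic_paths_continuous_image[OF simply_connected_loop_null[OF sc h(1,2)] continuous_p] h by simp
  then have "path_class M (p \<circ> h) = path_class M (\<lambda>_. p e0)"
    unfolding path_class_def comp_def by (blast intro: homotopic_paths_trans homotopic_paths_sym)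
  then have "?d = \<one>\<^bsub>G\<^esub>" using in_class(1)[OF d h(4)] one by simp
  then show ?thesis using \<gamma> by (metis inv_closed inv_equality inv_inv)
qed

text \<open>Join x to e0 by l and lift p \<circ> l to a path l' from y. The end of l' lies over p
  e0, so a path h from e0 to it projects to a loop. The class of this loop carries the end of l to
  the end of l'; comparing lifts backwards from time 1 to time 0, it carries x to y.\<close>

lemma deck_transitive:
  assumes x: "x \<in> E" "y \<in> E" and eq: "p x = p y"
  obtains \<gamma> where "\<gamma> \<in> carrier G" "\<delta> \<gamma> x = y"
proof -
  have pc: "path_connected E" by (rule simply_connected_path_connected[OF sc])
  obtain l where l: "path l" "path_image l \<subseteq> E" "pathstart l = x" "pathfinish l = e0"
    using pc x e0 unfolding path_connected_def by blast
  have "pathstart (p \<circ> l) = p y" using l eq by (simp add: pathstart_compose)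
  then obtain l' where l': "path l'" "path_image l' \<subseteq> E" "pathstart l' = y" "\<And>t. t \<in> {0..1} \<Longrightarrow> p (l' t) = p (l t)"
    using covering_path_lift[OF cov path_comp_p[OF l(1,2)] x(2)] by auto
  have e1: "pathfinish l' \<in> E" "p (pathfinish l') = p e0"
    using l' l(4) l'(4)[of 1] by (auto simp: pathfinish_def path_image_def)
  obtain h where h: "path h" "path_image h \<subseteq> E" "pathstart h = e0" "pathfinish h = pathfinish l'"
    using pc e0 e1 unfolding path_connected_def by blast
  define \<gamma> where "\<gamma> = path_class M (p \<circ> h)"
  have \<gamma>: "\<gamma> \<in> carrier G" "p \<circ> h \<in> \<gamma>"
    using path_comp_p[OF h(1,2)] h e1
    by (auto simp: \<gamma>_def G_def fundamental_group_def path_class_def pathstart_compose pathfinish_compose)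
  have fin: "\<delta> \<gamma> (pathfinish l) = pathfinish l'" using deck_e0[OF \<gamma>(1) h(1,2,3) \<gamma>(2)] l h by simp
  have cl: "continuous_on {0..1} l" "l \<in> {0..1} \<rightarrow> E" "continuous_on {0..1} l'" "l' \<in> {0..1} \<rightarrow> E"
    using l l' by (auto simp: path_def path_image_def)
  have "\<delta> \<gamma> (l 0) = l' 0"
  proof (rule covering_lift_unique[OF cov, of "{0..1}" "\<lambda>t. \<delta> \<gamma> (l t)" l' 1 0])
    show "continuous_on {0..1} (\<lambda>t. \<delta> \<gamma> (l t))"
      by (rule continuous_on_compose2[OF deck_maps(1)[OF \<gamma>(1)] cl(1)]) (use cl in auto)
  qed (use cl deck_maps[OF \<gamma>(1)] l' fin in \<open>auto simp: pathfinish_def Pi_iff\<close>)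
  then show thesis using that \<gamma> l l' by (simp add: pathstart_def)
qed

section \<open>The induced action on singular simplices\<close>

abbreviation "Esimplex q \<equiv> singular_simplex q (top_of_set E)"

lemma simplex_deck:
  assumes "\<gamma> \<in> carrier G" "Esimplex q \<sigma>"
  shows "Esimplex q (simplex_map q (\<delta> \<gamma>) \<sigma>)"
    "simplex_map q p (simplex_map q (\<delta> \<gamma>) \<sigma>) = simplex_map q p \<sigma>"
proof -
  show "Esimplex q (simplex_map q (\<delta> \<gamma>) \<sigma>)"
    using deck_maps[OF assms(1)] by (intro singular_simplex_simplex_map[OF assms(2)]) (simp add: image_subset_iff_funcset)
  show "simplex_map q p (simplex_map q (\<delta> \<gamma>) \<sigma>) = simplex_map q p \<sigma>"
    using assms deck_maps(3)[OF assms(1)]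
    by (auto simp: simplex_map_def singular_simplex_top_of_set Pi_iff)
qed

lemma simplex_deck_mult:
  assumes "\<gamma> \<in> carrier G" "\<gamma>' \<in> carrier G" "Esimplex q \<sigma>"
  shows "simplex_map q (\<delta> (\<gamma> \<otimes>\<^bsub>G\<^esub> \<gamma>')) \<sigma> = simplex_map q (\<delta> \<gamma>) (simplex_map q (\<delta> \<gamma>') \<sigma>)"
  using assms deck_mult[OF assms(1,2)]
  by (auto simp: simplex_map_def singular_simplex_top_of_set Pi_iff)

lemma simplex_deck_free:
  assumes "\<gamma> \<in> carrier G" "\<gamma>' \<in> carrier G" "Esimplex q \<sigma>" "simplex_map q (\<delta> \<gamma>) \<sigma> = simplex_map q (\<delta> \<gamma>') \<sigma>"
  shows "\<gamma> = \<gamma>'"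
proof -
  obtain v where v: "v \<in> standard_simplex q" using nonempty_standard_simplex by blast
  have "\<delta> \<gamma> (\<sigma> v) = \<delta> \<gamma>' (\<sigma> v)" using fun_cong[OF assms(4), of v] v by (simp add: simplex_map_def)
  then show ?thesis using deck_free assms v by (auto simp: singular_simplex_top_of_set)
qed

text \<open>A group element is chosen to match the simplices at one point; as the standard simplex
  is connected, uniqueness of lifts gives equality everywhere.\<close>

lemma simplex_deck_transitive:
  assumes \<sigma>: "Esimplex q \<sigma>" "Esimplex q \<tau>" and eq: "simplex_map q p \<sigma> = simplex_map q p \<tau>"
  shows "\<exists>\<gamma>\<in>carrier G. simplex_map q (\<delta> \<gamma>) \<sigma> = \<tau>"
proof -
  have s: "continuous_on (standard_simplex q) \<sigma>" "\<sigma> \<in> standard_simplex q \<rightarrow> E"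
    "continuous_on (standard_simplex q) \<tau>" "\<tau> \<in> standard_simplex q \<rightarrow> E" "\<tau> \<in> extensional (standard_simplex q)"
    using \<sigma> by (auto simp: singular_simplex_top_of_set)
  have peq: "p (\<sigma> x) = p (\<tau> x)" if "x \<in> standard_simplex q" for x
    using fun_cong[OF eq, of x] that by (simp add: simplex_map_def)
  obtain v where v: "v \<in> standard_simplex q" using nonempty_standard_simplex by blast
  obtain \<gamma> where \<gamma>: "\<gamma> \<in> carrier G" "\<delta> \<gamma> (\<sigma> v) = \<tau> v"
    using deck_transitive[of "\<sigma> v" "\<tau> v"] s v peq by blast
  have "\<delta> \<gamma> (\<sigma> x) = \<tau> x" if x: "x \<in> standard_simplex q" for x
  proof (rule covering_lift_unique[OF cov, of "standard_simplex q" "\<lambda>x. \<delta> \<gamma> (\<sigma> x)" \<tau> v x])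
    show "continuous_on (standard_simplex q) (\<lambda>x. \<delta> \<gamma> (\<sigma> x))"
      by (rule continuous_on_compose2[OF deck_maps(1)[OF \<gamma>(1)] s(1)]) (use s in auto)
  qed (use s v x \<gamma> deck_maps[OF \<gamma>(1)] peq connected_standard_simplex in \<open>auto simp: Pi_iff\<close>)
  then have "simplex_map q (\<delta> \<gamma>) \<sigma> = \<tau>"
    using s(5) by (auto simp: simplex_map_def fun_eq_iff restrict_def extensional_def)
  with \<gamma> show ?thesis by blast
qed

end

section \<open>Standard Borel spaces\<close>

lemma (in Metric_space) separable_imp_second_countable:
  assumes "separable_space mtopology"
  shows "second_countable mtopology"
proof -
  obtain C where C: "countable C" "C \<subseteq> M" "mtopology closure_of C = M"
    using assms by (auto simp: separable_space_def)
  let ?B = "(\<lambda>(x, n). mball x (1 / real (Suc n))) ` (C \<times> UNIV)"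
  have "\<exists>V\<in>?B. x \<in> V \<and> V \<subseteq> U" if U: "openin mtopology U" "x \<in> U" for U x
  proof -
    obtain r where r: "r > 0" "mball x r \<subseteq> U" using U by (auto simp: openin_mtopology)
    have xM: "x \<in> M" using U openin_subset[OF U(1)] by auto
    obtain n where n: "1 / real (Suc n) < r / 2"
      using reals_Archimedean[of "r/2"] r by (auto simp: inverse_eq_divide)
    have "\<forall>r>0. \<exists>y\<in>C. y \<in> mball x r" using C(3) xM unfolding metric_closure_of by blast
    then obtain y where y: "y \<in> C" "y \<in> mball x (1 / real (Suc n))"
      by (metis of_nat_0_less_iff zero_less_Suc zero_less_divide_1_iff)
    have "mball y (1 / real (Suc n)) \<subseteq> mball x r"
    proof
      fix z assume z: "z \<in> mball y (1 / real (Suc n))"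
      then have "d x z \<le> d x y + d y z" using y xM by (intro triangle) auto
      also have "\<dots> < r" using y z n by auto
      finally show "z \<in> mball x r" using xM z by auto
    qed
    moreover have "x \<in> mball y (1 / real (Suc n))" using y xM C by (auto simp: commute)
    ultimately show ?thesis using y r by (intro bexI[of _ "mball y (1 / real (Suc n))"]) auto
  qed
  moreover have "countable ?B" using C by simp
  ultimately show ?thesis unfolding second_countable_def
    by (intro exI[of _ ?B]) auto
qed

text \<open>The Borel isomorphism pulls back a countable base of the topology. Finite intersections
  are added because indicators are later approximated by induction over a Dynkin system, which
  requires an intersection-stable generator.\<close>

lemma standard_borel_countably_generated:
  assumes "standard_borel X"
  obtains \<G> where "countable \<G>" "Int_stable \<G>" "\<G> \<subseteq> Pow (space X)" "space X \<in> \<G>"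
    "sets X = sigma_sets (space X) \<G>"
proof -
  obtain T :: "'a topology" and f where T: "completely_metrizable_space T" "separable_space T"
    and bij: "bij_betw f (space X) (topspace T)"
    and f: "f \<in> X \<rightarrow>\<^sub>M sigma (topspace T) {U. openin T U}"
    and g: "the_inv_into (space X) f \<in> sigma (topspace T) {U. openin T U} \<rightarrow>\<^sub>M X"
    using assms unfolding standard_borel_def by blast
  have "second_countable T"
    using completely_metrizable_imp_metrizable_space[OF T(1)] T(2) Metric_space.separable_imp_second_countable
    unfolding metrizable_space_def by blast
  then obtain B where "countable B \<and> (\<forall>V\<in>B. openin T V) \<and>
      (\<forall>U x. openin T U \<and> x \<in> U \<longrightarrow> (\<exists>V\<in>B. x \<in> V \<and> V \<subseteq> U))"
    unfolding second_countable_def ..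
  then have B: "countable B" "\<And>V. V \<in> B \<Longrightarrow> openin T V"
    "\<And>U x. openin T U \<Longrightarrow> x \<in> U \<Longrightarrow> \<exists>V\<in>B. x \<in> V \<and> V \<subseteq> U"
    by blast+
  have Bsub: "B \<subseteq> Pow (topspace T)" using B(2) openin_subset by blast
  have Osub: "{U. openin T U} \<subseteq> Pow (topspace T)" using openin_subset by blast
  have "U \<in> sigma_sets (topspace T) B" if U: "openin T U" for U
  proof -
    have "U = \<Union>{V \<in> B. V \<subseteq> U}" using B(3)[OF U] by blast
    moreover have "\<Union>{V \<in> B. V \<subseteq> U} \<in> sigma_sets (topspace T) B"
    proof -
      interpret sigma_algebra "topspace T" "sigma_sets (topspace T) B" by (rule sigma_algebra_sigma_sets[OF Bsub])
      show ?thesis using B(1) by (intro countable_Union) auto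
    qed
    ultimately show ?thesis by simp
  qed
  then have "sigma_sets (topspace T) {U. openin T U} \<subseteq> sigma_sets (topspace T) B"
    by (intro sigma_sets_mono) auto
  then have OB: "sigma_sets (topspace T) {U. openin T U} = sigma_sets (topspace T) B"
    using B(2) sigma_sets_mono'[of B "{U. openin T U}" "topspace T"] by blast
  define \<A> where "\<A> = (\<lambda>V. f -` V \<inter> space X) ` B"
  \<comment> \<open>Intersecting with \<open>space X\<close> turns the empty intersection into
    \<open>space X\<close> itself.\<close>
  define \<G> where "\<G> = (\<lambda>F. \<Inter>F \<inter> space X) ` {F. finite F \<and> F \<subseteq> \<A>}"
  have fT: "f \<in> space X \<rightarrow> topspace T" using bij by (auto simp: bij_betw_def)
  have sub: "\<A> \<subseteq> Pow (space X)" "\<G> \<subseteq> Pow (space X)" by (auto simp: \<A>_def \<G>_def)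
  have "sets X \<subseteq> sigma_sets (space X) \<A>"
  proof
    fix A assume A: "A \<in> sets X"
    let ?g = "the_inv_into (space X) f"
    have AX: "A \<subseteq> space X" using sets.sets_into_space[OF A] .
    have "?g -` A \<inter> topspace T \<in> sigma_sets (topspace T) B"
      using measurable_sets[OF g A] Osub OB by simp
    then have "f -` (?g -` A \<inter> topspace T) \<inter> space X \<in> sigma_sets (space X) {f -` A \<inter> space X |A. A \<in> B}"
      using sigma_sets_vimage_commute[OF fT, of B] by blast
    moreover have "f -` (?g -` A \<inter> topspace T) \<inter> space X = A"
    proof -
      have "?g (f x) = x" if "x \<in> space X" for x
        using bij that by (simp add: bij_betw_def the_inv_into_f_f)
      then show ?thesis using AX fT by auto
    qed
    moreover have "{f -` A \<inter> space X |A. A \<in> B} = \<A>" by (auto simp: \<A>_def)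
    ultimately show "A \<in> sigma_sets (space X) \<A>" by simp
  qed
  moreover have "\<A> \<subseteq> \<G>"
  proof
    fix A assume "A \<in> \<A>"
    then show "A \<in> \<G>" using sub unfolding \<G>_def by (intro image_eqI[of _ _ "{A}"]) auto
  qed
  moreover have "\<G> \<subseteq> sets X"
  proof -
    have A: "A \<in> sets X" if "A \<in> \<A>" for A
      using that B(2) Osub measurable_sets[OF f] by (auto simp: \<A>_def intro!: sigma_sets.Basic)
    have "\<Inter>F \<inter> space X \<in> sets X" if "finite F" "F \<subseteq> \<A>" for F
      using that
    proof (induction F)
      case (insert B F)
      then have "B \<in> sets X" "\<Inter>F \<inter> space X \<in> sets X" using A by auto
      then show ?case by (simp add: Int_assoc sets.Int)
    qed simp
    then show ?thesis by (auto simp: \<G>_def)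
  qed
  ultimately have "sets X = sigma_sets (space X) \<G>"
    using sets.sigma_sets_subset[of \<G> X] sigma_sets_mono'[of \<A> \<G> "space X"] by blast
  moreover have "Int_stable \<G>"
  proof (rule Int_stableI)
    fix a b assume "a \<in> \<G>" "b \<in> \<G>"
    then obtain F H where "finite F" "F \<subseteq> \<A>" "a = \<Inter>F \<inter> space X" "finite H" "H \<subseteq> \<A>" "b = \<Inter>H \<inter> space X"
      by (auto simp: \<G>_def)
    then show "a \<inter> b \<in> \<G>" unfolding \<G>_def by (intro image_eqI[of _ _ "F \<union> H"]) auto
  qed
  moreover have "countable \<G>"
    unfolding \<G>_def \<A>_def by (intro countable_image countable_Collect_finite_subset B(1))
  moreover have "space X \<in> \<G>" unfolding \<G>_def by (intro image_eqI[of _ _ "{}"]) auto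
  ultimately show thesis using that sub by blast
qed

section \<open>Integral chains with integer-valued functions as coefficients\<close>

definition l1_norm :: "('s \<Rightarrow>\<^sub>0 int) \<Rightarrow> real" where
  "l1_norm a = (\<Sum>s\<in>Poly_Mapping.keys a. \<bar>real_of_int (poly_mapping.lookup a s)\<bar>)"

lemma l1_norm_superset:
  assumes "finite S" "Poly_Mapping.keys a \<subseteq> S"
  shows "l1_norm a = (\<Sum>s\<in>S. \<bar>real_of_int (poly_mapping.lookup a s)\<bar>)"
  unfolding l1_norm_def by (intro sum.mono_neutral_left assms) (simp add: in_keys_iff)

lemma l1_norm_nonneg: "0 \<le> l1_norm a"
  by (simp add: l1_norm_def sum_nonneg)

lemma l1_norm_0 [simp]: "l1_norm 0 = 0"
  by (simp add: l1_norm_def)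

lemma l1_norm_add: "l1_norm (a + b) \<le> l1_norm a + l1_norm b"
proof -
  let ?S = "Poly_Mapping.keys a \<union> Poly_Mapping.keys b"
  have "l1_norm (a + b) = (\<Sum>s\<in>?S. \<bar>real_of_int (poly_mapping.lookup a s) + real_of_int (poly_mapping.lookup b s)\<bar>)"
    using Poly_Mapping.keys_add[of a b] by (subst l1_norm_superset[of ?S]) (auto simp: lookup_add)
  also have "\<dots> \<le> (\<Sum>s\<in>?S. \<bar>real_of_int (poly_mapping.lookup a s)\<bar> + \<bar>real_of_int (poly_mapping.lookup b s)\<bar>)"
    by (intro sum_mono abs_triangle_ineq)
  also have "\<dots> = l1_norm a + l1_norm b"
    by (simp add: sum.distrib l1_norm_superset[of ?S])
  finally show ?thesis .
qed

lemma l1_norm_cmul_frag_of: "l1_norm (frag_cmul k (frag_of s)) = \<bar>real_of_int k\<bar>"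
  by (subst l1_norm_superset[of "{s}"]) (use keys_cmul[of k "frag_of s"] in auto)

lemma l1_norm_relabel:
  assumes "inj_on h S" "Poly_Mapping.keys a \<subseteq> S"
  shows "l1_norm (frag_extend (frag_of \<circ> h) a) = l1_norm a"
proof -
  let ?b = "frag_extend (frag_of \<circ> h) a"
  have keys: "Poly_Mapping.keys ?b \<subseteq> h ` Poly_Mapping.keys a"
    using keys_frag_extend[of "frag_of \<circ> h" a] by auto
  have lk: "poly_mapping.lookup ?b (h s) = poly_mapping.lookup a s" if s: "s \<in> Poly_Mapping.keys a" for s
  proof -
    have "poly_mapping.lookup ?b (h s) = (\<Sum>i\<in>Poly_Mapping.keys a. if i = s then poly_mapping.lookup a i else 0)"
      unfolding frag_extend_def lookup_sum
      using assms s by (intro sum.cong) (auto simp: inj_on_def)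
    then show ?thesis using s by simp
  qed
  have "l1_norm ?b = (\<Sum>s\<in>h ` Poly_Mapping.keys a. \<bar>real_of_int (poly_mapping.lookup ?b s)\<bar>)"
    using keys by (intro l1_norm_superset) auto
  also have "\<dots> = l1_norm a"
    using inj_on_subset[OF assms] by (simp add: sum.reindex lk l1_norm_def)
  finally show ?thesis .
qed

text \<open>A pair of a coefficient function \<open>f\<close> and a list of triples \<open>(k, g, s)\<close> stands for
  \<open>\<Sum> k \<cdot> (f \<circ> \<alpha> g) \<otimes> s\<close>.\<close>

definition cell :: "('g \<Rightarrow> 'x \<Rightarrow> 'x) \<Rightarrow> ('x \<Rightarrow> int) \<Rightarrow> (int \<times> 'g \<times> 's) list \<Rightarrow> 'x \<Rightarrow> ('s \<Rightarrow>\<^sub>0 int)" where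
  "cell \<alpha> f l x = (\<Sum>(k, g, s)\<leftarrow>l. frag_cmul (k * f (\<alpha> g x)) (frag_of s))"

definition fibre ::
  "('g \<Rightarrow> 'x \<Rightarrow> 'x) \<Rightarrow> (('x \<Rightarrow> int) \<times> (int \<times> 'g \<times> 's) list) list \<Rightarrow> 'x \<Rightarrow> ('s \<Rightarrow>\<^sub>0 int)" where
  "fibre \<alpha> u x = (\<Sum>(f, l)\<leftarrow>u. cell \<alpha> f l x)"

text \<open>Neither the integrand nor the list refers to the measure, so one list can be tested
  against \<open>\<mu>\<close> and against every \<open>\<beta> x\<close>.\<close>

definition fibre_norm ::
  "('g \<Rightarrow> 'x \<Rightarrow> 'x) \<Rightarrow> 'x measure \<Rightarrow> (('x \<Rightarrow> int) \<times> (int \<times> 'g \<times> 's) list) list \<Rightarrow> real" where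
  "fibre_norm \<alpha> \<nu> u = (\<integral>x. l1_norm (fibre \<alpha> u x) \<partial>\<nu>)"

definition labels :: "(('x \<Rightarrow> int) \<times> (int \<times> 'g \<times> 's) list) list \<Rightarrow> 's set" where
  "labels u = (\<Union>(f, l)\<in>set u. (\<lambda>(k, g, s). s) ` set l)"

lemma cell_simps [simp]:
  "cell \<alpha> f [] x = 0"
  "cell \<alpha> f ((k, g, s) # l) x = frag_cmul (k * f (\<alpha> g x)) (frag_of s) + cell \<alpha> f l x"
  by (simp_all add: cell_def)

lemma fibre_simps [simp]:
  "fibre \<alpha> [] x = 0"
  "fibre \<alpha> ((f, l) # u) x = cell \<alpha> f l x + fibre \<alpha> u x"
  "fibre \<alpha> (u @ v) x = fibre \<alpha> u x + fibre \<alpha> v x"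
  by (simp_all add: fibre_def)

lemma cell_add: "cell \<alpha> (\<lambda>x. f x + h x) l x = cell \<alpha> f l x + cell \<alpha> h l x"
  by (induction l) (auto simp: distrib_left frag_cmul_distrib)

text \<open>Serves two purposes: with the indicator of an invariant set it restricts a chain to this
  set, and with the constant - 1 it negates a chain.\<close>

lemma cell_restrict:
  assumes "\<And>k g s. (k, g, s) \<in> set l \<Longrightarrow> c (\<alpha> g x) = c x"
  shows "cell \<alpha> (\<lambda>y. c y * f y) l x = frag_cmul (c x) (cell \<alpha> f l x)"
  using assms
proof (induction l)
  case (Cons a l)
  obtain k g s where a: "a = (k, g, s)" by (cases a)
  have "c (\<alpha> g x) = c x" using Cons.prems[of k g s] a by simp
  moreover have "cell \<alpha> (\<lambda>y. c y * f y) l x = frag_cmul (c x) (cell \<alpha> f l x)"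
    by (rule Cons.IH) (use Cons.prems in auto)
  ultimately show ?case by (simp add: a frag_cmul_distrib2 mult_ac)
qed simp

lemma labels_finite [simp]: "finite (labels u)"
  by (auto simp: labels_def)

lemma keys_cell: "Poly_Mapping.keys (cell \<alpha> f l x) \<subseteq> (\<lambda>(k, g, s). s) ` set l"
proof (induction l)
  case (Cons a l)
  obtain k g s where a: "a = (k, g, s)" by (cases a)
  have "Poly_Mapping.keys (cell \<alpha> f (a # l) x) \<subseteq> {s} \<union> Poly_Mapping.keys (cell \<alpha> f l x)"
    unfolding a cell_simps
    using Poly_Mapping.keys_add[of "frag_cmul (k * f (\<alpha> g x)) (frag_of s)" "cell \<alpha> f l x"] keys_cmul[of "k * f (\<alpha> g x)" "frag_of s"]
    by auto
  then show ?case using Cons a by auto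
qed simp

lemma keys_fibre: "Poly_Mapping.keys (fibre \<alpha> u x) \<subseteq> labels u"
proof (induction u)
  case (Cons a u)
  obtain f l where a: "a = (f, l)" by (cases a)
  show ?case unfolding a fibre_simps
    using Poly_Mapping.keys_add[of "cell \<alpha> f l x" "fibre \<alpha> u x"] keys_cell[of \<alpha> f l x] Cons
    by (auto simp: labels_def)
qed simp

text \<open>The index set \<open>labels u\<close> is finite and the same for all x, so integrability
  can be checked one coefficient at a time.\<close>

lemma l1_norm_fibre: "l1_norm (fibre \<alpha> u x) = (\<Sum>s\<in>labels u. \<bar>real_of_int (poly_mapping.lookup (fibre \<alpha> u x) s)\<bar>)"
  by (rule l1_norm_superset[OF labels_finite keys_fibre])

lemma l1_norm_cell_le: "l1_norm (cell \<alpha> f l x) \<le> (\<Sum>(k, g, s)\<leftarrow>l. \<bar>real_of_int k\<bar> * \<bar>real_of_int (f (\<alpha> g x))\<bar>)"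
proof (induction l)
  case (Cons a l)
  obtain k g s where a: "a = (k, g, s)" by (cases a)
  show ?case unfolding a cell_simps
    using Cons l1_norm_add[of "frag_cmul (k * f (\<alpha> g x)) (frag_of s)" "cell \<alpha> f l x"]
    by (simp add: l1_norm_cmul_frag_of abs_mult)
qed simp

text \<open>Only the coincidences between the labels matter for the norm, so the labels may be taken
  from a countable set, however many simplices there are.\<close>

lemma fibre_relabel:
  fixes u :: "(('x \<Rightarrow> int) \<times> (int \<times> 'g \<times> 's) list) list"
  assumes "u \<in> lists (D \<times> lists (UNIV \<times> C \<times> UNIV))"
  obtains w :: "(('x \<Rightarrow> int) \<times> (int \<times> 'g \<times> nat) list) list"
  where "w \<in> lists (D \<times> lists (UNIV \<times> C \<times> UNIV))"
    "\<And>\<alpha> x. l1_norm (fibre \<alpha> w x) = l1_norm (fibre \<alpha> u x)"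
proof -
  obtain h :: "'s \<Rightarrow> nat" where h: "inj_on h (labels u)"
    using finite_imp_inj_to_nat_seg[OF labels_finite[of u]] by blast
  define w where "w = map (\<lambda>(f, l). (f, map (\<lambda>(k, g, s). (k, g, h s)) l)) u"
  show thesis
  proof
    show "w \<in> lists (D \<times> lists (UNIV \<times> C \<times> UNIV))" using assms by (force simp: w_def)
    fix \<alpha> :: "'g \<Rightarrow> 'x \<Rightarrow> 'x" and x
    have cell: "cell \<alpha> f (map (\<lambda>(k, g, s). (k, g, h s)) l) x = frag_extend (frag_of \<circ> h) (cell \<alpha> f l x)" for f l
      by (induction l) (auto simp: frag_extend_add frag_extend_cmul)
    have "fibre \<alpha> w x = frag_extend (frag_of \<circ> h) (fibre \<alpha> u x)"
      unfolding w_def by (induction u) (auto simp: frag_extend_add cell comp_def)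
    then show "l1_norm (fibre \<alpha> w x) = l1_norm (fibre \<alpha> u x)"
      using l1_norm_relabel[OF h keys_fibre] by simp
  qed
qed

section \<open>Invariant measures\<close>

locale invariant_measure =
  fixes G :: "'g monoid" and X :: "'x measure" and \<alpha> :: "'g \<Rightarrow> 'x \<Rightarrow> 'x" and \<nu> :: "'x measure"
  assumes act: "\<And>\<gamma>. \<gamma> \<in> carrier G \<Longrightarrow> \<alpha> \<gamma> \<in> X \<rightarrow>\<^sub>M X"
    and inv: "\<nu> \<in> invariant_probability G X \<alpha>"
begin

sublocale prob_space \<nu>
  using inv by (simp add: invariant_probability_def)

lemma sets_eq [measurable_cong]: "sets \<nu> = sets X"
  using inv by (simp add: invariant_probability_def)

lemma space_eq: "space \<nu> = space X"
  using sets_eq by (rule sets_eq_imp_space_eq)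

lemma act_measurable: "\<gamma> \<in> carrier G \<Longrightarrow> \<alpha> \<gamma> \<in> \<nu> \<rightarrow>\<^sub>M \<nu>"
  using act measurable_cong_sets[OF sets_eq sets_eq] by blast

lemma distr_act:
  assumes "\<gamma> \<in> carrier G"
  shows "distr \<nu> \<nu> (\<alpha> \<gamma>) = \<nu>"
proof -
  have "distr \<nu> \<nu> (\<alpha> \<gamma>) = distr \<nu> X (\<alpha> \<gamma>)" by (rule distr_cong) (auto simp: sets_eq)
  then show ?thesis using inv assms by (simp add: invariant_probability_def)
qed

lemma AE_act:
  assumes "\<gamma> \<in> carrier G" "AE x in \<nu>. P x"
  shows "AE x in \<nu>. P (\<alpha> \<gamma> x)"
proof -
  have "AE x in distr \<nu> \<nu> (\<alpha> \<gamma>). P x" unfolding distr_act[OF assms(1)] by (rule assms(2))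
  then show ?thesis by (rule AE_distrD[OF act_measurable[OF assms(1)]])
qed

lemma integral_act:
  assumes "\<gamma> \<in> carrier G" "h \<in> borel_measurable \<nu>"
  shows "(\<integral>x. h (\<alpha> \<gamma> x) \<partial>\<nu>) = (\<integral>x. (h x :: real) \<partial>\<nu>)"
  using integral_distr[OF act_measurable[OF assms(1)] assms(2)] by (simp add: distr_act[OF assms(1)])

section \<open>Bounded integer-valued functions with the L1 distance\<close>

abbreviation "L \<equiv> Linf_functions \<nu>"
abbreviation "l1_dist f h \<equiv> (\<integral>x. \<bar>real_of_int (f x - h x)\<bar> \<partial>\<nu>)"

lemma L_I:
  assumes "f \<in> \<nu> \<rightarrow>\<^sub>M count_space UNIV" "AE x in \<nu>. \<bar>f x\<bar> \<le> B"
  shows "f \<in> L"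
  using assms by (auto simp: Linf_functions_def)

lemma L_measurable: "f \<in> L \<Longrightarrow> f \<in> \<nu> \<rightarrow>\<^sub>M count_space UNIV"
  by (simp add: Linf_functions_def)

lemma L_measurable_real: "f \<in> L \<Longrightarrow> (\<lambda>x. real_of_int (f x)) \<in> borel_measurable \<nu>"
  using L_measurable by measurable

lemma L_const: "(\<lambda>_. k) \<in> L"
  by (intro L_I[of _ "\<bar>k\<bar>"]) auto

text \<open>As the values are integers, a pointwise operation preserves measurability without
  further ado; what has to be checked is boundedness, through the bounding function T.\<close>

lemma L_map2:
  assumes f: "f \<in> L" and h: "h \<in> L" and B: "\<And>a b A B. \<bar>a\<bar> \<le> A \<Longrightarrow> \<bar>b\<bar> \<le> B \<Longrightarrow> \<bar>t a b\<bar> \<le> (T A B :: int)"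
  shows "(\<lambda>x. t (f x) (h x)) \<in> L"
proof -
  obtain A where A: "AE x in \<nu>. \<bar>f x\<bar> \<le> A" using f by (auto simp: Linf_functions_def)
  obtain C where C: "AE x in \<nu>. \<bar>h x\<bar> \<le> C" using h by (auto simp: Linf_functions_def)
  have "(\<lambda>x. t (f x) (h x)) \<in> \<nu> \<rightarrow>\<^sub>M count_space UNIV"
    using measurable_compose_countable[of "\<lambda>i x. t i (h x)" \<nu> "count_space UNIV" f] L_measurable[OF f] L_measurable[OF h]
    by measurable
  moreover have "AE x in \<nu>. \<bar>t (f x) (h x)\<bar> \<le> T A C" using A C B by auto
  ultimately show ?thesis by (rule L_I)
qed

lemma L_add: "f \<in> L \<Longrightarrow> h \<in> L \<Longrightarrow> (\<lambda>x. f x + h x) \<in> L"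
  by (rule L_map2[where T="(+)"]) auto

lemma L_diff: "f \<in> L \<Longrightarrow> h \<in> L \<Longrightarrow> (\<lambda>x. f x - h x) \<in> L"
  by (rule L_map2[where T="(+)"]) auto

lemma L_mult: "f \<in> L \<Longrightarrow> h \<in> L \<Longrightarrow> (\<lambda>x. f x * h x) \<in> L"
  by (rule L_map2[where T="\<lambda>a b. \<bar>a\<bar> * \<bar>b\<bar>"]) (auto simp: abs_mult intro!: mult_mono)

lemma L_cmult: "f \<in> L \<Longrightarrow> (\<lambda>x. k * f x) \<in> L"
  using L_mult[OF L_const] .

lemma L_act:
  assumes "f \<in> L" "\<gamma> \<in> carrier G"
  shows "(\<lambda>x. f (\<alpha> \<gamma> x)) \<in> L"
proof -
  obtain B where B: "AE x in \<nu>. \<bar>f x\<bar> \<le> B" using assms by (auto simp: Linf_functions_def)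
  show ?thesis
    using AE_act[OF assms(2) B] measurable_compose[OF act_measurable[OF assms(2)] L_measurable[OF assms(1)]]
    by (intro L_I) auto
qed

lemma L_integrable:
  assumes "f \<in> L"
  shows "integrable \<nu> (\<lambda>x. real_of_int (f x))"
proof -
  obtain B where B: "AE x in \<nu>. \<bar>f x\<bar> \<le> B" using assms by (auto simp: Linf_functions_def)
  show ?thesis
    by (rule integrable_const_bound[where B="of_int B"])
       (use B L_measurable_real[OF assms] in \<open>auto elim!: eventually_mono simp flip: of_int_abs\<close>)
qed

abbreviation "cells \<equiv> lists (UNIV \<times> carrier G \<times> UNIV)"

lemma lookup_cell_L:
  assumes "f \<in> L" "l \<in> cells"
  shows "(\<lambda>x. poly_mapping.lookup (cell \<alpha> f l x) s) \<in> L"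
  using assms(2)
proof (induction l)
  case (Cons a l)
  obtain k g t where a: "a = (k, g, t)" by (cases a)
  have "(\<lambda>x. (if s = t then k else 0) * f (\<alpha> g x)) \<in> L"
    using Cons a by (intro L_cmult L_act assms) auto
  moreover have "(\<lambda>x. poly_mapping.lookup (cell \<alpha> f l x) s) \<in> L" using Cons by auto
  moreover have "poly_mapping.lookup (cell \<alpha> f (a # l) x) s =
      (if s = t then k else 0) * f (\<alpha> g x) + poly_mapping.lookup (cell \<alpha> f l x) s" for x
    by (simp add: a lookup_add)
  ultimately show ?case using L_add by presburger
qed (simp add: L_const)

lemma lookup_fibre_L:
  assumes "u \<in> lists (L \<times> cells)"
  shows "(\<lambda>x. poly_mapping.lookup (fibre \<alpha> u x) s) \<in> L"
  using assms
proof (induction u)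
  case (Cons a u)
  then show ?case by (cases a) (auto simp: lookup_add intro!: L_add lookup_cell_L)
qed (simp add: L_const)

lemma integrable_fibre:
  assumes "u \<in> lists (L \<times> cells)"
  shows "integrable \<nu> (\<lambda>x. l1_norm (fibre \<alpha> u x))"
  unfolding l1_norm_fibre
  by (intro Bochner_Integration.integrable_sum integrable_abs L_integrable lookup_fibre_L assms)

text \<open>By invariance all translates of f have the same integral of the absolute value, so the
  group elements in l do not enter the bound.\<close>

lemma integral_cell_le:
  assumes f: "f \<in> L" and l: "l \<in> cells"
  shows "(\<integral>x. l1_norm (cell \<alpha> f l x) \<partial>\<nu>) \<le> (\<Sum>(k, g, s)\<leftarrow>l. \<bar>real_of_int k\<bar>) * (\<integral>x. \<bar>real_of_int (f x)\<bar> \<partial>\<nu>)"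
  using l
proof (induction l)
  case (Cons a l)
  obtain k g s where a: "a = (k, g, s)" by (cases a)
  have g: "g \<in> carrier G" and l: "l \<in> cells" using Cons a by auto
  have int1: "integrable \<nu> (\<lambda>x. \<bar>real_of_int k\<bar> * \<bar>real_of_int (f (\<alpha> g x))\<bar>)"
    by (intro integrable_mult_right integrable_abs L_integrable L_act f g)
  have int2: "integrable \<nu> (\<lambda>x. l1_norm (cell \<alpha> f l x))" "integrable \<nu> (\<lambda>x. l1_norm (cell \<alpha> f (a # l) x))"
    using integrable_fibre[of "[(f, l)]"] integrable_fibre[of "[(f, a # l)]"] f l g by (simp_all add: a)
  have "(\<integral>x. l1_norm (cell \<alpha> f (a # l) x) \<partial>\<nu>)
      \<le> (\<integral>x. \<bar>real_of_int k\<bar> * \<bar>real_of_int (f (\<alpha> g x))\<bar> + l1_norm (cell \<alpha> f l x) \<partial>\<nu>)"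
  proof (rule integral_mono[OF int2(2) Bochner_Integration.integrable_add[OF int1 int2(1)]])
    fix x
    show "l1_norm (cell \<alpha> f (a # l) x) \<le> \<bar>real_of_int k\<bar> * \<bar>real_of_int (f (\<alpha> g x))\<bar> + l1_norm (cell \<alpha> f l x)"
      using l1_norm_add[of "frag_cmul (k * f (\<alpha> g x)) (frag_of s)" "cell \<alpha> f l x"]
      by (simp add: a l1_norm_cmul_frag_of abs_mult)
  qed
  also have "\<dots> = \<bar>real_of_int k\<bar> * (\<integral>x. \<bar>real_of_int (f (\<alpha> g x))\<bar> \<partial>\<nu>) + (\<integral>x. l1_norm (cell \<alpha> f l x) \<partial>\<nu>)"
    using int1 int2(1) by (subst Bochner_Integration.integral_add) auto
  also have "(\<integral>x. \<bar>real_of_int (f (\<alpha> g x))\<bar> \<partial>\<nu>) = (\<integral>x. \<bar>real_of_int (f x)\<bar> \<partial>\<nu>)"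
    using L_measurable_real[OF f] by (intro integral_act[OF g, of "\<lambda>x. \<bar>real_of_int (f x)\<bar>"]) simp
  finally show ?case using Cons.IH l by (simp add: a distrib_right)
qed simp

text \<open>Coefficients are replaced one at a time, each at the cost of half of the remaining
  error. The arbitrary prefix v absorbs entries that are already replaced, and in the application it
  carries the fundamental cycle. The lists in \<open>B\<close> stay as they are, so boundaries
  remain boundaries.\<close>

lemma fibre_norm_approx:
  fixes B :: "(int \<times> 'g \<times> 's) list set"
  assumes D: "D \<subseteq> L" "\<And>f e. f \<in> L \<Longrightarrow> e > 0 \<Longrightarrow> \<exists>d\<in>D. l1_dist d f < e"
    and B: "B \<subseteq> cells"
    and u: "u \<in> lists (L \<times> B)" and e: "e > 0"
  shows "\<exists>u'\<in>lists (D \<times> B). \<forall>v\<in>lists (L \<times> cells). fibre_norm \<alpha> \<nu> (v @ u') \<le> fibre_norm \<alpha> \<nu> (v @ u) + e"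
  using u e
proof (induction u arbitrary: e)
  case Nil
  then show ?case by (intro bexI[of _ "[]"]) auto
next
  case (Cons a u)
  obtain f l where a: "a = (f, l)" by (cases a)
  have fl: "f \<in> L" "l \<in> B" "u \<in> lists (L \<times> B)" using Cons a by auto
  have sub: "lists (L \<times> B) \<subseteq> lists (L \<times> cells)" using B by (intro lists_mono) auto
  have "\<exists>u'\<in>lists (D \<times> B). \<forall>v\<in>lists (L \<times> cells). fibre_norm \<alpha> \<nu> (v @ u') \<le> fibre_norm \<alpha> \<nu> (v @ u) + e / 2"
    using Cons.prems by (intro Cons.IH) simp
  then obtain u' where u': "u' \<in> lists (D \<times> B)"
    "\<And>v. v \<in> lists (L \<times> cells) \<Longrightarrow> fibre_norm \<alpha> \<nu> (v @ u') \<le> fibre_norm \<alpha> \<nu> (v @ u) + e / 2"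
    by blast
  define c where "c = (\<Sum>(k, g, s)\<leftarrow>l. \<bar>real_of_int k\<bar>)"
  have c: "c \<ge> 0" unfolding c_def by (rule sum_list_nonneg) auto
  \<comment> \<open>Dividing by \<open>1 + c\<close> in place of c covers the case that all weights
    vanish.\<close>
  obtain d where d: "d \<in> D" "l1_dist d f < e / 2 / (1 + c)"
    using D(2)[OF fl(1), of "e / 2 / (1 + c)"] Cons.prems c by (auto simp: field_simps)
  have dL: "d \<in> L" using d D by auto
  have small: "(\<integral>x. l1_norm (cell \<alpha> (\<lambda>x. d x - f x) l x) \<partial>\<nu>) \<le> e / 2"
  proof -
    have "(\<integral>x. l1_norm (cell \<alpha> (\<lambda>x. d x - f x) l x) \<partial>\<nu>) \<le> c * l1_dist d f"
      unfolding c_def using fl B by (intro integral_cell_le L_diff dL) auto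
    also have "\<dots> \<le> c * (e / 2 / (1 + c))" using d c by (intro mult_left_mono) auto
    also have "\<dots> \<le> e / 2" using c Cons.prems by (simp add: field_simps)
    finally show ?thesis .
  qed
  show ?case
  proof (intro bexI[of _ "(d, l) # u'"] ballI)
    show "(d, l) # u' \<in> lists (D \<times> B)" using d fl u' by auto
    fix v :: "(('x \<Rightarrow> int) \<times> (int \<times> 'g \<times> 's) list) list" assume v: "v \<in> lists (L \<times> cells)"
    have lc: "l \<in> cells" "u \<in> lists (L \<times> cells)" using fl B sub by auto
    have w: "v @ [(d, l)] \<in> lists (L \<times> cells)" using v dL lc by auto
    have "fibre_norm \<alpha> \<nu> (v @ (d, l) # u') \<le> fibre_norm \<alpha> \<nu> (v @ (d, l) # u) + e / 2"
      using u'(2)[OF w] by simp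
    also have "fibre_norm \<alpha> \<nu> (v @ (d, l) # u) \<le>
        (\<integral>x. l1_norm (fibre \<alpha> (v @ (f, l) # u) x) + l1_norm (cell \<alpha> (\<lambda>x. d x - f x) l x) \<partial>\<nu>)"
      unfolding fibre_norm_def
    proof (rule integral_mono)
      show "integrable \<nu> (\<lambda>x. l1_norm (fibre \<alpha> (v @ (d, l) # u) x))"
        using v dL lc by (intro integrable_fibre) auto
      show "integrable \<nu> (\<lambda>x. l1_norm (fibre \<alpha> (v @ (f, l) # u) x) + l1_norm (cell \<alpha> (\<lambda>x. d x - f x) l x))"
        using v fl lc integrable_fibre[of "[(\<lambda>x. d x - f x, l)]"] L_diff[OF dL fl(1)]
        by (intro Bochner_Integration.integrable_add integrable_fibre) auto
      fix x
      have "cell \<alpha> d l x = cell \<alpha> (\<lambda>x. d x - f x) l x + cell \<alpha> f l x"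
        by (subst cell_add[symmetric]) simp
      then have "fibre \<alpha> (v @ (d, l) # u) x = fibre \<alpha> (v @ (f, l) # u) x + cell \<alpha> (\<lambda>x. d x - f x) l x"
        by simp
      then show "l1_norm (fibre \<alpha> (v @ (d, l) # u) x) \<le>
          l1_norm (fibre \<alpha> (v @ (f, l) # u) x) + l1_norm (cell \<alpha> (\<lambda>x. d x - f x) l x)"
        by (simp only: l1_norm_add)
    qed
    also have "\<dots> = fibre_norm \<alpha> \<nu> (v @ (f, l) # u) + (\<integral>x. l1_norm (cell \<alpha> (\<lambda>x. d x - f x) l x) \<partial>\<nu>)"
      unfolding fibre_norm_def
    proof (rule Bochner_Integration.integral_add)
      show "integrable \<nu> (\<lambda>x. l1_norm (fibre \<alpha> (v @ (f, l) # u) x))"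
        using v fl lc by (intro integrable_fibre) auto
      show "integrable \<nu> (\<lambda>x. l1_norm (cell \<alpha> (\<lambda>x. d x - f x) l x))"
        using integrable_fibre[of "[(\<lambda>x. d x - f x, l)]"] L_diff[OF dL fl(1)] lc by simp
    qed
    finally show "fibre_norm \<alpha> \<nu> (v @ (d, l) # u') \<le> fibre_norm \<alpha> \<nu> (v @ a # u) + e"
      using small a by simp
  qed
qed

end

section \<open>Integer combinations of indicators\<close>

definition step_functions :: "'x set set \<Rightarrow> ('x \<Rightarrow> int) set" where
  "step_functions \<G> = (\<lambda>l x. \<Sum>(k, A)\<leftarrow>l. k * indicator A x) ` lists (UNIV \<times> \<G>)"

lemma countable_step_functions: "countable \<G> \<Longrightarrow> countable (step_functions \<G>)"
  unfolding step_functions_def by (intro countable_image countable_lists countable_SIGMA) auto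

text \<open>The bound holds everywhere and does not refer to a measure; together with measurability
  it makes step functions admissible coefficients for all invariant measures at once.\<close>

lemma step_functions_bounded:
  assumes "f \<in> step_functions \<G>"
  shows "\<exists>B. \<forall>x. \<bar>f x\<bar> \<le> B"
proof -
  obtain l where f: "f = (\<lambda>x. \<Sum>(k, A)\<leftarrow>l. k * indicator A x)" using assms by (auto simp: step_functions_def)
  have "\<bar>\<Sum>(k, A)\<leftarrow>l. k * indicator A x\<bar> \<le> (\<Sum>(k, A)\<leftarrow>l. \<bar>k\<bar>)" for x
  proof (induction l)
    case (Cons a l)
    obtain k A where a: "a = (k, A)" by (cases a)
    have "\<bar>k * indicator A x\<bar> \<le> \<bar>k\<bar>" by (simp add: indicator_def)
    then show ?case using Cons by (simp add: a)
  qed simp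
  then show ?thesis unfolding f by blast
qed

lemma step_functions_measurable:
  assumes "f \<in> step_functions \<G>" "\<G> \<subseteq> sets X"
  shows "f \<in> X \<rightarrow>\<^sub>M count_space UNIV"
proof -
  obtain l where f: "f = (\<lambda>x. \<Sum>(k, A)\<leftarrow>l. k * indicator A x)" and l: "l \<in> lists (UNIV \<times> \<G>)"
    using assms by (auto simp: step_functions_def)
  show ?thesis unfolding f using l
  proof (induction l)
    case (Cons a l)
    obtain k A where a: "a = (k, A)" by (cases a)
    have [measurable]: "A \<in> sets X" using Cons a assms by auto
    define S :: "'a \<Rightarrow> int" where "S x = (\<Sum>(k, A)\<leftarrow>l. k * indicator A x)" for x
    have [measurable]: "S \<in> X \<rightarrow>\<^sub>M count_space UNIV" using Cons by (auto simp: S_def[abs_def])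
    have "(\<lambda>x. k * (if x \<in> A then 1 else 0) + S x) \<in> X \<rightarrow>\<^sub>M count_space UNIV"
      by measurable
    moreover have "k * (if x \<in> A then 1 else 0) + S x = (\<Sum>(k, A)\<leftarrow>a # l. k * indicator A x)" for x
      by (simp add: a S_def)
    ultimately show ?case by simp
  qed simp
qed

lemma step_functions_add:
  assumes "f \<in> step_functions \<G>" "h \<in> step_functions \<G>"
  shows "(\<lambda>x. f x + h x) \<in> step_functions \<G>"
proof -
  obtain l l' where "f = (\<lambda>x. \<Sum>(k, A)\<leftarrow>l. k * indicator A x)" "l \<in> lists (UNIV \<times> \<G>)"
    "h = (\<lambda>x. \<Sum>(k, A)\<leftarrow>l'. k * indicator A x)" "l' \<in> lists (UNIV \<times> \<G>)"
    using assms by (auto simp: step_functions_def)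
  then show ?thesis unfolding step_functions_def by (intro image_eqI[of _ _ "l @ l'"]) auto
qed

lemma step_functions_cmult:
  assumes "f \<in> step_functions \<G>"
  shows "(\<lambda>x. c * f x) \<in> step_functions \<G>"
proof -
  obtain l where l: "f = (\<lambda>x. \<Sum>(k, A)\<leftarrow>l. k * indicator A x)" "l \<in> lists (UNIV \<times> \<G>)"
    using assms by (auto simp: step_functions_def)
  have "c * (\<Sum>(k, A)\<leftarrow>l. k * indicator A x) = (\<Sum>(k, A)\<leftarrow>map (\<lambda>(k, A). (c * k, A)) l. k * indicator A x)" for x :: 'a
    by (induction l) (auto simp: distrib_left)
  then show ?thesis
    unfolding step_functions_def l(1)
    by (intro image_eqI[of _ _ "map (\<lambda>(k, A). (c * k, A)) l"]) (use l(2) in auto)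
qed

lemma step_functions_0: "(\<lambda>_. 0) \<in> step_functions \<G>"
  unfolding step_functions_def by (intro image_eqI[of _ _ "[]"]) auto

lemma step_functions_indicator: "A \<in> \<G> \<Longrightarrow> (\<lambda>x. indicator A x) \<in> step_functions \<G>"
  unfolding step_functions_def by (intro image_eqI[of _ _ "[(1, A)]"]) auto

lemma step_functions_sum:
  "finite I \<Longrightarrow> (\<And>i. i \<in> I \<Longrightarrow> f i \<in> step_functions \<G>) \<Longrightarrow> (\<lambda>x. \<Sum>i\<in>I. f i x) \<in> step_functions \<G>"
  by (induction I rule: finite_induct) (auto intro: step_functions_0 step_functions_add)

context invariant_measure
begin

lemma step_functions_L:
  assumes "f \<in> step_functions \<G>" "\<G> \<subseteq> sets X"
  shows "f \<in> L"
proof -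
  obtain B where "\<forall>x. \<bar>f x\<bar> \<le> B" using step_functions_bounded[OF assms(1)] by blast
  moreover have "f \<in> \<nu> \<rightarrow>\<^sub>M count_space UNIV"
    using step_functions_measurable[OF assms] measurable_cong_sets[OF sets_eq refl] by blast
  ultimately show ?thesis by (intro L_I) auto
qed

lemma indicator_L: "A \<in> sets X \<Longrightarrow> (\<lambda>x. indicator A x) \<in> L"
  by (rule step_functions_L[OF step_functions_indicator[of A "{A}"]]) auto

lemma integral_abs_triangle:
  assumes "f \<in> L" "g \<in> L" "h \<in> L"
  shows "l1_dist f h \<le>
    l1_dist f g + l1_dist g h"
proof -
  have i: "integrable \<nu> (\<lambda>x. \<bar>real_of_int (f x - h x)\<bar>)" "integrable \<nu> (\<lambda>x. \<bar>real_of_int (f x - g x)\<bar>)"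
    "integrable \<nu> (\<lambda>x. \<bar>real_of_int (g x - h x)\<bar>)"
    using L_diff assms by (auto intro!: integrable_abs L_integrable simp del: of_int_diff)
  have "l1_dist f h \<le>
      (\<integral>x. \<bar>real_of_int (f x - g x)\<bar> + \<bar>real_of_int (g x - h x)\<bar> \<partial>\<nu>)"
    using i by (intro integral_mono Bochner_Integration.integrable_add) auto
  then show ?thesis using i by simp
qed

lemma integral_abs_sum_le:
  fixes I :: "'i set"
  assumes "finite I" "\<And>i. i \<in> I \<Longrightarrow> d i \<in> L" "\<And>i. i \<in> I \<Longrightarrow> f i \<in> L"
  shows "(\<integral>x. \<bar>real_of_int ((\<Sum>i\<in>I. d i x) - (\<Sum>i\<in>I. f i x))\<bar> \<partial>\<nu>) \<le>
    (\<Sum>i\<in>I. \<integral>x. \<bar>real_of_int (d i x - f i x)\<bar> \<partial>\<nu>)"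
proof -
  have i: "integrable \<nu> (\<lambda>x. \<bar>real_of_int (d i x - f i x)\<bar>)" if "i \<in> I" for i
    using that assms by (intro integrable_abs L_integrable L_diff) auto
  have s: "(\<lambda>x. \<Sum>i\<in>I. f i x) \<in> L" if "\<And>i. i \<in> I \<Longrightarrow> f i \<in> L" for f :: "'i \<Rightarrow> 'x \<Rightarrow> int"
    using assms(1) that by (induction I rule: finite_induct) (auto intro: L_const L_add)
  have "(\<integral>x. \<bar>real_of_int ((\<Sum>i\<in>I. d i x) - (\<Sum>i\<in>I. f i x))\<bar> \<partial>\<nu>) \<le>
      (\<integral>x. (\<Sum>i\<in>I. \<bar>real_of_int (d i x - f i x)\<bar>) \<partial>\<nu>)"
  proof (rule integral_mono)
    show "integrable \<nu> (\<lambda>x. \<bar>real_of_int ((\<Sum>i\<in>I. d i x) - (\<Sum>i\<in>I. f i x))\<bar>)"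
      using assms by (intro integrable_abs L_integrable L_diff s) auto
    show "integrable \<nu> (\<lambda>x. \<Sum>i\<in>I. \<bar>real_of_int (d i x - f i x)\<bar>)"
      using i by (intro Bochner_Integration.integrable_sum) auto
    show "\<bar>real_of_int ((\<Sum>i\<in>I. d i x) - (\<Sum>i\<in>I. f i x))\<bar> \<le> (\<Sum>i\<in>I. \<bar>real_of_int (d i x - f i x)\<bar>)" for x
      using sum_abs[of "\<lambda>i. real_of_int (d i x - f i x)" I] by (simp add: sum_subtractf)
  qed
  also have "\<dots> = (\<Sum>i\<in>I. \<integral>x. \<bar>real_of_int (d i x - f i x)\<bar> \<partial>\<nu>)"
    using i by (intro Bochner_Integration.integral_sum) auto
  finally show ?thesis .
qed

text \<open>Induction over the Dynkin system generated by \<open>\<G>\<close>. Integer coefficients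
  suffice for all its operations: a complement is the difference from the indicator of
  \<open>space X\<close>, and a disjoint union is a sum. A countable union is first cut off after n
  sets by continuity of the measure.\<close>

lemma indicator_approx:
  assumes \<G>: "Int_stable \<G>" "\<G> \<subseteq> Pow (space X)" "space X \<in> \<G>" "sets X = sigma_sets (space X) \<G>"
    and A: "A \<in> sets X" and e: "e > 0"
  shows "\<exists>d\<in>step_functions \<G>. l1_dist d (indicator A) < e"
  using A[unfolded \<G>(4)] e
proof (induction arbitrary: e rule: sigma_sets_induct_disjoint[OF \<G>(1,2), consumes 1, case_names 1 2 3 4])
  case (1 A)
  then show ?case by (intro bexI[of _ "\<lambda>x. indicator A x"] step_functions_indicator) auto
next
  case 2
  then show ?case by (intro bexI[OF _ step_functions_0]) auto
next
  case (3 A)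
  then obtain d where d: "d \<in> step_functions \<G>" "l1_dist d (indicator A) < e" by blast
  have "A \<subseteq> space X" using 3 \<G> sets.sets_into_space by blast
  then have "(\<integral>x. \<bar>real_of_int (indicator (space X) x + (-1) * d x - indicator (space X - A) x)\<bar> \<partial>\<nu>) =
      l1_dist d (indicator A)"
    by (intro Bochner_Integration.integral_cong refl) (auto simp: indicator_def space_eq)
  moreover have "(\<lambda>x. indicator (space X) x + (-1) * d x) \<in> step_functions \<G>"
    by (intro step_functions_add step_functions_cmult step_functions_indicator \<G>(3) d(1))
  ultimately show ?case using d(2) by (intro bexI[of _ "\<lambda>x. indicator (space X) x + (-1) * d x"]) linarith
next
  case (4 A)
  have AX: "A i \<in> sets X" for i using 4 \<G>(4) by blast
  define U where "U n = (\<Union>i<n. A i)" for n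
  have UX [measurable]: "U n \<in> sets X" for n using AX by (auto simp: U_def)
  have "(\<lambda>n. measure \<nu> (U n)) \<longlonglongrightarrow> measure \<nu> (\<Union>n. U n)"
    by (rule finite_Lim_measure_incseq) (auto simp: incseq_def U_def sets_eq AX intro: order_less_le_trans)
  moreover have UN: "(\<Union>n. U n) = (\<Union>i. A i)" by (auto simp: U_def)
  ultimately obtain n where n: "\<bar>measure \<nu> (U n) - measure \<nu> (\<Union>i. A i)\<bar> < e / 2"
    using LIMSEQ_D[of "\<lambda>n. measure \<nu> (U n)" "measure \<nu> (\<Union>i. A i)" "e / 2"] \<open>e > 0\<close> by fastforce
  \<comment> \<open>The n approximations share the error e / 2; \<open>real n + 1\<close> covers the
    case n = 0.\<close>
  have "\<forall>i. \<exists>d. d \<in> step_functions \<G> \<and> l1_dist d (indicator (A i)) < e / (2 * (real n + 1))"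
    using 4(3)[of "e / (2 * (real n + 1))"] \<open>e > 0\<close> by (meson divide_pos_pos mult_pos_pos of_nat_0_le_iff add_nonneg_pos zero_less_numeral zero_less_one)
  then obtain d where d: "\<And>i. d i \<in> step_functions \<G>"
    "\<And>i. l1_dist (d i) (indicator (A i)) < e / (2 * (real n + 1))"
    by metis
  let ?d = "\<lambda>x. \<Sum>i<n. d i x"
  have \<G>X: "\<G> \<subseteq> sets X" using \<G>(4) by auto
  have dD: "?d \<in> step_functions \<G>" using d by (intro step_functions_sum) auto
  have ind: "indicator (U n) x = (\<Sum>i<n. indicator (A i) x :: int)" for x
    unfolding U_def using 4(1) by (intro indicator_UN_disjoint) (auto intro: disjoint_family_on_mono)
  have AU: "(\<Union>i. A i) \<in> sets X" using AX by auto
  have "l1_dist ?d (indicator (\<Union>i. A i)) \<le>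
      l1_dist ?d (indicator (U n)) +
      (\<integral>x. \<bar>real_of_int (indicator (U n) x - indicator (\<Union>i. A i) x)\<bar> \<partial>\<nu>)"
    by (intro integral_abs_triangle indicator_L UX AU step_functions_L[OF dD \<G>X])
  also have "l1_dist ?d (indicator (U n)) \<le> (\<Sum>i<n. \<integral>x. \<bar>real_of_int (d i x - indicator (A i) x)\<bar> \<partial>\<nu>)"
    unfolding ind by (intro integral_abs_sum_le indicator_L AX step_functions_L[OF d(1) \<G>X]) auto
  also have "\<dots> \<le> (\<Sum>i<n. e / (2 * (real n + 1)))"
    by (intro sum_mono less_imp_le[OF d(2)])
  also have "\<dots> \<le> e / 2" using \<open>e > 0\<close> by (simp add: field_simps)
  also have "(\<integral>x. \<bar>real_of_int (indicator (U n) x - indicator (\<Union>i. A i) x)\<bar> \<partial>\<nu>) =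
      (\<integral>x. indicator ((\<Union>i. A i) - U n) x \<partial>\<nu>)"
    by (intro Bochner_Integration.integral_cong refl) (auto simp: indicator_def U_def)
  also have "\<dots> = measure \<nu> ((\<Union>i. A i) - U n)"
    using sets.sets_into_space[OF AU] by (simp add: space_eq Int_absorb2 Diff_subset[THEN subset_trans])
  also have "\<dots> = measure \<nu> (\<Union>i. A i) - measure \<nu> (U n)"
    using AU UX by (intro finite_measure_Diff) (auto simp: U_def sets_eq)
  also have "\<dots> < e / 2" using n by linarith
  finally show ?case using dD by (intro bexI[OF _ dD]) simp
qed

text \<open>A bounded integer-valued function is almost everywhere a finite combination of the
  indicators of its level sets, with its values as coefficients. This reduces the claim to
  indicators.\<close>

lemma step_functions_dense:
  assumes \<G>: "Int_stable \<G>" "\<G> \<subseteq> Pow (space X)" "space X \<in> \<G>" "sets X = sigma_sets (space X) \<G>"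
    and f: "f \<in> L" and e: "e > 0"
  shows "\<exists>d\<in>step_functions \<G>. l1_dist d f < e"
proof -
  obtain B where B: "AE x in \<nu>. \<bar>f x\<bar> \<le> B" using f by (auto simp: Linf_functions_def)
  define A where "A k = f -` {k} \<inter> space X" for k
  have AX: "A k \<in> sets X" for k
    using measurable_sets[OF L_measurable[OF f], of "{k}"] by (simp add: A_def sets_eq space_eq)
  have \<G>X: "\<G> \<subseteq> sets X" using \<G>(4) by auto
  \<comment> \<open>The total weight with which the errors of the level sets enter; it may be 0, so
    1 is added before dividing by it.\<close>
  define S where "S = (\<Sum>k\<in>{-B..B}. \<bar>real_of_int k\<bar>)"
  have S: "S \<ge> 0" by (simp add: S_def sum_nonneg)
  have "\<forall>k. \<exists>d. d \<in> step_functions \<G> \<and> l1_dist d (indicator (A k)) < e / (S + 1)"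
    using indicator_approx[OF \<G> AX, of "e / (S + 1)"] e S by (auto simp: Bex_def)
  then obtain d where d: "\<And>k. d k \<in> step_functions \<G>"
    "\<And>k. l1_dist (d k) (indicator (A k)) < e / (S + 1)"
    by metis
  let ?d = "\<lambda>x. \<Sum>k\<in>{-B..B}. k * d k x"
  have dD: "?d \<in> step_functions \<G>" using d by (intro step_functions_sum step_functions_cmult) auto
  have "AE x in \<nu>. \<bar>real_of_int (?d x - f x)\<bar> = \<bar>real_of_int (?d x - (\<Sum>k\<in>{-B..B}. k * indicator (A k) x))\<bar>"
    using B AE_space
  proof eventually_elim
    case (elim x)
    have "(\<Sum>k\<in>{-B..B}. k * indicator (A k) x) = (\<Sum>k\<in>{-B..B}. if k = f x then k else 0)"
      using elim by (intro sum.cong) (auto simp: A_def space_eq)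
    also have "\<dots> = f x" using elim by (auto simp: abs_le_iff)
    finally show ?case by simp
  qed
  then have "l1_dist ?d f =
      (\<integral>x. \<bar>real_of_int (?d x - (\<Sum>k\<in>{-B..B}. k * indicator (A k) x))\<bar> \<partial>\<nu>)"
    using L_measurable_real[OF L_diff[OF step_functions_L[OF dD \<G>X] f]]
      borel_measurable_integrable[OF L_integrable[OF L_diff[OF step_functions_L[OF dD \<G>X]
          step_functions_L[OF step_functions_sum[of "{-B..B}" "\<lambda>k x. k * indicator (A k) x" "sets X"]]]]]
      AX
    by (intro integral_cong_AE borel_measurable_abs) (auto intro: step_functions_cmult step_functions_indicator)
  also have "\<dots> \<le> (\<Sum>k\<in>{-B..B}. \<integral>x. \<bar>real_of_int (k * d k x - k * indicator (A k) x)\<bar> \<partial>\<nu>)"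
    by (intro integral_abs_sum_le L_cmult indicator_L AX step_functions_L[OF d(1) \<G>X]) auto
  also have "\<dots> = (\<Sum>k\<in>{-B..B}. \<bar>real_of_int k\<bar> * l1_dist (d k) (indicator (A k)))"
    by (intro sum.cong refl) (simp add: abs_mult flip: right_diff_distrib)
  also have "\<dots> \<le> (\<Sum>k\<in>{-B..B}. \<bar>real_of_int k\<bar> * (e / (S + 1)))"
    by (intro sum_mono mult_left_mono less_imp_le[OF d(2)]) auto
  also have "\<dots> = S * (e / (S + 1))"
    unfolding S_def by (rule sum_distrib_right[symmetric])
  also have "\<dots> < e" using S e by (simp add: field_simps)
  finally show ?thesis using dD by (intro bexI[of _ ?d])
qed

end

section \<open>Ergodic decomposition of the norm\<close>

text \<open>Unlike an essential bound, a bound that is uniform in x holds for all measures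
  \<open>\<beta> x\<close> simultaneously, as integration along the decomposition requires.\<close>

lemma fibre_bounded:
  assumes "\<And>f l. (f, l) \<in> set u \<Longrightarrow> \<exists>B. \<forall>x. \<bar>f x\<bar> \<le> (B :: int)"
  shows "\<exists>C. \<forall>x. l1_norm (fibre \<alpha> u x) \<le> C"
  using assms
proof (induction u)
  case Nil
  then show ?case by (intro exI[of _ 0]) simp
next
  case (Cons a u)
  obtain f l where a: "a = (f, l)" by (cases a)
  obtain B where B: "\<And>x. \<bar>f x\<bar> \<le> B" using Cons.prems[of f l] a by auto
  obtain C where C: "\<And>x. l1_norm (fibre \<alpha> u x) \<le> C" using Cons.IH Cons.prems by (meson list.set_intros(2))
  have "l1_norm (cell \<alpha> f l x) \<le> (\<Sum>(k, g, s)\<leftarrow>l. \<bar>real_of_int k\<bar> * real_of_int B)" for x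
  proof -
    have "(\<Sum>(k, g, s)\<leftarrow>l. \<bar>real_of_int k\<bar> * \<bar>real_of_int (f (\<alpha> g x))\<bar>) \<le> (\<Sum>(k, g, s)\<leftarrow>l. \<bar>real_of_int k\<bar> * real_of_int B)"
    proof (rule sum_list_mono)
      fix a assume "a \<in> set l"
      obtain k g s where "a = (k, g, s)" by (cases a)
      moreover have "\<bar>real_of_int (f (\<alpha> g x))\<bar> \<le> real_of_int B"
        using B[of "\<alpha> g x"] by (simp flip: of_int_abs)
      ultimately show "(case a of (k, g, s) \<Rightarrow> \<bar>real_of_int k\<bar> * \<bar>real_of_int (f (\<alpha> g x))\<bar>) \<le> (case a of (k, g, s) \<Rightarrow> \<bar>real_of_int k\<bar> * real_of_int B)"
        by (simp add: mult_left_mono)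
    qed
    with l1_norm_cell_le[of \<alpha> f l x] show ?thesis by linarith
  qed
  note c = this
  have "l1_norm (fibre \<alpha> (a # u) x) \<le> (\<Sum>(k, g, s)\<leftarrow>l. \<bar>real_of_int k\<bar> * real_of_int B) + C" for x
    using l1_norm_add[of "cell \<alpha> f l x" "fibre \<alpha> u x"] c[of x] C[of x] by (simp add: a)
  then show ?case by blast
qed

lemma fibre_concat: "fibre \<alpha> (concat us) x = (\<Sum>u\<leftarrow>us. fibre \<alpha> u x)"
  by (induction us) auto

locale ergodic_decomposed =
  fixes G :: "'g monoid" and X :: "'x measure" and \<alpha> :: "'g \<Rightarrow> 'x \<Rightarrow> 'x" and \<mu> :: "'x measure"
    and \<beta> :: "'x \<Rightarrow> 'x measure"
  assumes spa: "standard_probability_action G X \<alpha> \<mu>"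
    and dec: "ergodic_decomposition G X \<alpha> \<mu> \<beta>"
begin

section \<open>Integration along the ergodic decomposition\<close>

lemma \<alpha>_measurable: "\<gamma> \<in> carrier G \<Longrightarrow> \<alpha> \<gamma> \<in> X \<rightarrow>\<^sub>M X"
  using spa by (simp add: standard_probability_action_def standard_action_def)

lemma invariant_measureI: "\<nu> \<in> invariant_probability G X \<alpha> \<Longrightarrow> invariant_measure G X \<alpha> \<nu>"
  using \<alpha>_measurable by unfold_locales

sublocale invariant_measure G X \<alpha> \<mu>
  using spa by (intro invariant_measureI) (simp add: standard_probability_action_def)

lemma \<beta>_Erg: "x \<in> space X \<Longrightarrow> \<beta> x \<in> Erg G X \<alpha>"
  using dec by (auto simp: ergodic_decomposition_def)

lemma \<beta>_invariant_measure: "x \<in> space X \<Longrightarrow> invariant_measure G X \<alpha> (\<beta> x)"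
  using \<beta>_Erg invariant_measureI by (simp add: Erg_def)

lemma \<beta>_invariant_measure': "x \<in> space \<mu> \<Longrightarrow> invariant_measure G X \<alpha> (\<beta> x)"
  by (simp add: \<beta>_invariant_measure space_eq)

lemma \<beta>_act: "x \<in> space X \<Longrightarrow> \<gamma> \<in> carrier G \<Longrightarrow> \<beta> (\<alpha> \<gamma> x) = \<beta> x"
  using dec by (simp add: ergodic_decomposition_def)

lemma \<beta>_measure:
  assumes "A \<in> sets X"
  shows "(\<lambda>x. measure (\<beta> x) A) \<in> borel_measurable \<mu>" "measure \<mu> A = (\<integral>x. measure (\<beta> x) A \<partial>\<mu>)"
proof -
  have "(\<lambda>x. measure (\<beta> x) A) \<in> borel_measurable X"
    using dec assms unfolding ergodic_decomposition_def by blast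
  then show "(\<lambda>x. measure (\<beta> x) A) \<in> borel_measurable \<mu>" using measurable_cong_sets[OF sets_eq refl] by blast
  show "measure \<mu> A = (\<integral>x. measure (\<beta> x) A \<partial>\<mu>)"
    using dec assms unfolding ergodic_decomposition_def by blast
qed

text \<open>An ergodic decomposition gives the fibre over each ergodic measure full measure for it;
  here the ergodic measure is \<open>\<beta> x\<close> itself.\<close>

lemma \<beta>_AE:
  assumes x: "x \<in> space X"
  shows "AE y in \<beta> x. y \<in> space X \<and> \<beta> y = \<beta> x"
proof -
  interpret b: invariant_measure G X \<alpha> "\<beta> x" by (rule \<beta>_invariant_measure[OF x])
  have "{y \<in> space X. \<beta> y = \<beta> x} \<in> sets X" "measure (\<beta> x) {y \<in> space X. \<beta> y = \<beta> x} = 1"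
    using dec \<beta>_Erg[OF x] by (auto simp: ergodic_decomposition_def)
  then have "AE y in \<beta> x. y \<in> {y \<in> space X. \<beta> y = \<beta> x}" by (intro b.AE_prob_1)
  then show ?thesis by simp
qed

text \<open>Reading the decomposition as a kernel, and \<open>\<mu>\<close> below as the result of
  \<open>bind\<close>, transfers the decomposition formula from sets to integrals of bounded
  functions.\<close>

lemma \<beta>_kernel: "\<beta> \<in> \<mu> \<rightarrow>\<^sub>M subprob_algebra X"
proof (rule measurable_subprob_algebra)
  fix x assume "x \<in> space \<mu>"
  then interpret b: invariant_measure G X \<alpha> "\<beta> x" by (rule \<beta>_invariant_measure')
  show "subprob_space (\<beta> x)" "sets (\<beta> x) = sets X" by (simp_all add: b.sets_eq prob_space_imp_subprob_space b.prob_space_axioms)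
next
  fix A assume A: "A \<in> sets X"
  have "(\<lambda>x. ennreal (measure (\<beta> x) A)) \<in> borel_measurable \<mu>"
    using \<beta>_measure(1)[OF A] by simp
  moreover have "emeasure (\<beta> x) A = ennreal (measure (\<beta> x) A)" if "x \<in> space \<mu>" for x
  proof -
    interpret b: invariant_measure G X \<alpha> "\<beta> x" by (rule \<beta>_invariant_measure'[OF that])
    show ?thesis by (rule b.emeasure_eq_measure)
  qed
  ultimately show "(\<lambda>x. emeasure (\<beta> x) A) \<in> borel_measurable \<mu>" by (simp cong: measurable_cong)
qed

lemma \<mu>_bind: "\<mu> = \<mu> \<bind> \<beta>"
proof (rule measure_eqI)
  show "sets \<mu> = sets (\<mu> \<bind> \<beta>)"
    using sets_bind[of \<mu> \<beta> X] sets_kernel[OF \<beta>_kernel] not_empty by (simp add: sets_eq)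
  fix A assume A: "A \<in> sets \<mu>"
  then have AX: "A \<in> sets X" by (simp add: sets_eq)
  have m: "(\<lambda>x. measure (\<beta> x) A) \<in> borel_measurable \<mu>"
    by (rule \<beta>_measure(1)[OF AX])
  have "emeasure (\<mu> \<bind> \<beta>) A = (\<integral>\<^sup>+x. emeasure (\<beta> x) A \<partial>\<mu>)"
    by (rule emeasure_bind[OF not_empty \<beta>_kernel AX])
  also have "\<dots> = (\<integral>\<^sup>+x. ennreal (measure (\<beta> x) A) \<partial>\<mu>)"
  proof (rule nn_integral_cong)
    fix x assume "x \<in> space \<mu>"
    then interpret b: invariant_measure G X \<alpha> "\<beta> x" by (rule \<beta>_invariant_measure')
    show "emeasure (\<beta> x) A = ennreal (measure (\<beta> x) A)" by (rule b.emeasure_eq_measure)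
  qed
  also have "\<dots> = ennreal (\<integral>x. measure (\<beta> x) A \<partial>\<mu>)"
  proof (rule nn_integral_eq_integral)
    have "measure (\<beta> x) A \<le> 1" if "x \<in> space \<mu>" for x
    proof -
      interpret b: invariant_measure G X \<alpha> "\<beta> x" by (rule \<beta>_invariant_measure'[OF that])
      show ?thesis by simp
    qed
    then show "integrable \<mu> (\<lambda>x. measure (\<beta> x) A)"
      by (intro integrable_const_bound[where B=1] m AE_I2) auto
  qed auto
  also have "\<dots> = emeasure \<mu> A"
    using \<beta>_measure(2)[OF AX] by (simp add: emeasure_eq_measure)
  finally show "emeasure \<mu> A = emeasure (\<mu> \<bind> \<beta>) A" by simp
qed

lemma \<beta>_integral:
  fixes h :: "'x \<Rightarrow> real"
  assumes h: "h \<in> borel_measurable X" "\<And>x. x \<in> space X \<Longrightarrow> \<bar>h x\<bar> \<le> C"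
  shows "(\<lambda>x. \<integral>y. h y \<partial>\<beta> x) \<in> borel_measurable \<mu>"
    and "(\<integral>x. h x \<partial>\<mu>) = (\<integral>x. (\<integral>y. h y \<partial>\<beta> x) \<partial>\<mu>)"
    and "\<And>x. x \<in> space X \<Longrightarrow> \<bar>\<integral>y. h y \<partial>\<beta> x\<bar> \<le> C"
    and "integrable \<mu> (\<lambda>x. \<integral>y. h y \<partial>\<beta> x)"
    and "\<And>x. x \<in> space X \<Longrightarrow> integrable (\<beta> x) h"
proof -
  show m: "(\<lambda>x. \<integral>y. h y \<partial>\<beta> x) \<in> borel_measurable \<mu>"
    using measurable_compose[OF \<beta>_kernel integral_measurable_subprob_algebra[OF h(1)]] .
  have "(\<integral>x. h x \<partial>(\<mu> \<bind> \<beta>)) = (\<integral>x. (\<integral>y. h y \<partial>\<beta> x) \<partial>\<mu>)"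
  proof (rule integral_bind[OF h \<beta>_kernel, where B'=1])
    show "finite_measure \<mu>" by (rule finite_measure_axioms)
    show "AE x in \<mu>. emeasure (\<beta> x) (space (\<beta> x)) \<le> ennreal 1"
    proof (rule AE_I2)
      fix x assume "x \<in> space \<mu>"
      then interpret b: invariant_measure G X \<alpha> "\<beta> x" by (rule \<beta>_invariant_measure')
      show "emeasure (\<beta> x) (space (\<beta> x)) \<le> ennreal 1" by (simp add: b.emeasure_space_1)
    qed
  qed
  then show "(\<integral>x. h x \<partial>\<mu>) = (\<integral>x. (\<integral>y. h y \<partial>\<beta> x) \<partial>\<mu>)" using \<mu>_bind by simp
  show i: "integrable (\<beta> x) h" if x: "x \<in> space X" for x
  proof -
    interpret b: invariant_measure G X \<alpha> "\<beta> x" by (rule \<beta>_invariant_measure[OF x])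
    show ?thesis
      using h measurable_cong_sets[OF b.sets_eq refl] by (intro b.integrable_const_bound[where B=C] AE_I2) (auto simp: b.space_eq)
  qed
  show bd: "\<bar>\<integral>y. h y \<partial>\<beta> x\<bar> \<le> C" if x: "x \<in> space X" for x
  proof -
    interpret b: invariant_measure G X \<alpha> "\<beta> x" by (rule \<beta>_invariant_measure[OF x])
    have "\<bar>\<integral>y. h y \<partial>\<beta> x\<bar> \<le> (\<integral>y. \<bar>h y\<bar> \<partial>\<beta> x)" by (rule integral_abs_bound)
    also have "\<dots> \<le> (\<integral>y. C \<partial>\<beta> x)"
      using h(2) i[OF x] by (intro integral_mono) (auto simp: b.space_eq)
    finally show ?thesis by (simp add: b.prob_space)
  qed
  show "integrable \<mu> (\<lambda>x. \<integral>y. h y \<partial>\<beta> x)"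
    by (intro integrable_const_bound[where B=C] m AE_I2) (auto simp: space_eq bd)
qed

text \<open>A is a union of fibres of \<open>\<beta>\<close> and \<open>\<beta> x\<close> lives on
  the fibre of x, so the indicator is almost everywhere the constant
  \<open>indicator A x\<close>.\<close>

lemma \<beta>_indicator:
  fixes h :: "'x \<Rightarrow> real"
  assumes A: "A \<in> sets X" "\<And>x y. x \<in> space X \<Longrightarrow> y \<in> space X \<Longrightarrow> \<beta> x = \<beta> y \<Longrightarrow> x \<in> A \<Longrightarrow> y \<in> A"
    and h: "h \<in> borel_measurable X" and x: "x \<in> space X"
  shows "(\<integral>y. indicator A y * h y \<partial>\<beta> x) = indicator A x * (\<integral>y. h y \<partial>\<beta> x)"
proof -
  interpret b: invariant_measure G X \<alpha> "\<beta> x" by (rule \<beta>_invariant_measure[OF x])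
  have [measurable]: "h \<in> borel_measurable (\<beta> x)" "A \<in> sets (\<beta> x)"
    using h A measurable_cong_sets[OF b.sets_eq refl] by (auto simp: b.sets_eq)
  have "(\<integral>y. indicator A y * h y \<partial>\<beta> x) = (\<integral>y. indicator A x * h y \<partial>\<beta> x)"
  proof (rule integral_cong_AE)
    show "AE y in \<beta> x. indicator A y * h y = indicator A x * h y"
      using \<beta>_AE[OF x]
    proof eventually_elim
      case (elim y)
      then have "y \<in> A \<longleftrightarrow> x \<in> A" using A(2)[of x y] A(2)[of y x] x by auto
      then show ?case by (simp add: indicator_def)
    qed
  qed measurable
  then show ?thesis by simp
qed

text \<open>The measure-theoretic core, free of topology: \<open>\<zeta>\<close> will be a lifted
  fundamental cycle and \<open>B\<close> the boundaries of chains of degree n + 1 in list form. The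
  index set of V depends on the measure through \<open>Linf_functions\<close>; this dependence is
  removed in \<open>V_D\<close>.\<close>

theorem integral_INF_fibre_norm:
  fixes B :: "(int \<times> 'g \<times> 's) list set" and \<zeta> :: "(int \<times> 'g \<times> 's) list"
  assumes B: "B \<subseteq> cells" and \<zeta>: "\<zeta> \<in> cells"
  defines "V \<equiv> \<lambda>\<nu>. INF u\<in>lists (Linf_functions \<nu> \<times> B). fibre_norm \<alpha> \<nu> ((\<lambda>_. 1, \<zeta>) # u)"
  shows "integrable \<mu> (\<lambda>x. V (\<beta> x))" and "V \<mu> = (\<integral>x. V (\<beta> x) \<partial>\<mu>)"
proof -
  have "standard_borel X" using spa by (simp add: standard_probability_action_def standard_action_def)
  then obtain \<G> where "countable \<G>" and \<G>: "Int_stable \<G>" "\<G> \<subseteq> Pow (space X)" "space X \<in> \<G>"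
      "sets X = sigma_sets (space X) \<G>"
    by (rule standard_borel_countably_generated)
  have \<G>X: "\<G> \<subseteq> sets X" using \<G>(4) by auto
  define D where "D = step_functions \<G>"
  have countD: "countable D" unfolding D_def by (rule countable_step_functions) fact
  define N where "N \<nu> u = fibre_norm \<alpha> \<nu> ((\<lambda>_. 1, \<zeta>) # u)" for \<nu> and u :: "(('x \<Rightarrow> int) \<times> (int \<times> 'g \<times> 's) list) list"
  have N_nonneg: "0 \<le> N \<nu> u" for \<nu> u by (simp add: N_def fibre_norm_def l1_norm_nonneg)
  have bdd: "bdd_below (N \<nu> ` A)" for \<nu> A using N_nonneg by (intro bdd_belowI[of _ 0]) auto
  let ?S = "lists (D \<times> B)"
  have DL: "D \<subseteq> Linf_functions \<nu>" if "invariant_measure G X \<alpha> \<nu>" for \<nu>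
    using invariant_measure.step_functions_L[OF that _ \<G>X] by (auto simp: D_def)
  have V_D: "V \<nu> = (INF u\<in>?S. N \<nu> u)" if n: "invariant_measure G X \<alpha> \<nu>" for \<nu>
  proof (rule antisym)
    interpret n: invariant_measure G X \<alpha> \<nu> by (rule n)
    show "V \<nu> \<le> (INF u\<in>?S. N \<nu> u)"
      unfolding V_def N_def[symmetric]
      using DL[OF n] by (intro cINF_superset_mono bdd lists_mono Sigma_mono) (auto intro: lists.Nil)
    show "(INF u\<in>?S. N \<nu> u) \<le> V \<nu>"
      unfolding V_def N_def[symmetric]
    proof (rule cINF_greatest)
      fix u assume u: "u \<in> lists (n.L \<times> B)"
      show "(INF u\<in>?S. N \<nu> u) \<le> N \<nu> u"
      proof (rule field_le_epsilon)
        fix e :: real assume "e > 0"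
        then obtain u' where u': "u' \<in> ?S"
          "\<And>v. v \<in> lists (n.L \<times> cells) \<Longrightarrow> fibre_norm \<alpha> \<nu> (v @ u') \<le> fibre_norm \<alpha> \<nu> (v @ u) + e"
          using n.fibre_norm_approx[OF DL[OF n] _ B u, of e] n.step_functions_dense[OF \<G>] unfolding D_def by blast
        have "(INF u\<in>?S. N \<nu> u) \<le> N \<nu> u'" by (intro cINF_lower bdd u')
        also have "\<dots> \<le> N \<nu> u + e" using u'(2)[of "[(\<lambda>_. 1, \<zeta>)]"] \<zeta> n.L_const[of 1] by (simp add: N_def)
        finally show "(INF u\<in>?S. N \<nu> u) \<le> N \<nu> u + e" .
      qed
    qed (use lists.Nil in blast)
  qed
  have "\<exists>w. w \<in> lists (insert (\<lambda>_. 1) D \<times> lists (UNIV \<times> carrier G \<times> (UNIV :: nat set))) \<and>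
      (\<forall>x. l1_norm (fibre \<alpha> w x) = l1_norm (fibre \<alpha> ((\<lambda>_. 1, \<zeta>) # u) x))" if "u \<in> ?S" for u
  proof -
    have "(\<lambda>_. 1, \<zeta>) # u \<in> lists (insert (\<lambda>_. 1) D \<times> lists (UNIV \<times> carrier G \<times> UNIV))"
      using that \<zeta> B by (auto 4 3)
    then show ?thesis using fibre_relabel by metis
  qed
  then obtain w where w: "\<And>u. u \<in> ?S \<Longrightarrow> w u \<in> lists (insert (\<lambda>_. 1) D \<times> lists (UNIV \<times> carrier G \<times> (UNIV :: nat set)))"
    "\<And>u x. u \<in> ?S \<Longrightarrow> l1_norm (fibre \<alpha> (w u) x) = l1_norm (fibre \<alpha> ((\<lambda>_. 1, \<zeta>) # u) x)"
    by metis
  have "countable (carrier G)" using spa by (simp add: standard_probability_action_def standard_action_def)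
  then have c: "countable ((UNIV :: int set) \<times> carrier G \<times> (UNIV :: nat set))"
    by (intro countable_SIGMA countableI_type)
  have "countable (insert (\<lambda>_. 1) D \<times> lists ((UNIV :: int set) \<times> carrier G \<times> (UNIV :: nat set)))"
    by (rule countable_SIGMA[OF countable_insert[OF countD] countable_lists[OF c]])
  then have "countable (lists (insert (\<lambda>_. 1) D \<times> lists ((UNIV :: int set) \<times> carrier G \<times> (UNIV :: nat set))))"
    by (rule countable_lists)
  then have "countable (w ` ?S)" by (rule countable_subset[rotated]) (use w(1) in blast)
  \<comment> \<open>One u is kept for each value of w. Since \<open>N \<nu> u\<close> depends on u
    only through \<open>w u\<close>, the same countable S serves every measure.\<close>
  then obtain S where S: "countable S" "S \<subseteq> ?S" "w ` ?S = w ` S"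
    using countable_subset_image[of "w ` ?S" w ?S] by auto
  have N_eq: "N \<nu> u = N \<nu> u'" if "u \<in> ?S" "u' \<in> ?S" "w u = w u'" for u u' \<nu>
    using w(2)[OF that(1)] w(2)[OF that(2)] that(3) by (simp add: N_def fibre_norm_def)
  have NS: "N \<nu> ` ?S = N \<nu> ` S" for \<nu>
  proof
    show "N \<nu> ` ?S \<subseteq> N \<nu> ` S"
    proof (rule image_subsetI)
      fix u assume u: "u \<in> ?S"
      then have "w u \<in> w ` S" unfolding S(3)[symmetric] by (rule imageI)
      then obtain u' where "w u = w u'" "u' \<in> S" by (rule imageE)
      then show "N \<nu> u \<in> N \<nu> ` S" using N_eq[OF u, of u'] S(2) by auto
    qed
  qed (use S in auto)
  have V_S: "V \<nu> = (INF u\<in>S. N \<nu> u)" if "invariant_measure G X \<alpha> \<nu>" for \<nu>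
    using V_D[OF that] unfolding NS .
  have "S \<noteq> {}" using S(3) lists.Nil by blast

  define h where "h u x = l1_norm (fibre \<alpha> ((\<lambda>_. 1, \<zeta>) # u) x)" for u x
  have N_h: "N \<nu> u = (\<integral>x. h u x \<partial>\<nu>)" for \<nu> u by (simp add: N_def fibre_norm_def h_def)
  have h_measurable: "h u \<in> borel_measurable X" if "u \<in> lists (L \<times> B)" for u
  proof -
    have "(\<lambda>_. 1, \<zeta>) # u \<in> lists (L \<times> cells)" using that \<zeta> B L_const[of 1] by (auto 4 3)
    then have "h u \<in> borel_measurable \<mu>" unfolding h_def[abs_def] by (intro borel_measurable_integrable integrable_fibre)
    then show ?thesis using measurable_cong_sets[OF sets_eq refl] by blast
  qed
  have SL: "?S \<subseteq> lists (L \<times> B)" using DL[OF invariant_measure_axioms] by (intro lists_mono) auto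
  have "\<forall>u\<in>?S. \<exists>C. \<forall>x. h u x \<le> C"
    unfolding h_def
  proof (intro ballI fibre_bounded)
    fix u f l assume "u \<in> ?S" "(f, l) \<in> set ((\<lambda>_. 1, \<zeta>) # u)"
    then have "f = (\<lambda>_. 1) \<or> f \<in> D" by auto
    then show "\<exists>B. \<forall>x. \<bar>f x\<bar> \<le> B" using step_functions_bounded by (auto simp: D_def)
  qed
  then obtain C where C: "\<And>u x. u \<in> ?S \<Longrightarrow> h u x \<le> C u" by metis
  have h_nonneg: "0 \<le> h u x" for u x by (simp add: h_def l1_norm_nonneg)
  have h_bound: "\<bar>h u x\<bar> \<le> C u" if "u \<in> ?S" for u x using C[OF that] h_nonneg[of u x] by simp
  have h_meas: "h u \<in> borel_measurable X" if "u \<in> ?S" for u using that SL by (intro h_measurable) auto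
  have S_sub: "u \<in> ?S" if "u \<in> S" for u using S that by blast
  \<comment> \<open>The empty list stands for the fundamental cycle with nothing added. It bounds V
    from above and is the fallback on the set left over by the gluing.\<close>
  have NIL: "[] \<in> ?S" by (rule lists.Nil)

  have V_le: "V (\<beta> x) \<le> N (\<beta> x) u" if "x \<in> space X" "u \<in> ?S" for x u
    using V_D[OF \<beta>_invariant_measure[OF that(1)]] that(2) bdd by (simp add: cINF_lower)
  have V_nonneg: "0 \<le> V (\<beta> x)" if "x \<in> space X" for x
    using V_S[OF \<beta>_invariant_measure[OF that]] N_nonneg \<open>S \<noteq> {}\<close> by (simp add: cINF_greatest)
  have N_meas: "(\<lambda>x. N (\<beta> x) u) \<in> borel_measurable \<mu>" if "u \<in> ?S" for u
    unfolding N_h using \<beta>_integral(1)[OF h_meas h_bound] that by blast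
  have V_meas: "(\<lambda>x. V (\<beta> x)) \<in> borel_measurable \<mu>"
  proof -
    have "(\<lambda>x. INF u\<in>S. N (\<beta> x) u) \<in> borel_measurable \<mu>"
      using S bdd N_meas S_sub by (intro borel_measurable_cINF) auto
    moreover have "V (\<beta> x) = (INF u\<in>S. N (\<beta> x) u)" if "x \<in> space \<mu>" for x
      using that V_S[OF \<beta>_invariant_measure] by (simp add: space_eq)
    ultimately show ?thesis by (simp cong: measurable_cong)
  qed
  have V_le_C: "V (\<beta> x) \<le> C []" if "x \<in> space X" for x
    using V_le[OF that NIL] \<beta>_integral(3)[OF h_meas[OF NIL] h_bound[OF NIL] that] unfolding N_h by linarith
  show int: "integrable \<mu> (\<lambda>x. V (\<beta> x))"
    using V_le_C V_nonneg by (intro integrable_const_bound[where B="C []"] V_meas AE_I2) (auto simp: space_eq)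
  have V\<mu>: "V \<mu> = (INF u\<in>S. N \<mu> u)" by (rule V_S[OF invariant_measure_axioms])
  have N_int: "N \<mu> u = (\<integral>x. N (\<beta> x) u \<partial>\<mu>)" "integrable \<mu> (\<lambda>x. N (\<beta> x) u)" if "u \<in> ?S" for u
    unfolding N_h using \<beta>_integral(2,4)[OF h_meas h_bound] that by blast+

  show "V \<mu> = (\<integral>x. V (\<beta> x) \<partial>\<mu>)"
  proof (rule antisym)
    show "(\<integral>x. V (\<beta> x) \<partial>\<mu>) \<le> V \<mu>"
      unfolding V\<mu>
    proof (rule cINF_greatest[OF \<open>S \<noteq> {}\<close>])
      fix u assume u: "u \<in> S"
      show "(\<integral>x. V (\<beta> x) \<partial>\<mu>) \<le> N \<mu> u"
        unfolding N_int(1)[OF S_sub[OF u]]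
        using V_le S_sub[OF u] by (intro integral_mono int N_int(2)) (auto simp: space_eq)
    qed
    show "V \<mu> \<le> (\<integral>x. V (\<beta> x) \<partial>\<mu>)"
    proof (rule field_le_epsilon)
      fix e :: real assume e: "e > 0"
      \<comment> \<open>If S is finite the enumeration repeats elements, which is harmless because Y
        assigns each point to its first good index.\<close>
      define s where "s = from_nat_into S"
      have sS: "s k \<in> ?S" for k using S \<open>S \<noteq> {}\<close> from_nat_into[of S k] by (auto simp: s_def)
      define good where "good k x \<longleftrightarrow> N (\<beta> x) (s k) < V (\<beta> x) + e / 2" for k x
      define Y where "Y k = {x \<in> space X. good k x \<and> (\<forall>j<k. \<not> good j x)}" for k
      have ex_good: "\<exists>k. good k x" if x: "x \<in> space X" for x
      proof -
        have "(INF u\<in>S. N (\<beta> x) u) < V (\<beta> x) + e / 2"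
          using V_S[OF \<beta>_invariant_measure[OF x]] e by simp
        then obtain u where "u \<in> S" "N (\<beta> x) u < V (\<beta> x) + e / 2"
          using cINF_less_iff[OF \<open>S \<noteq> {}\<close> bdd] by blast
        moreover obtain k where "u = s k"
          using from_nat_into_surj[OF S(1) \<open>u \<in> S\<close>] by (auto simp: s_def)
        ultimately show ?thesis by (auto simp: good_def)
      qed
      have Y_sets: "Y k \<in> sets X" for k
      proof -
        have m: "{x \<in> space X. good k x} \<in> sets X" for k
        proof -
          have "{x \<in> space \<mu>. N (\<beta> x) (s k) < V (\<beta> x) + e / 2} \<in> sets \<mu>"
            using N_meas[OF sS] V_meas by measurable
          then show ?thesis by (simp add: good_def space_eq sets_eq)
        qed
        have "Y k = {x \<in> space X. good k x} - (\<Union>j<k. {x \<in> space X. good j x})"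
          by (auto simp: Y_def)
        then show ?thesis using m by auto
      qed
      have Y_disj: "disjoint_family Y"
        unfolding disjoint_family_on_def Y_def by (auto, metis linorder_neqE_nat)
      have Y_UN: "(\<Union>k. Y k) = space X"
      proof -
        have "x \<in> Y (LEAST k. good k x)" if "x \<in> space X" for x
          using LeastI_ex[OF ex_good[OF that]] not_less_Least that by (auto simp: Y_def)
        then show ?thesis by (auto simp: Y_def)
      qed
      \<comment> \<open>\<open>good\<close> refers to x only through \<open>\<beta> x\<close>, so Y
        k is a union of fibres of \<open>\<beta>\<close> and in particular invariant.\<close>
      have Y_sat: "y \<in> Y k" if "x \<in> space X" "y \<in> space X" "\<beta> x = \<beta> y" "x \<in> Y k" for x y k
        using that by (auto simp: Y_def good_def)
      define U where "U K = (\<Union>k<K. Y k)" for K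
      have "(\<lambda>K. measure \<mu> (U K)) \<longlonglongrightarrow> measure \<mu> (\<Union>K. U K)"
        by (rule finite_Lim_measure_incseq) (auto simp: incseq_def U_def sets_eq Y_sets intro: order_less_le_trans)
      moreover have "(\<Union>K. U K) = space \<mu>" using Y_UN by (auto simp: U_def space_eq)
      ultimately have lim: "(\<lambda>K. measure \<mu> (U K)) \<longlonglongrightarrow> 1" by (simp add: prob_space)
      have C0: "0 \<le> C []" using h_bound[OF NIL, of undefined] by linarith
      \<comment> \<open>On a leftover set of this measure the norm is at most \<open>C []\<close>,
        which costs at most e / 2; the other e / 2 is spent in \<open>good\<close>.\<close>
      have "0 < e / (2 * (C [] + 1))" using e C0 by simp
      then obtain K where "\<bar>measure \<mu> (U K) - 1\<bar> < e / (2 * (C [] + 1))"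
        using LIMSEQ_D[OF lim] by fastforce
      then have K: "1 - measure \<mu> (U K) < e / (2 * (C [] + 1))" by linarith
      have U_sets: "U K \<in> sets X" using Y_sets by (auto simp: U_def)
      have rest: "measure \<mu> (space X - U K) < e / (2 * (C [] + 1))"
        using prob_compl[of "U K"] U_sets K by (simp add: sets_eq space_eq)

      \<comment> \<open>Only the coefficient functions are cut down to Y k. The lists in
        \<open>B\<close> are untouched, so the concatenation W is again admissible.\<close>
      define us where "us k = map (\<lambda>(f, l). (\<lambda>y. indicator (Y k) y * f y, l)) (s k)" for k
      define W where "W = concat (map us [0..<K])"
      have us_L: "us k \<in> lists (L \<times> B)" for k
        using sS[of k] SL indicator_L[OF Y_sets[of k]] unfolding us_def by (fastforce intro!: L_mult)
      have "x \<in> L \<times> B" if "x \<in> set (us k)" for x k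
        using us_L[of k] that by (rule in_listsD[rule_format])
      then have W_L: "W \<in> lists (L \<times> B)" unfolding W_def in_lists_conv_set by auto
      have fibre_us: "fibre \<alpha> (us k) x = frag_cmul (indicator (Y k) x) (fibre \<alpha> (s k) x)" if x: "x \<in> space X" for k x
      proof -
        have ind: "indicator (Y k) (\<alpha> g x) = (indicator (Y k) x :: int)" if g: "g \<in> carrier G" for g
        proof -
          have "\<alpha> g x \<in> space X" using \<alpha>_measurable[OF g] x by (rule measurable_space)
          then have "\<alpha> g x \<in> Y k \<longleftrightarrow> x \<in> Y k"
            using Y_sat[of x "\<alpha> g x" k] Y_sat[of "\<alpha> g x" x k] \<beta>_act[OF x g] x by metis
          then show ?thesis by (simp add: indicator_def)
        qed
        have "fibre \<alpha> (map (\<lambda>(f, l). (\<lambda>y. indicator (Y k) y * f y, l)) u) x = frag_cmul (indicator (Y k) x) (fibre \<alpha> u x)"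
          if "u \<in> lists (UNIV \<times> B)" for u
          using that
        proof (induction u)
          case (Cons a u)
          obtain f l where a: "a = (f, l)" by (cases a)
          have "l \<in> cells" using Cons a B by auto
          then have "cell \<alpha> (\<lambda>y. indicator (Y k) y * f y) l x = frag_cmul (indicator (Y k) x) (cell \<alpha> f l x)"
            using ind by (intro cell_restrict) auto
          then show ?case using Cons a by (simp add: frag_cmul_distrib2)
        qed simp
        moreover have "s k \<in> lists (UNIV \<times> B)" using sS[of k] by (auto 4 3)
        ultimately show ?thesis by (simp add: us_def)
      qed
      have fibre_W: "fibre \<alpha> W x = (\<Sum>k<K. frag_cmul (indicator (Y k) x) (fibre \<alpha> (s k) x))" if "x \<in> space X" for x
        unfolding W_def fibre_concat using fibre_us[OF that]
        by (simp add: comp_def sum_list_distinct_conv_sum_set atLeast0LessThan)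
      \<comment> \<open>At most one piece contributes at x, and none outside U K, where the
        unmodified cycle remains.\<close>
      have h_W: "h W x = (\<Sum>k<K. indicator (Y k) x * h (s k) x) + indicator (space X - U K) x * h [] x" if x: "x \<in> space X" for x
      proof (cases "x \<in> U K")
        case True
        then obtain j where j: "j < K" "x \<in> Y j" by (auto simp: U_def)
        have ind: "indicator (Y k) x = (if k = j then 1 else 0)" for k
          using j Y_disj by (auto simp: disjoint_family_on_def indicator_def)
        have "fibre \<alpha> W x = (\<Sum>k<K. if k = j then fibre \<alpha> (s k) x else 0)"
          unfolding fibre_W[OF x] ind by (intro sum.cong) auto
        then have "fibre \<alpha> W x = fibre \<alpha> (s j) x" using j by simp
        moreover have "(\<Sum>k<K. indicator (Y k) x * h (s k) x) = (\<Sum>k<K. if k = j then h (s k) x else 0)"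
          unfolding ind by (intro sum.cong) auto
        ultimately show ?thesis using j True by (simp add: h_def)
      next
        case False
        then have ind: "indicator (Y k) x = 0" if "k < K" for k using that by (auto simp: U_def indicator_def)
        then have "fibre \<alpha> W x = 0" unfolding fibre_W[OF x] using False by (intro sum.neutral) (auto simp: U_def indicator_def)
        moreover have "(\<Sum>k<K. indicator (Y k) x * h (s k) x) = 0"
          using False by (intro sum.neutral) (auto simp: U_def indicator_def)
        ultimately show ?thesis using x False by (simp add: h_def)
      qed
      have h_ind: "(\<lambda>x. indicator A x * h u x) \<in> borel_measurable X" "\<bar>indicator A x * h u x\<bar> \<le> C u"
        if "u \<in> ?S" "A \<in> sets X" for u A x
        using that h_meas[OF that(1)] h_bound[OF that(1), of x] h_nonneg[of u x] C[OF that(1), of x]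
        by (auto simp: indicator_def)
      have h_ind_int: "integrable \<mu> (\<lambda>x. indicator A x * h u x)" if "u \<in> ?S" "A \<in> sets X" for u A
        using h_ind[OF that] measurable_cong_sets[OF sets_eq refl] by (intro integrable_const_bound[where B="C u"] AE_I2) auto
      have Vint: "integrable \<mu> (\<lambda>x. V (\<beta> x) + e / 2)" using int by simp
      have Vind: "integrable \<mu> (\<lambda>x. indicator (Y k) x * (V (\<beta> x) + e / 2))" for k
        using integrable_real_mult_indicator[OF _ Vint, of "Y k"] Y_sets by (simp add: sets_eq mult.commute)
      \<comment> \<open>Almost optimality of s k is known for the measures \<open>\<beta> x\<close>
        and not for \<open>\<mu>\<close>, so the integral is disintegrated first; the indicator of Y
        k then leaves the inner integral.\<close>
      have piece: "(\<integral>x. indicator (Y k) x * h (s k) x \<partial>\<mu>) \<le> (\<integral>x. indicator (Y k) x * (V (\<beta> x) + e / 2) \<partial>\<mu>)" for k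
      proof -
        have "(\<integral>x. indicator (Y k) x * h (s k) x \<partial>\<mu>) = (\<integral>x. (\<integral>y. indicator (Y k) y * h (s k) y \<partial>\<beta> x) \<partial>\<mu>)"
          using h_ind[OF sS Y_sets] by (intro \<beta>_integral(2)[where C="C (s k)"]) auto
        also have "\<dots> \<le> (\<integral>x. indicator (Y k) x * (V (\<beta> x) + e / 2) \<partial>\<mu>)"
        proof (rule integral_mono)
          show "integrable \<mu> (\<lambda>x. \<integral>y. indicator (Y k) y * h (s k) y \<partial>\<beta> x)"
            using h_ind[OF sS Y_sets] by (intro \<beta>_integral(4)[where C="C (s k)"]) auto
          fix x assume "x \<in> space \<mu>"
          then have x: "x \<in> space X" by (simp add: space_eq)
          have "(\<integral>y. indicator (Y k) y * h (s k) y \<partial>\<beta> x) = indicator (Y k) x * N (\<beta> x) (s k)"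
            unfolding N_h by (rule \<beta>_indicator[OF Y_sets _ h_meas[OF sS] x]) (use Y_sat in blast)
          also have "\<dots> \<le> indicator (Y k) x * (V (\<beta> x) + e / 2)"
            by (auto simp: indicator_def Y_def good_def)
          finally show "(\<integral>y. indicator (Y k) y * h (s k) y \<partial>\<beta> x) \<le> indicator (Y k) x * (V (\<beta> x) + e / 2)" .
        qed (rule Vind)
        finally show ?thesis .
      qed
      have restX: "space X - U K \<in> sets X" using U_sets by auto
      have "V \<mu> \<le> N \<mu> W"
        unfolding V_def N_def[symmetric] by (intro cINF_lower bdd W_L)
      also have "\<dots> = (\<integral>x. (\<Sum>k<K. indicator (Y k) x * h (s k) x) + indicator (space X - U K) x * h [] x \<partial>\<mu>)"
        unfolding N_h by (intro Bochner_Integration.integral_cong refl h_W) (simp add: space_eq)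
      also have "\<dots> = (\<Sum>k<K. \<integral>x. indicator (Y k) x * h (s k) x \<partial>\<mu>) + (\<integral>x. indicator (space X - U K) x * h [] x \<partial>\<mu>)"
        by (subst Bochner_Integration.integral_add[OF Bochner_Integration.integrable_sum h_ind_int[OF NIL restX]])
           (rule h_ind_int[OF sS Y_sets], subst Bochner_Integration.integral_sum, rule h_ind_int[OF sS Y_sets], rule refl)
      also have "(\<Sum>k<K. \<integral>x. indicator (Y k) x * h (s k) x \<partial>\<mu>) \<le> (\<Sum>k<K. \<integral>x. indicator (Y k) x * (V (\<beta> x) + e / 2) \<partial>\<mu>)"
        by (intro sum_mono piece)
      also have "\<dots> = (\<integral>x. (\<Sum>k<K. indicator (Y k) x * (V (\<beta> x) + e / 2)) \<partial>\<mu>)"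
        by (rule Bochner_Integration.integral_sum[symmetric]) (rule Vind)
      also have "\<dots> \<le> (\<integral>x. V (\<beta> x) + e / 2 \<partial>\<mu>)"
      proof (rule integral_mono)
        show "integrable \<mu> (\<lambda>x. \<Sum>k<K. indicator (Y k) x * (V (\<beta> x) + e / 2))"
          by (intro Bochner_Integration.integrable_sum Vind)
        show "integrable \<mu> (\<lambda>x. V (\<beta> x) + e / 2)" by (rule Vint)
        fix x assume x: "x \<in> space \<mu>"
        have "(\<Sum>k<K. indicator (Y k) x * (V (\<beta> x) + e / 2)) = (\<Sum>k<K. indicator (Y k) x) * (V (\<beta> x) + e / 2)"
          by (simp add: sum_distrib_right)
        also have "(\<Sum>k<K. indicator (Y k) x) = (indicator (U K) x :: real)"
          unfolding U_def using Y_disj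
          by (intro indicator_UN_disjoint[symmetric]) (auto intro: disjoint_family_on_mono)
        also have "indicator (U K) x * (V (\<beta> x) + e / 2) \<le> V (\<beta> x) + e / 2"
          using V_nonneg[of x] x e by (auto simp: indicator_def space_eq)
        finally show "(\<Sum>k<K. indicator (Y k) x * (V (\<beta> x) + e / 2)) \<le> V (\<beta> x) + e / 2" .
      qed
      also have "\<dots> = (\<integral>x. V (\<beta> x) \<partial>\<mu>) + e / 2" using int by (simp add: prob_space)
      also have "(\<integral>x. indicator (space X - U K) x * h [] x \<partial>\<mu>) \<le> (\<integral>x. C [] * indicator (space X - U K) x \<partial>\<mu>)"
      proof (rule integral_mono[OF h_ind_int[OF NIL restX]])
        show "integrable \<mu> (\<lambda>x. C [] * indicator (space X - U K) x)"
          using restX by (intro integrable_mult_right integrable_real_indicator) (auto simp: sets_eq emeasure_eq_measure)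
        show "indicator (space X - U K) x * h [] x \<le> C [] * indicator (space X - U K) x" for x
          using C[OF NIL, of x] by (simp add: indicator_def)
      qed
      also have "\<dots> = C [] * measure \<mu> (space X - U K)" using restX by (simp add: space_eq Int_absorb2)
      also have "\<dots> \<le> C [] * (e / (2 * (C [] + 1)))" using rest C0 by (intro mult_left_mono) auto
      also have "\<dots> \<le> e / 2" using C0 e by (simp add: field_simps)
      finally show "V \<mu> \<le> (\<integral>x. V (\<beta> x) \<partial>\<mu>) + e" by simp
    qed
  qed
qed

end

section \<open>Tensor products\<close>

text \<open>Closure of the carriers puts all relators into the free Abelian group on pairs from the
  carriers, so that the relations form a subgroup of it.\<close>

locale tensor_setting =
  fixes G :: "'g monoid" and A :: "('g, 'a) right_module" and C :: "('g, 'c) left_module"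
  assumes A_mult: "\<And>a b. a \<in> carrier A \<Longrightarrow> b \<in> carrier A \<Longrightarrow> a \<otimes>\<^bsub>A\<^esub> b \<in> carrier A"
    and A_act: "\<And>a g. a \<in> carrier A \<Longrightarrow> g \<in> carrier G \<Longrightarrow> ract A a g \<in> carrier A"
    and C_mult: "\<And>c d. c \<in> carrier C \<Longrightarrow> d \<in> carrier C \<Longrightarrow> c \<otimes>\<^bsub>C\<^esub> d \<in> carrier C"
    and C_act: "\<And>c g. c \<in> carrier C \<Longrightarrow> g \<in> carrier G \<Longrightarrow> lact C g c \<in> carrier C"
begin

abbreviation "FA \<equiv> free_Abelian_group (carrier A \<times> carrier C)"
abbreviation "R \<equiv> tensor_relations G A C"
abbreviation "tc \<equiv> tensor_class G A C"

lemma keys_frag_diff: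
  assumes "a \<in> S" "b \<in> S"
  shows "Poly_Mapping.keys (frag_of a - frag_of b) \<subseteq> S"
  using keys_diff[of "frag_of a" "frag_of b"] assms by auto

lemma keys_frag_diff2:
  assumes "a \<in> S" "b \<in> S" "c \<in> S"
  shows "Poly_Mapping.keys (frag_of a - frag_of b - frag_of c) \<subseteq> S"
  using keys_diff[of "frag_of a - frag_of b" "frag_of c"] keys_frag_diff[OF assms(1,2)] assms by auto

lemma relators_keys:
  assumes "r \<in> tensor_relators G A C"
  shows "Poly_Mapping.keys r \<subseteq> carrier A \<times> carrier C"
  using assms unfolding tensor_relators_def
  by (elim UnE CollectE exE conjE)
     (simp_all add: A_mult A_act C_mult C_act keys_frag_diff keys_frag_diff2)

lemma relators_carrier: "tensor_relators G A C \<subseteq> carrier FA"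
  using relators_keys by auto

lemma R_subgroup: "subgroup R FA"
  unfolding tensor_relations_def by (rule group.generate_is_subgroup[OF group_free_Abelian_group relators_carrier])

lemma R_keys: "r \<in> R \<Longrightarrow> Poly_Mapping.keys r \<subseteq> carrier A \<times> carrier C"
  using subgroup.subset[OF R_subgroup] unfolding carrier_free_Abelian_group_iff[symmetric] by blast

lemma R_0: "0 \<in> R" and R_add: "u \<in> R \<Longrightarrow> v \<in> R \<Longrightarrow> u + v \<in> R" and R_uminus: "u \<in> R \<Longrightarrow> - u \<in> R"
  using subgroup.one_closed[OF R_subgroup] subgroup.m_closed[OF R_subgroup] subgroup.m_inv_closed[OF R_subgroup, of u] R_keys
  by auto

lemma R_diff: "u \<in> R \<Longrightarrow> v \<in> R \<Longrightarrow> u - v \<in> R"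
  using R_add[OF _ R_uminus] by fastforce

lemma R_sum: "(\<And>i. i \<in> I \<Longrightarrow> u i \<in> R) \<Longrightarrow> (\<Sum>i\<in>I. u i) \<in> R"
  by (induction I rule: infinite_finite_induct) (auto intro: R_0 R_add)

lemma R_induct [consumes 1, case_names zero relator uminus add]:
  assumes "r \<in> R" "P 0" "\<And>r. r \<in> tensor_relators G A C \<Longrightarrow> P r" "\<And>r. P r \<Longrightarrow> P (- r)" "\<And>r r'. P r \<Longrightarrow> P r' \<Longrightarrow> P (r + r')"
  shows "P r"
  using assms(1) unfolding tensor_relations_def
proof induction
  case (inv h)
  then show ?case using assms(3,4) relators_keys by simp
qed (use assms in simp_all)

lemma R_relator: "r \<in> tensor_relators G A C \<Longrightarrow> r \<in> R"
  unfolding tensor_relations_def by (rule generate.incl)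

lemma R_add_left:
  "a \<in> carrier A \<Longrightarrow> b \<in> carrier A \<Longrightarrow> c \<in> carrier C \<Longrightarrow> frag_of (a \<otimes>\<^bsub>A\<^esub> b, c) - frag_of (a, c) - frag_of (b, c) \<in> R"
  by (rule R_relator) (auto simp: tensor_relators_def)

lemma R_add_right:
  "a \<in> carrier A \<Longrightarrow> c \<in> carrier C \<Longrightarrow> d \<in> carrier C \<Longrightarrow> frag_of (a, c \<otimes>\<^bsub>C\<^esub> d) - frag_of (a, c) - frag_of (a, d) \<in> R"
  by (rule R_relator) (auto simp: tensor_relators_def)

lemma R_act:
  "a \<in> carrier A \<Longrightarrow> g \<in> carrier G \<Longrightarrow> c \<in> carrier C \<Longrightarrow> frag_of (ract A a g, c) - frag_of (a, lact C g c) \<in> R"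
  by (rule R_relator) (auto simp: tensor_relators_def)

lemma tc_def': "tc u = (\<lambda>r. r + u) ` R"
  by (auto simp: tensor_class_def r_coset_def)

lemma mem_tc: "v \<in> tc u \<longleftrightarrow> v - u \<in> R"
  by (force simp: tc_def' image_iff)

lemma tc_eq: "tc u = tc v \<longleftrightarrow> u - v \<in> R"
proof
  assume "tc u = tc v"
  then show "u - v \<in> R" using mem_tc[of u u] mem_tc[of u v] R_0 by simp
next
  assume uv: "u - v \<in> R"
  have "w - u \<in> R \<longleftrightarrow> w - v \<in> R" for w
  proof
    assume "w - u \<in> R"
    from R_add[OF this uv] show "w - v \<in> R" by simp
  next
    assume "w - v \<in> R"
    from R_diff[OF this uv] show "w - u \<in> R" by simp
  qed
  then show "tc u = tc v" using mem_tc by blast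
qed

lemma carrier_tensor: "carrier (tensor G A C) = tc ` {u. Poly_Mapping.keys u \<subseteq> carrier A \<times> carrier C}"
  by (auto simp: tensor_def FactGroup_def RCOSETS_def tensor_class_def)

lemma one_tensor: "\<one>\<^bsub>tensor G A C\<^esub> = tc 0"
  by (auto simp: tensor_def FactGroup_def tc_def')

lemma mult_tensor: "tc u \<otimes>\<^bsub>tensor G A C\<^esub> tc v = tc (u + v)"
proof -
  have "tc u \<otimes>\<^bsub>tensor G A C\<^esub> tc v = (\<Union>h\<in>tc u. \<Union>k\<in>tc v. {h + k})"
    by (simp add: tensor_def FactGroup_def set_mult_def)
  also have "\<dots> = tc (u + v)"
  proof (intro equalityI subsetI)
    fix w assume "w \<in> (\<Union>h\<in>tc u. \<Union>k\<in>tc v. {h + k})"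
    then obtain h k where w: "w = h + k" "h - u \<in> R" "k - v \<in> R" by (auto simp: mem_tc)
    from R_add[OF w(2,3)] show "w \<in> tc (u + v)" by (simp add: mem_tc w(1) algebra_simps)
  next
    fix w assume "w \<in> tc (u + v)"
    then have "w - v \<in> tc u" "v \<in> tc v" using R_0 by (simp_all add: mem_tc algebra_simps)
    then show "w \<in> (\<Union>h\<in>tc u. \<Union>k\<in>tc v. {h + k})" by (intro UN_I[of "w - v"] UN_I[of v]) auto
  qed
  finally show ?thesis .
qed

end

text \<open>Equivariant homomorphisms send relators to relators, hence relations to relations. All
  sets in the union defining \<open>tensor_map\<close> are therefore the same coset.\<close>

lemma tensor_map_class:
  assumes T: "tensor_setting G A C" and T': "tensor_setting G A' C'"
    and \<phi>: "\<And>a. a \<in> carrier A \<Longrightarrow> \<phi> a \<in> carrier A'"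
      "\<And>a b. a \<in> carrier A \<Longrightarrow> b \<in> carrier A \<Longrightarrow> \<phi> (a \<otimes>\<^bsub>A\<^esub> b) = \<phi> a \<otimes>\<^bsub>A'\<^esub> \<phi> b"
      "\<And>a g. a \<in> carrier A \<Longrightarrow> g \<in> carrier G \<Longrightarrow> \<phi> (ract A a g) = ract A' (\<phi> a) g"
    and \<psi>: "\<And>c. c \<in> carrier C \<Longrightarrow> \<psi> c \<in> carrier C'"
      "\<And>c d. c \<in> carrier C \<Longrightarrow> d \<in> carrier C \<Longrightarrow> \<psi> (c \<otimes>\<^bsub>C\<^esub> d) = \<psi> c \<otimes>\<^bsub>C'\<^esub> \<psi> d"
      "\<And>c g. c \<in> carrier C \<Longrightarrow> g \<in> carrier G \<Longrightarrow> \<psi> (lact C g c) = lact C' g (\<psi> c)"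
  shows "tensor_map G A' C' \<phi> \<psi> (tensor_class G A C u) =
    tensor_class G A' C' (frag_extend (\<lambda>(a, c). frag_of (\<phi> a, \<psi> c)) u)"
proof -
  interpret T: tensor_setting G A C by (rule T)
  interpret T': tensor_setting G A' C' by (rule T')
  let ?H = "frag_extend (\<lambda>(a, c). frag_of (\<phi> a, \<psi> c))"
  have H: "?H r \<in> T'.R" if "r \<in> T.R" for r
    using that
  proof (induction rule: T.R_induct)
    case zero
    then show ?case by (simp add: T'.R_0)
  next
    case (relator r)
    then show ?case unfolding tensor_relators_def
      by (elim UnE CollectE exE conjE)
        (simp_all add: frag_extend_diff \<phi> \<psi> T'.R_add_left T'.R_add_right T'.R_act)
  next
    case (uminus r)
    then show ?case by (simp add: frag_extend_minus T'.R_uminus)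
  next
    case (add r r')
    then show ?case by (simp add: frag_extend_add T'.R_add)
  qed
  have "T'.tc (?H v) = T'.tc (?H u)" if "v \<in> T.tc u" for v
    using H[of "v - u"] that by (simp add: T.mem_tc T'.tc_eq frag_extend_diff)
  moreover have "u \<in> T.tc u" by (simp add: T.mem_tc T.R_0)
  ultimately show ?thesis unfolding tensor_map_def by blast
qed

section \<open>Evaluation of parametrised chains at points\<close>

context deck_group
begin

text \<open>For every simplex of \<open>M\<close> we choose a lift to \<open>E\<close>, and every simplex of \<open>E\<close> is the translate
  of the chosen lift of its image under a unique element of \<open>G\<close>.\<close>

definition lift :: "nat \<Rightarrow> ((nat \<Rightarrow> real) \<Rightarrow> 'a) \<Rightarrow> ((nat \<Rightarrow> real) \<Rightarrow> 'b)" where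
  "lift q s = (SOME \<sigma>. Esimplex q \<sigma> \<and> simplex_map q p \<sigma> = s)"

definition deck_of :: "nat \<Rightarrow> ((nat \<Rightarrow> real) \<Rightarrow> 'b) \<Rightarrow> (real \<Rightarrow> 'a) set" where
  "deck_of q \<sigma> = (SOME \<gamma>. \<gamma> \<in> carrier G \<and> simplex_map q (\<delta> \<gamma>) (lift q (simplex_map q p \<sigma>)) = \<sigma>)"

lemma lift:
  assumes "Esimplex q \<sigma>" "simplex_map q p \<sigma> = s"
  shows "Esimplex q (lift q s)" "simplex_map q p (lift q s) = s"
  using someI[of "\<lambda>\<sigma>. Esimplex q \<sigma> \<and> simplex_map q p \<sigma> = s" \<sigma>] assms by (simp_all add: lift_def)

lemma deck_of:
  assumes "Esimplex q \<sigma>"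
  shows "deck_of q \<sigma> \<in> carrier G" "simplex_map q (\<delta> (deck_of q \<sigma>)) (lift q (simplex_map q p \<sigma>)) = \<sigma>"
proof -
  have "\<exists>\<gamma>. \<gamma> \<in> carrier G \<and> simplex_map q (\<delta> \<gamma>) (lift q (simplex_map q p \<sigma>)) = \<sigma>"
    using simplex_deck_transitive[OF lift(1)[OF assms refl] assms lift(2)[OF assms refl]] by blast
  from someI_ex[OF this] show "deck_of q \<sigma> \<in> carrier G" "simplex_map q (\<delta> (deck_of q \<sigma>)) (lift q (simplex_map q p \<sigma>)) = \<sigma>"
    by (simp_all add: deck_of_def)
qed

text \<open>Both sides translate the chosen lift to the same simplex, and the action on simplices is
  free. The order of the factors fits the right action on coefficient functions in
  \<open>ev_act\<close>.\<close>

lemma deck_of_act: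
  assumes \<sigma>: "Esimplex q \<sigma>" and g: "g \<in> carrier G"
  shows "deck_of q (simplex_map q (\<delta> g) \<sigma>) = g \<otimes>\<^bsub>G\<^esub> deck_of q \<sigma>"
proof -
  let ?s = "simplex_map q p \<sigma>" and ?g\<sigma> = "simplex_map q (\<delta> g) \<sigma>"
  have s: "Esimplex q ?g\<sigma>" "simplex_map q p ?g\<sigma> = ?s" using simplex_deck[OF g \<sigma>] by auto
  have l: "Esimplex q (lift q ?s)" by (rule lift(1)[OF \<sigma> refl])
  have m: "g \<otimes>\<^bsub>G\<^esub> deck_of q \<sigma> \<in> carrier G"
    using grp g deck_of(1)[OF \<sigma>] by (simp add: group.is_monoid monoid.m_closed)
  have "simplex_map q (\<delta> (deck_of q ?g\<sigma>)) (lift q ?s) = ?g\<sigma>" using deck_of(2)[OF s(1)] s(2) by simp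
  also have "\<dots> = simplex_map q (\<delta> g) (simplex_map q (\<delta> (deck_of q \<sigma>)) (lift q ?s))" by (simp add: deck_of(2)[OF \<sigma>])
  also have "\<dots> = simplex_map q (\<delta> (g \<otimes>\<^bsub>G\<^esub> deck_of q \<sigma>)) (lift q ?s)"
    using simplex_deck_mult[OF g deck_of(1)[OF \<sigma>] l] by simp
  finally show ?thesis using simplex_deck_free[OF deck_of(1)[OF s(1)] m l] by blast
qed

text \<open>\<open>cell\<close> takes lists, so the simplices are enumerated in an arbitrary order;
  distinctness keeps a coefficient from being counted twice.\<close>

definition chain_cells :: "nat \<Rightarrow> 'b chain \<Rightarrow> (int \<times> (real \<Rightarrow> 'a) set \<times> ((nat \<Rightarrow> real) \<Rightarrow> 'a)) list" where
  "chain_cells q c = map (\<lambda>\<sigma>. (poly_mapping.lookup c \<sigma>, deck_of q \<sigma>, simplex_map q p \<sigma>))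
     (SOME l. set l = Poly_Mapping.keys c \<and> distinct l)"

lemma chain_cells:
  assumes "singular_chain q (top_of_set E) c"
  shows "chain_cells q c \<in> lists (UNIV \<times> carrier G \<times> UNIV)"
proof -
  have "\<exists>l. set l = Poly_Mapping.keys c \<and> distinct l" by (simp add: finite_distinct_list)
  from someI_ex[OF this] have l: "set (SOME l. set l = Poly_Mapping.keys c \<and> distinct l) = Poly_Mapping.keys c" ..
  have "deck_of q \<sigma> \<in> carrier G" if "\<sigma> \<in> Poly_Mapping.keys c" for \<sigma>
    using assms that by (intro deck_of(1)) (auto simp: singular_chain_def)
  with l show ?thesis by (auto simp: chain_cells_def in_lists_conv_set)
qed

lemma cell_chain_cells:
  "cell \<alpha> f (chain_cells q c) x =
    frag_extend (\<lambda>\<sigma>. frag_cmul (f (\<alpha> (deck_of q \<sigma>) x)) (frag_of (simplex_map q p \<sigma>))) c"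
proof -
  define l where "l = (SOME l. set l = Poly_Mapping.keys c \<and> distinct l)"
  have "\<exists>l. set l = Poly_Mapping.keys c \<and> distinct l" by (simp add: finite_distinct_list)
  from someI_ex[OF this] have l: "Poly_Mapping.keys c = set l" "distinct l" by (auto simp: l_def)
  have "chain_cells q c = map (\<lambda>\<sigma>. (poly_mapping.lookup c \<sigma>, deck_of q \<sigma>, simplex_map q p \<sigma>)) l"
    by (simp only: chain_cells_def l_def)
  then show ?thesis
    unfolding cell_def frag_extend_def l(1)
    by (simp add: comp_def sum_list_distinct_conv_sum_set[OF l(2)])
qed

end

lemma frag_cmul_diff: "frag_cmul k (a - b) = frag_cmul k a - frag_cmul k b"
  by (rule poly_mapping_eqI) (simp add: lookup_minus right_diff_distrib)

locale parametrised_chains =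
  deck_group M E p e0 \<delta> G + invariant_measure G X \<alpha> \<nu>
  for M :: "'a::topological_space set" and E :: "'b::topological_space set" and p e0 \<delta>
    and G :: "(real \<Rightarrow> 'a) set monoid" and X :: "'x measure" and \<alpha> \<nu> +
  assumes act_mult: "\<And>\<gamma> \<gamma>' x. \<gamma> \<in> carrier G \<Longrightarrow> \<gamma>' \<in> carrier G \<Longrightarrow> x \<in> space X \<Longrightarrow>
    \<alpha> (\<gamma> \<otimes>\<^bsub>G\<^esub> \<gamma>') x = \<alpha> \<gamma> (\<alpha> \<gamma>' x)"
begin

section \<open>The coefficient module and evaluation of chains\<close>

abbreviation "cls \<equiv> Linf_class \<nu>"
abbreviation "LM \<equiv> Linf \<alpha> \<nu>"
abbreviation "CM q \<equiv> chain_module q E \<delta>"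
abbreviation "tensor_chain q u \<equiv> Poly_Mapping.keys u \<subseteq> carrier LM \<times> carrier (CM q)"
abbreviation "Echain q \<equiv> singular_chain q (top_of_set E)"

lemma cls_eq: "f \<in> L \<Longrightarrow> h \<in> L \<Longrightarrow> AE x in \<nu>. f x = h x \<Longrightarrow> cls f = cls h"
  unfolding Linf_class_def by (intro Collect_cong conj_cong refl) (auto elim: AE_mp)

lemma cls_self: "f \<in> L \<Longrightarrow> f \<in> cls f"
  by (simp add: Linf_class_def)

lemma cls_mem: "h \<in> cls f \<longleftrightarrow> h \<in> L \<and> (AE x in \<nu>. h x = f x)"
  by (simp add: Linf_class_def)

lemma Linf_mult:
  assumes f: "f \<in> L" and h: "h \<in> L"
  shows "cls f \<otimes>\<^bsub>LM\<^esub> cls h = cls (\<lambda>x. f x + h x)"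
proof -
  have "cls (\<lambda>x. f' x + h' x) = cls (\<lambda>x. f x + h x)" if "f' \<in> cls f" "h' \<in> cls h" for f' h'
  proof (rule cls_eq)
    have "AE x in \<nu>. f' x = f x" "AE x in \<nu>. h' x = h x" using that by (auto simp: cls_mem)
    then show "AE x in \<nu>. f' x + h' x = f x + h x" by eventually_elim simp
  qed (use that f h in \<open>auto simp: cls_mem intro!: L_add\<close>)
  then have "(\<Union>f'\<in>cls f. \<Union>h'\<in>cls h. cls (\<lambda>x. f' x + h' x)) = (\<Union>f'\<in>cls f. \<Union>h'\<in>cls h. cls (\<lambda>x. f x + h x))"
    by (intro SUP_cong refl)
  also have "\<dots> = cls (\<lambda>x. f x + h x)" using cls_self[OF f] cls_self[OF h] by blast
  finally show ?thesis by (simp add: Linf_def)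
qed

lemma Linf_act:
  assumes f: "f \<in> L" and g: "g \<in> carrier G"
  shows "ract LM (cls f) g = cls (\<lambda>x. f (\<alpha> g x))"
proof -
  have "cls (\<lambda>x. f' (\<alpha> g x)) = cls (\<lambda>x. f (\<alpha> g x))" if "f' \<in> cls f" for f'
  proof (rule cls_eq)
    have "AE x in \<nu>. f' x = f x" using that by (auto simp: cls_mem)
    then show "AE x in \<nu>. f' (\<alpha> g x) = f (\<alpha> g x)" by (rule AE_act[OF g])
  qed (use that f g in \<open>auto simp: cls_mem intro!: L_act\<close>)
  then have "(\<Union>f'\<in>cls f. cls (\<lambda>x. f' (\<alpha> g x))) = (\<Union>f'\<in>cls f. cls (\<lambda>x. f (\<alpha> g x)))"
    by (intro SUP_cong refl)
  also have "\<dots> = cls (\<lambda>x. f (\<alpha> g x))" using cls_self[OF f] by blast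
  finally show ?thesis by (simp add: Linf_def)
qed

lemma Linf_carrier: "carrier LM = cls ` L"
  by (simp add: Linf_def)

text \<open>Evaluation at a point needs functions in place of classes. The choice matters only on
  null sets, but it also respects addition and translation only up to null sets.\<close>

definition rp :: "('x \<Rightarrow> int) set \<Rightarrow> 'x \<Rightarrow> int" where
  "rp F = (SOME f. f \<in> F)"

lemma rp:
  assumes "F \<in> carrier LM"
  shows "rp F \<in> L" "cls (rp F) = F"
proof -
  obtain f where f: "f \<in> L" "F = cls f" using assms by (auto simp: Linf_carrier)
  have "rp F \<in> F" unfolding rp_def using cls_self[OF f(1)] f(2) by (metis someI)
  then show "rp F \<in> L" "cls (rp F) = F" using f cls_eq[of "rp F" f] by (auto simp: cls_mem)
qed

lemma rp_cls: "f \<in> L \<Longrightarrow> AE x in \<nu>. rp (cls f) x = f x"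
  unfolding rp_def using someI[of "\<lambda>h. h \<in> cls f", OF cls_self] by (simp add: cls_mem)

lemma chain_module_simps [simp]:
  "carrier (CM q) = {c. Echain q c}" "c \<otimes>\<^bsub>CM q\<^esub> d = c + d" "lact (CM q) g = chain_map q (\<delta> g)"
  by (simp_all add: chain_module_def)

lemma deck_continuous_map: "g \<in> carrier G \<Longrightarrow> continuous_map (top_of_set E) (top_of_set E) (\<delta> g)"
  using deck_maps[of g] by (simp add: image_subset_iff_funcset)

lemma tensor_LM: "tensor_setting G LM (CM q)"
proof
  show "\<And>a b. a \<in> carrier LM \<Longrightarrow> b \<in> carrier LM \<Longrightarrow> a \<otimes>\<^bsub>LM\<^esub> b \<in> carrier LM"
    by (auto simp: Linf_carrier Linf_mult intro!: imageI L_add)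
  show "\<And>a g. a \<in> carrier LM \<Longrightarrow> g \<in> carrier G \<Longrightarrow> ract LM a g \<in> carrier LM"
    by (auto simp: Linf_carrier Linf_act intro!: imageI L_act)
qed (auto intro: singular_chain_add singular_chain_chain_map deck_continuous_map)

sublocale T: tensor_setting G LM "CM q" for q
  by (rule tensor_LM)

lemma tensor_Z: "tensor_setting G trivial_integers (CM q)"
  by unfold_locales
    (auto simp: trivial_integers_def intro: singular_chain_add singular_chain_chain_map deck_continuous_map)

text \<open>With g = \<open>deck_of q \<sigma>\<close> and the chosen lift \<tau> one has f
  \<otimes> \<sigma> = f \<otimes> g\<tau> = (f\<cdot>g) \<otimes> \<tau>. The value of f\<cdot>g at
  x is \<open>f (\<alpha> g x)\<close>, and this becomes the coefficient of the projected
  simplex.\<close>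

definition ev :: "nat \<Rightarrow> ('x \<Rightarrow> int) \<Rightarrow> 'x \<Rightarrow> 'b chain \<Rightarrow> 'a chain" where
  "ev q f x c = frag_extend (\<lambda>\<sigma>. frag_cmul (f (\<alpha> (deck_of q \<sigma>) x)) (frag_of (simplex_map q p \<sigma>))) c"

lemma ev_0 [simp]: "ev q f x 0 = 0"
  and ev_diff_right: "ev q f x (c - d) = ev q f x c - ev q f x d"
  and ev_add_right: "ev q f x (c + d) = ev q f x c + ev q f x d"
  and ev_of: "ev q f x (frag_of \<sigma>) = frag_cmul (f (\<alpha> (deck_of q \<sigma>) x)) (frag_of (simplex_map q p \<sigma>))"
  by (simp_all add: ev_def frag_extend_diff frag_extend_add)

lemma ev_const: "ev q (\<lambda>_. k) x c = frag_cmul k (chain_map q p c)"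
  using subset_UNIV
  by (induction c rule: frag_induction) (simp_all add: ev_of ev_diff_right chain_map_diff frag_cmul_diff)

lemma ev_add_left: "ev q (\<lambda>x. f x + h x) x c = ev q f x c + ev q h x c"
  using subset_UNIV
  by (induction c rule: frag_induction) (simp_all add: ev_of ev_diff_right frag_cmul_distrib)

text \<open>A chain has finitely many simplices, and by invariance each of their deck elements pulls
  the exceptional null set back to a null set.\<close>

lemma ev_AE:
  assumes c: "Echain q c" and fh: "AE x in \<nu>. f x = h x"
  shows "AE x in \<nu>. ev q f x c = ev q h x c"
proof -
  have "AE x in \<nu>. \<forall>\<sigma>\<in>Poly_Mapping.keys c. f (\<alpha> (deck_of q \<sigma>) x) = h (\<alpha> (deck_of q \<sigma>) x)"
  proof (rule AE_finite_allI)
    fix \<sigma> assume "\<sigma> \<in> Poly_Mapping.keys c"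
    then have "Esimplex q \<sigma>" using c by (auto simp: singular_chain_def)
    then show "AE x in \<nu>. f (\<alpha> (deck_of q \<sigma>) x) = h (\<alpha> (deck_of q \<sigma>) x)"
      using deck_of(1) by (intro AE_act fh)
  qed simp
  then show ?thesis by eventually_elim (auto simp: ev_def intro!: frag_extend_eq)
qed

text \<open>The balancing relation at a point. On a simplex with deck element \<gamma> both
  coefficients are \<open>f (\<alpha> g (\<alpha> \<gamma> x))\<close>, because its translate by g
  has deck element g\<gamma>.\<close>

lemma ev_act:
  assumes c: "Echain q c" and g: "g \<in> carrier G" and x: "x \<in> space X"
  shows "ev q (\<lambda>y. f (\<alpha> g y)) x c = ev q f x (chain_map q (\<delta> g) c)"
  using c[unfolded singular_chain_def]
proof (induction c rule: frag_induction)
  case (one \<sigma>)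
  then show ?case
    using deck_of_act[of q \<sigma> g] simplex_deck(2)[OF g, of q \<sigma>] act_mult[OF g deck_of(1) x, of q \<sigma>] g
    by (simp add: ev_of)
qed (simp_all add: ev_diff_right chain_map_diff)

definition EV :: "nat \<Rightarrow> ((('x \<Rightarrow> int) set \<times> 'b chain) \<Rightarrow>\<^sub>0 int) \<Rightarrow> 'x \<Rightarrow> 'a chain" where
  "EV q u x = frag_extend (\<lambda>(F, c). ev q (rp F) x c) u"

lemma EV_0 [simp]: "EV q 0 x = 0"
  and EV_diff: "EV q (u - v) x = EV q u x - EV q v x"
  and EV_add: "EV q (u + v) x = EV q u x + EV q v x"
  and EV_uminus: "EV q (- u) x = - EV q u x"
  and EV_of: "EV q (frag_of (F, c)) x = ev q (rp F) x c"
  by (simp_all add: EV_def frag_extend_diff frag_extend_add frag_extend_minus)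

lemma EV_sum: "finite I \<Longrightarrow> EV q (\<Sum>i\<in>I. u i) x = (\<Sum>i\<in>I. EV q (u i) x)"
  by (induction I rule: finite_induct) (simp_all add: EV_add)

lemma EV_cls: "f \<in> L \<Longrightarrow> Echain q c \<Longrightarrow> AE x in \<nu>. EV q (frag_of (cls f, c)) x = ev q f x c"
  unfolding EV_of by (rule ev_AE[OF _ rp_cls])

text \<open>Representatives are chosen class by class, so a relator evaluates to 0 only outside a
  null set. A relation arises from finitely many relators, so the union of these sets is still
  null.\<close>

lemma EV_relations:
  assumes "r \<in> T.R q"
  shows "AE x in \<nu>. EV q r x = 0"
proof -
  show ?thesis using assms
  proof (induction rule: T.R_induct)
    case (relator r)
    then consider (left) F F' c where "r = frag_of (F \<otimes>\<^bsub>LM\<^esub> F', c) - frag_of (F, c) - frag_of (F', c)"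
          "F \<in> carrier LM" "F' \<in> carrier LM" "Echain q c"
      | (right) F c d where "r = frag_of (F, c + d) - frag_of (F, c) - frag_of (F, d)"
      | (act) F g c where "r = frag_of (ract LM F g, c) - frag_of (F, chain_map q (\<delta> g) c)"
          "F \<in> carrier LM" "g \<in> carrier G" "Echain q c"
      unfolding tensor_relators_def chain_module_simps mem_Collect_eq
      by (elim UnE CollectE exE conjE) blast+
    then show ?case
    proof cases
      case left
      have "F \<otimes>\<^bsub>LM\<^esub> F' = cls (\<lambda>x. rp F x + rp F' x)"
        using Linf_mult[OF rp(1)[OF left(2)] rp(1)[OF left(3)]] by (simp only: rp(2) left(2,3))
      then have "AE x in \<nu>. rp (F \<otimes>\<^bsub>LM\<^esub> F') x = rp F x + rp F' x"
        using rp_cls[OF L_add[OF rp(1)[OF left(2)] rp(1)[OF left(3)]]] by (simp only:)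
      from ev_AE[OF left(4) this] show ?thesis
        unfolding left(1) EV_diff EV_of by eventually_elim (simp add: ev_add_left)
    next
      case right
      then show ?thesis by (simp add: EV_diff EV_of ev_add_right)
    next
      case act
      have "ract LM F g = cls (\<lambda>x. rp F (\<alpha> g x))"
        using Linf_act[OF rp(1)[OF act(2)] act(3)] by (simp only: rp(2)[OF act(2)])
      then have "AE x in \<nu>. rp (ract LM F g) x = rp F (\<alpha> g x)"
        using rp_cls[OF L_act[OF rp(1)[OF act(2)] act(3)]] by (simp only:)
      from ev_AE[OF act(4) this] AE_space show ?thesis
        unfolding act(1) EV_diff EV_of
        by eventually_elim (simp add: ev_act[OF act(4,3)] space_eq)
    qed
  next
    case (add r r')
    then show ?case by eventually_elim (simp add: EV_add)
  qed (simp_all add: EV_uminus)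
qed

lemma EV_cong:
  assumes "T.tc q u = T.tc q v"
  shows "AE x in \<nu>. EV q u x = EV q v x"
proof -
  have "AE x in \<nu>. EV q (u - v) x = 0" using assms by (intro EV_relations) (simp add: T.tc_eq)
  then show ?thesis by eventually_elim (simp add: EV_diff)
qed

end

section \<open>Reduced forms and norms\<close>

context parametrised_chains
begin

text \<open>The inverse construction to \<open>EV\<close>: a chain is rebuilt from its pointwise
  values, with each simplex of M represented by its chosen lift. S is meant to be a finite set
  containing all supports.\<close>

definition NF :: "nat \<Rightarrow> ((nat \<Rightarrow> real) \<Rightarrow> 'a) set \<Rightarrow> ('x \<Rightarrow> 'a chain) \<Rightarrow> ((('x \<Rightarrow> int) set \<times> 'b chain) \<Rightarrow>\<^sub>0 int)" where
  "NF q S a = (\<Sum>s\<in>S. frag_of (cls (\<lambda>x. poly_mapping.lookup (a x) s), frag_of (lift q s)))"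

definition Msimplices :: "nat \<Rightarrow> ((nat \<Rightarrow> real) \<Rightarrow> 'a) set" where
  "Msimplices q = simplex_map q p ` {\<sigma>. Esimplex q \<sigma>}"

definition coeffs_L :: "('x \<Rightarrow> 'a chain) \<Rightarrow> bool" where
  "coeffs_L a \<longleftrightarrow> (\<forall>s. (\<lambda>x. poly_mapping.lookup (a x) s) \<in> L)"

lemma lift_M: "s \<in> Msimplices q \<Longrightarrow> Esimplex q (lift q s)" "s \<in> Msimplices q \<Longrightarrow> simplex_map q p (lift q s) = s"
  using lift by (auto simp: Msimplices_def)

text \<open>Since 0 + 0 = 0, the additivity relator for two zero functions is the negative of the
  pair itself.\<close>

lemma R_cls_0:
  assumes "Echain q c" "f \<in> L" "AE x in \<nu>. f x = 0"
  shows "frag_of (cls f, c) \<in> T.R q"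
proof -
  have 0: "cls f = cls (\<lambda>_. 0)" using assms by (intro cls_eq L_const)
  have "cls (\<lambda>_. 0) \<otimes>\<^bsub>LM\<^esub> cls (\<lambda>_. 0) = cls (\<lambda>_. 0)" using Linf_mult[OF L_const L_const, of 0 0] by simp
  then have "frag_of (cls (\<lambda>_. 0), c) - frag_of (cls (\<lambda>_. 0), c) - frag_of (cls (\<lambda>_. 0), c) \<in> T.R q"
    using T.R_add_left[of "cls (\<lambda>_. 0)" "cls (\<lambda>_. 0)" c] assms L_const[of 0] by (simp add: Linf_carrier)
  then show ?thesis using T.R_uminus by (fastforce simp: 0)
qed

lemma R_add_cls:
  assumes "Echain q c" "f \<in> L" "h \<in> L"
  shows "frag_of (cls (\<lambda>x. f x + h x), c) - frag_of (cls f, c) - frag_of (cls h, c) \<in> T.R q"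
proof -
  show ?thesis
    using T.R_add_left[of "cls f" "cls h" c] Linf_mult[OF assms(2,3)] assms by (simp add: Linf_carrier)
qed

lemma NF_diff:
  assumes S: "S \<subseteq> Msimplices q" and a: "coeffs_L a" "coeffs_L b"
  shows "NF q S (\<lambda>x. a x - b x) - (NF q S a - NF q S b) \<in> T.R q"
proof -
  let ?f = "\<lambda>s x. poly_mapping.lookup (a x) s" and ?h = "\<lambda>s x. poly_mapping.lookup (b x) s"
  let ?d = "\<lambda>s. frag_of (cls (\<lambda>x. ?f s x - ?h s x), frag_of (lift q s))"
  have "?d s - (frag_of (cls (?f s), frag_of (lift q s)) - frag_of (cls (?h s), frag_of (lift q s))) \<in> T.R q" if "s \<in> S" for s
  proof -
    have fL: "?f s \<in> L" "?h s \<in> L" using a by (auto simp: coeffs_L_def)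
    have c: "Echain q (frag_of (lift q s))" using lift_M(1) S that by (auto simp: singular_chain_of)
    from R_add_cls[OF c L_diff[OF fL] fL(2)]
    have "frag_of (cls (?f s), frag_of (lift q s)) - ?d s - frag_of (cls (?h s), frag_of (lift q s)) \<in> T.R q" by simp
    from T.R_uminus[OF this] show ?thesis by (simp add: algebra_simps)
  qed
  from T.R_sum[of S, OF this] show ?thesis unfolding NF_def by (simp add: sum_subtractf lookup_minus)
qed

definition normalisable :: "nat \<Rightarrow> ((('x \<Rightarrow> int) set \<times> 'b chain) \<Rightarrow>\<^sub>0 int) \<Rightarrow> bool" where
  "normalisable q u \<longleftrightarrow> coeffs_L (EV q u) \<and> (\<exists>S0. finite S0 \<and> S0 \<subseteq> Msimplices q \<and>
     (\<forall>x. Poly_Mapping.keys (EV q u x) \<subseteq> S0) \<and>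
     (\<forall>S. finite S \<longrightarrow> S0 \<subseteq> S \<longrightarrow> S \<subseteq> Msimplices q \<longrightarrow> u - NF q S (EV q u) \<in> T.R q))"

lemma normalisable_diff:
  assumes u: "normalisable q u" and v: "normalisable q v"
  shows "normalisable q (u - v)"
proof -
  obtain S where S: "finite S" "S \<subseteq> Msimplices q" "\<And>x. Poly_Mapping.keys (EV q u x) \<subseteq> S"
    "\<And>S'. finite S' \<Longrightarrow> S \<subseteq> S' \<Longrightarrow> S' \<subseteq> Msimplices q \<Longrightarrow> u - NF q S' (EV q u) \<in> T.R q"
    using u unfolding normalisable_def by blast
  obtain S' where S': "finite S'" "S' \<subseteq> Msimplices q" "\<And>x. Poly_Mapping.keys (EV q v x) \<subseteq> S'"
    "\<And>S''. finite S'' \<Longrightarrow> S' \<subseteq> S'' \<Longrightarrow> S'' \<subseteq> Msimplices q \<Longrightarrow> v - NF q S'' (EV q v) \<in> T.R q"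
    using v unfolding normalisable_def by blast
  have c: "coeffs_L (EV q u)" "coeffs_L (EV q v)" using u v by (auto simp: normalisable_def)
  have EVd: "EV q (u - v) = (\<lambda>x. EV q u x - EV q v x)" by (simp add: fun_eq_iff EV_diff)
  show ?thesis unfolding normalisable_def
  proof (intro conjI exI[of _ "S \<union> S'"] allI impI)
    show "coeffs_L (EV q (u - v))" using c unfolding coeffs_L_def EVd lookup_minus by (intro allI L_diff) auto
    show "finite (S \<union> S')" "S \<union> S' \<subseteq> Msimplices q" using S S' by auto
    show "Poly_Mapping.keys (EV q (u - v) x) \<subseteq> S \<union> S'" for x
      using keys_diff[of "EV q u x" "EV q v x"] S(3)[of x] S'(3)[of x] unfolding EV_diff by blast
    fix S'' assume S'': "finite S''" "S \<union> S' \<subseteq> S''" "S'' \<subseteq> Msimplices q"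
    have 1: "u - NF q S'' (EV q u) \<in> T.R q" "v - NF q S'' (EV q v) \<in> T.R q" using S(4) S'(4) S'' by auto
    have 2: "NF q S'' (EV q (u - v)) - (NF q S'' (EV q u) - NF q S'' (EV q v)) \<in> T.R q"
      unfolding EVd by (rule NF_diff[OF S''(3) c])
    have "(u - NF q S'' (EV q u)) - (v - NF q S'' (EV q v)) - (NF q S'' (EV q (u - v)) - (NF q S'' (EV q u) - NF q S'' (EV q v))) \<in> T.R q"
      by (intro T.R_diff 1 2)
    then show "u - v - NF q S'' (EV q (u - v)) \<in> T.R q" by (simp add: algebra_simps)
  qed
qed

lemma normalisable_cong:
  assumes v: "normalisable q v" and uv: "u - v \<in> T.R q" and ev: "\<And>x. EV q u x = EV q v x"
  shows "normalisable q u"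
proof -
  have e: "EV q u = EV q v" using ev by blast
  have *: "u - NF q S (EV q v) \<in> T.R q" if "v - NF q S (EV q v) \<in> T.R q" for S
    using T.R_add[OF that uv] by simp
  from v obtain S0 where "coeffs_L (EV q v)" "finite S0" "S0 \<subseteq> Msimplices q" "\<forall>x. Poly_Mapping.keys (EV q v x) \<subseteq> S0"
    "\<forall>S. finite S \<longrightarrow> S0 \<subseteq> S \<longrightarrow> S \<subseteq> Msimplices q \<longrightarrow> v - NF q S (EV q v) \<in> T.R q"
    unfolding normalisable_def by (elim conjE exE)
  then show ?thesis unfolding normalisable_def e by (intro conjI exI[of _ S0] allI impI *) simp_all
qed

lemma normalisable_0: "normalisable q 0"
proof -
  have "- NF q S (EV q 0) \<in> T.R q" if "S \<subseteq> Msimplices q" for S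
    unfolding NF_def using that lift_M(1)
    by (intro T.R_uminus T.R_sum R_cls_0) (auto simp: singular_chain_of intro: L_const)
  then show ?thesis unfolding normalisable_def
    by (intro conjI exI[of _ "{}"]) (simp_all add: coeffs_L_def L_const)
qed

text \<open>The balancing relator moves the deck element of \<open>\<sigma>\<close> to the
  coefficient; the other simplices of S receive the zero class.\<close>

lemma normalisable_simplex:
  assumes F: "F \<in> carrier LM" and \<sigma>: "Esimplex q \<sigma>"
  shows "normalisable q (frag_of (F, frag_of \<sigma>))"
proof -
  let ?s = "simplex_map q p \<sigma>" and ?g = "deck_of q \<sigma>" and ?u = "frag_of (F, frag_of \<sigma>)"
  let ?f = "\<lambda>x. rp F (\<alpha> ?g x)"
  have fL: "?f \<in> L" by (rule L_act[OF rp(1)[OF F] deck_of(1)[OF \<sigma>]])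
  have EVu: "EV q ?u x = frag_cmul (?f x) (frag_of ?s)" for x by (simp add: EV_of ev_of)
  have lookup: "(\<lambda>x. poly_mapping.lookup (EV q ?u x) t) = (if t = ?s then ?f else (\<lambda>_. 0))" for t
    by (auto simp: EVu)
  have l: "Echain q (frag_of (lift q ?s))" using lift(1)[OF \<sigma> refl] by (simp add: singular_chain_of)
  have act: "ract LM F ?g = cls ?f" using Linf_act[OF rp(1)[OF F] deck_of(1)[OF \<sigma>]] rp(2)[OF F] by simp
  have "frag_of (ract LM F ?g, frag_of (lift q ?s)) - frag_of (F, lact (CM q) ?g (frag_of (lift q ?s))) \<in> T.R q"
    using F deck_of(1)[OF \<sigma>] l by (intro T.R_act) auto
  then have "frag_of (cls ?f, frag_of (lift q ?s)) - ?u \<in> T.R q" by (simp add: act deck_of(2)[OF \<sigma>])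
  then have 1: "?u - frag_of (cls ?f, frag_of (lift q ?s)) \<in> T.R q" using T.R_uminus by fastforce
  show ?thesis unfolding normalisable_def
  proof (intro conjI exI[of _ "{?s}"] allI impI)
    show "coeffs_L (EV q ?u)" unfolding coeffs_L_def lookup using fL L_const by auto
    show "{?s} \<subseteq> Msimplices q" using \<sigma> by (auto simp: Msimplices_def)
    show "Poly_Mapping.keys (EV q ?u x) \<subseteq> {?s}" for x unfolding EVu using keys_cmul by fastforce
    fix S assume S: "finite S" "{?s} \<subseteq> S" "S \<subseteq> Msimplices q"
    have "NF q S (EV q ?u) = frag_of (cls ?f, frag_of (lift q ?s)) + (\<Sum>s\<in>S - {?s}. frag_of (cls (\<lambda>_. 0), frag_of (lift q s)))"
      unfolding NF_def lookup using S by (subst sum.remove[of S ?s]) auto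
    moreover have "(\<Sum>s\<in>S - {?s}. frag_of (cls (\<lambda>_. 0), frag_of (lift q s))) \<in> T.R q"
      using S lift_M(1) by (intro T.R_sum R_cls_0) (auto simp: singular_chain_of intro: L_const)
    ultimately show "?u - NF q S (EV q ?u) \<in> T.R q" using T.R_diff[OF 1] by (simp add: algebra_simps)
  qed simp
qed

lemma normalisable_pair:
  assumes F: "F \<in> carrier LM" and c: "Echain q c"
  shows "normalisable q (frag_of (F, c))"
proof -
  \<comment> \<open>Being a chain of E is carried along because the induction step for a difference
    says nothing about the supports of a and b.\<close>
  have "Echain q c \<and> normalisable q (frag_of (F, c))"
    using c[unfolded singular_chain_def]
  proof (induction c rule: frag_induction)
    case zero
    have "frag_of (F, 0) - 0 \<in> T.R q"
      using T.R_uminus[OF T.R_add_right[where q=q and a=F and c=0 and d=0]] F by simp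
    then show ?case by (auto intro: normalisable_cong[OF normalisable_0] simp: EV_of)
  next
    case (one \<sigma>)
    then show ?case using normalisable_simplex[OF F] by (simp add: singular_chain_of)
  next
    case (diff a b)
    have "frag_of (F, (a - b) + b) - frag_of (F, a - b) - frag_of (F, b) \<in> T.R q"
      using T.R_add_right[where q=q and a=F and c="a - b" and d=b] F diff by (simp add: singular_chain_diff)
    from T.R_uminus[OF this] have "frag_of (F, a - b) - (frag_of (F, a) - frag_of (F, b)) \<in> T.R q"
      by (simp add: algebra_simps)
    then show ?case using diff
      by (auto intro: normalisable_cong[OF normalisable_diff] singular_chain_diff simp: EV_of EV_diff ev_diff_right)
  qed
  then show ?thesis by simp
qed

lemma normalisable:
  assumes "tensor_chain q u"
  shows "normalisable q u"
  using assms
proof (induction u rule: frag_induction)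
  case (one a)
  then show ?case by (cases a) (auto intro: normalisable_pair)
qed (auto intro: normalisable_0 normalisable_diff)

lemma l1_norm_EV_measurable:
  assumes "tensor_chain q u"
  shows "(\<lambda>x. l1_norm (EV q u x)) \<in> borel_measurable \<nu>"
proof -
  obtain S where S: "finite S" "\<And>x. Poly_Mapping.keys (EV q u x) \<subseteq> S" and c: "coeffs_L (EV q u)"
    using normalisable[OF assms] unfolding normalisable_def by blast
  have "(\<lambda>x. real_of_int (poly_mapping.lookup (EV q u x) s)) \<in> borel_measurable \<nu>" for s
    using c by (intro L_measurable_real) (simp add: coeffs_L_def)
  then show ?thesis unfolding l1_norm_superset[OF S] by (intro borel_measurable_sum borel_measurable_abs)
qed

text \<open>Modulo relations a chain equals its normal form, whose coefficient classes vanish here.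
  This converse of \<open>EV_relations\<close> allows the cycle condition to be checked
  pointwise.\<close>

lemma relation_if_EV_0:
  assumes u: "tensor_chain q u" and 0: "AE x in \<nu>. EV q u x = 0"
  shows "u \<in> T.R q"
proof -
  obtain S where S: "finite S" "S \<subseteq> Msimplices q" "u - NF q S (EV q u) \<in> T.R q" and c: "coeffs_L (EV q u)"
    using normalisable[OF u] unfolding normalisable_def by blast
  have "NF q S (EV q u) \<in> T.R q" unfolding NF_def
  proof (intro T.R_sum R_cls_0)
    fix s assume "s \<in> S"
    then show "Echain q (frag_of (lift q s))" using lift_M(1) S by (auto simp: singular_chain_of)
    show "(\<lambda>x. poly_mapping.lookup (EV q u x) s) \<in> L" using c by (simp add: coeffs_L_def)
    show "AE x in \<nu>. poly_mapping.lookup (EV q u x) s = 0" using 0 by eventually_elim simp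
  qed
  from T.R_add[OF S(3) this] show ?thesis by simp
qed

text \<open>The normal form is reduced, since the chosen lifts of distinct simplices of M have
  distinct projections.\<close>

lemma reduced_form_exists:
  assumes u: "tensor_chain q u"
  shows "\<exists>m f \<sigma>. reduced_form q G E p \<delta> \<alpha> \<nu> (T.tc q u) m f \<sigma>"
proof -
  obtain S where S: "finite S" "S \<subseteq> Msimplices q" "u - NF q S (EV q u) \<in> T.R q" and c: "coeffs_L (EV q u)"
    using normalisable[OF u] unfolding normalisable_def by blast
  obtain e where e: "bij_betw e {..<card S} S"
    using ex_bij_betw_nat_finite[OF S(1)] by (auto simp: atLeast0LessThan)
  have eS: "e j \<in> Msimplices q" if "j < card S" for j using e S(2) that by (auto simp: bij_betw_def)
  let ?f = "\<lambda>j x. poly_mapping.lookup (EV q u x) (e j)" and ?\<sigma> = "\<lambda>j. lift q (e j)"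
  have "reduced_form q G E p \<delta> \<alpha> \<nu> (T.tc q u) (card S) ?f ?\<sigma>"
    unfolding reduced_form_def
  proof (intro conjI allI impI)
    fix j assume j: "j < card S"
    show "?f j \<in> L" using c by (simp add: coeffs_L_def)
    show "Esimplex q (?\<sigma> j)" using lift_M(1)[OF eS[OF j]] .
    fix k assume k: "k < card S" "j \<noteq> k"
    then show "simplex_map q p (?\<sigma> j) \<noteq> simplex_map q p (?\<sigma> k)"
      using lift_M(2)[OF eS[OF j]] lift_M(2)[OF eS[OF k(1)]] e j by (auto simp: bij_betw_def inj_on_def)
  next
    have "NF q S (EV q u) = (\<Sum>j<card S. frag_of (cls (?f j), frag_of (?\<sigma> j)))"
      unfolding NF_def by (rule sum.reindex_bij_betw[OF e, symmetric])
    with S(3) show "T.tc q u = T.tc q (\<Sum>j<card S. frag_of (cls (?f j), frag_of (?\<sigma> j)))"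
      by (simp add: T.tc_eq)
  qed
  then show ?thesis by blast
qed

lemma keys_sum_pairs:
  assumes "\<And>i. i \<in> I \<Longrightarrow> f i \<in> L" "\<And>i. i \<in> I \<Longrightarrow> Echain q (c i)"
  shows "tensor_chain q (\<Sum>i\<in>I. frag_of (cls (f i), c i))"
  using keys_sum[of "\<lambda>i. frag_of (cls (f i), c i)" I] assms by (force simp: Linf_carrier)

text \<open>A reduced form may use any lifts. Passing to the chosen ones translates f j, which by
  invariance does not change the integral, and distinct projections exclude cancellation, so the
  norm at x is a plain sum. Hence all reduced forms give the same value, as the definite description
  in \<open>parametrised_norm\<close> demands.\<close>

lemma reduced_form_norm:
  assumes rf: "reduced_form q G E p \<delta> \<alpha> \<nu> (T.tc q u) m f \<sigma>"
    and u: "tensor_chain q u"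
  shows "(\<Sum>j<m. \<integral>x. real_of_int \<bar>f j x\<bar> \<partial>\<nu>) = (\<integral>x. l1_norm (EV q u x) \<partial>\<nu>)"
proof -
  let ?v = "\<Sum>j<m. frag_of (cls (f j), frag_of (\<sigma> j))"
  have f: "f j \<in> L" and \<sigma>: "Esimplex q (\<sigma> j)" if "j < m" for j using rf that by (auto simp: reduced_form_def)
  have inj: "j = k" if "j < m" "k < m" "simplex_map q p (\<sigma> j) = simplex_map q p (\<sigma> k)" for j k
    using rf that by (auto simp: reduced_form_def)
  have v: "tensor_chain q ?v"
    using f \<sigma> by (intro keys_sum_pairs) (auto simp: singular_chain_of)
  let ?h = "\<lambda>j x. f j (\<alpha> (deck_of q (\<sigma> j)) x)"
  have hL: "?h j \<in> L" if "j < m" for j by (rule L_act[OF f[OF that] deck_of(1)[OF \<sigma>[OF that]]])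
  have uv: "AE x in \<nu>. EV q u x = EV q ?v x"
    using rf by (intro EV_cong) (simp add: reduced_form_def)
  have "AE x in \<nu>. \<forall>j\<in>{..<m}. EV q (frag_of (cls (f j), frag_of (\<sigma> j))) x = ev q (f j) x (frag_of (\<sigma> j))"
    using f \<sigma> by (intro AE_finite_allI EV_cls) (auto simp: singular_chain_of)
  with uv have ae: "AE x in \<nu>. l1_norm (EV q u x) = (\<Sum>j<m. \<bar>real_of_int (?h j x)\<bar>)"
  proof eventually_elim
    case (elim x)
    have "EV q u x = (\<Sum>j<m. frag_cmul (?h j x) (frag_of (simplex_map q p (\<sigma> j))))"
      unfolding elim(1) EV_sum[OF finite_lessThan] using elim(2) by (intro sum.cong refl) (simp add: ev_of)
    then have e: "poly_mapping.lookup (EV q u x) s = (\<Sum>j<m. if s = simplex_map q p (\<sigma> j) then ?h j x else 0)" for s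
      unfolding lookup_sum by (simp add: lookup_sum if_distrib cong: if_cong)
    let ?S = "(\<lambda>j. simplex_map q p (\<sigma> j)) ` {..<m}"
    have "Poly_Mapping.keys (EV q u x) \<subseteq> ?S"
    proof
      fix s assume "s \<in> Poly_Mapping.keys (EV q u x)"
      then have "(\<Sum>j<m. if s = simplex_map q p (\<sigma> j) then ?h j x else 0) \<noteq> 0" by (simp add: in_keys_iff e)
      then obtain j where "j \<in> {..<m}" "(if s = simplex_map q p (\<sigma> j) then ?h j x else 0) \<noteq> 0"
        by (rule sum.not_neutral_contains_not_neutral)
      then show "s \<in> ?S" by (auto split: if_splits)
    qed
    then have "l1_norm (EV q u x) = (\<Sum>s\<in>?S. \<bar>real_of_int (poly_mapping.lookup (EV q u x) s)\<bar>)"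
      by (intro l1_norm_superset) auto
    also have "\<dots> = (\<Sum>j<m. \<bar>real_of_int (poly_mapping.lookup (EV q u x) (simplex_map q p (\<sigma> j)))\<bar>)"
      using inj by (subst sum.reindex) (auto simp: inj_on_def)
    also have "\<dots> = (\<Sum>j<m. \<bar>real_of_int (?h j x)\<bar>)"
    proof (intro sum.cong refl)
      fix j assume j: "j \<in> {..<m}"
      have "poly_mapping.lookup (EV q u x) (simplex_map q p (\<sigma> j)) = (\<Sum>k<m. if k = j then ?h k x else 0)"
        unfolding e using inj j by (intro sum.cong) auto
      then show "\<bar>real_of_int (poly_mapping.lookup (EV q u x) (simplex_map q p (\<sigma> j)))\<bar> = \<bar>real_of_int (?h j x)\<bar>"
        using j by simp
    qed
    finally show ?case .
  qed
  have int: "integrable \<nu> (\<lambda>x. \<bar>real_of_int (?h j x)\<bar>)" if "j < m" for j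
    by (intro integrable_abs L_integrable hL that)
  have "(\<integral>x. l1_norm (EV q u x) \<partial>\<nu>) = (\<integral>x. (\<Sum>j<m. \<bar>real_of_int (?h j x)\<bar>) \<partial>\<nu>)"
    using int by (intro integral_cong_AE l1_norm_EV_measurable[OF u] ae borel_measurable_sum) auto
  also have "\<dots> = (\<Sum>j<m. \<integral>x. \<bar>real_of_int (?h j x)\<bar> \<partial>\<nu>)"
    using int by (intro Bochner_Integration.integral_sum) auto
  also have "\<dots> = (\<Sum>j<m. \<integral>x. real_of_int \<bar>f j x\<bar> \<partial>\<nu>)"
  proof (intro sum.cong refl)
    fix j assume j: "j \<in> {..<m}"
    have "(\<integral>x. \<bar>real_of_int (?h j x)\<bar> \<partial>\<nu>) = (\<integral>x. \<bar>real_of_int (f j x)\<bar> \<partial>\<nu>)"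
      using j L_measurable_real[OF f] by (intro integral_act[of _ "\<lambda>x. \<bar>real_of_int (f j x)\<bar>"] deck_of(1) \<sigma>) auto
    then show "(\<integral>x. \<bar>real_of_int (?h j x)\<bar> \<partial>\<nu>) = (\<integral>x. real_of_int \<bar>f j x\<bar> \<partial>\<nu>)" by simp
  qed
  finally show ?thesis by simp
qed

theorem parametrised_norm_eq:
  assumes u: "tensor_chain q u"
  shows "parametrised_norm q G E p \<delta> \<alpha> \<nu> (T.tc q u) = (\<integral>x. l1_norm (EV q u x) \<partial>\<nu>)"
  unfolding parametrised_norm_def
proof (rule the_equality)
  show "\<exists>m f \<sigma>. reduced_form q G E p \<delta> \<alpha> \<nu> (T.tc q u) m f \<sigma> \<and>
      (\<integral>x. l1_norm (EV q u x) \<partial>\<nu>) = (\<Sum>j<m. \<integral>x. real_of_int \<bar>f j x\<bar> \<partial>\<nu>)"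
    using reduced_form_exists[OF u] reduced_form_norm[OF _ u] by metis
qed (use reduced_form_norm[OF _ u] in metis)

end

section \<open>The simplicial volume as an infimum of fibre norms\<close>

lemma keys_frag_extend_pair:
  assumes "Poly_Mapping.keys u \<subseteq> A \<times> C" "\<And>a. a \<in> A \<Longrightarrow> \<phi> a \<in> A'" "\<And>c. c \<in> C \<Longrightarrow> \<psi> c \<in> C'"
  shows "Poly_Mapping.keys (frag_extend (\<lambda>(a, c). frag_of (\<phi> a, \<psi> c)) u) \<subseteq> A' \<times> C'"
  using keys_frag_extend[of "\<lambda>(a, c). frag_of (\<phi> a, \<psi> c)" u] assms by fastforce

context parametrised_chains
begin

abbreviation "bdry q u \<equiv> frag_extend (\<lambda>(F, c). frag_of (F :: ('x \<Rightarrow> int) set, chain_boundary q c)) u"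
abbreviation "const_incl u \<equiv> frag_extend (\<lambda>(k, c). frag_of (cls (\<lambda>_. k), c)) u"
abbreviation "pushforward q u \<equiv> frag_extend (\<lambda>(k, c). frag_cmul k (chain_map q p c)) u"

lemma ev_cell: "ev q f x c = cell \<alpha> f (chain_cells q c) x"
  unfolding ev_def by (rule cell_chain_cells[symmetric])

text \<open>In degree 0 the truncated \<open>q - 1\<close> is again 0, which is harmless because
  \<open>chain_boundary 0\<close> is the zero map.\<close>

lemma Echain_boundary: "Echain q c \<Longrightarrow> Echain (q - 1) (chain_boundary q c)"
  using singular_chain_boundary by simp

lemma twisted_boundary_class:
  "twisted_boundary q G E \<delta> LM (tensor_class G LM (CM q) u) = tensor_class G LM (CM (q - 1)) (bdry q u)"
  unfolding twisted_boundary_def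
  by (subst tensor_map_class[OF tensor_LM tensor_LM])
     (auto simp: chain_boundary_add chain_boundary_chain_map singular_chain_boundary)

lemma const_incl_class:
  "tensor_map G LM (CM q) (\<lambda>k. cls (\<lambda>_. k)) id (tensor_class G trivial_integers (CM q) u) =
   tensor_class G LM (CM q) (const_incl u)"
proof (subst tensor_map_class[OF tensor_Z tensor_LM])
  show "\<And>a. a \<in> carrier trivial_integers \<Longrightarrow> cls (\<lambda>_. a) \<in> carrier LM" by (simp add: Linf_carrier L_const)
  show "cls (\<lambda>_. a \<otimes>\<^bsub>trivial_integers\<^esub> b) = cls (\<lambda>_. a) \<otimes>\<^bsub>LM\<^esub> cls (\<lambda>_. b)" for a b
    by (subst Linf_mult[OF L_const L_const]) (simp add: trivial_integers_def)
  show "cls (\<lambda>_. ract trivial_integers a g) = ract LM (cls (\<lambda>_. a)) g" if "g \<in> carrier G" for a g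
    by (subst Linf_act[OF L_const that]) (simp add: trivial_integers_def)
qed simp_all

text \<open>Since p \<circ> \<delta> g = p on E, a simplex and its translates have the same image in
  M. This makes the choice of representative in \<open>untwist\<close> immaterial.\<close>

lemma pushforward_relations:
  assumes "r \<in> tensor_relations G trivial_integers (CM q)"
  shows "pushforward q r = 0"
proof -
  interpret Z: tensor_setting G trivial_integers "CM q" by (rule tensor_Z)
  show ?thesis using assms
  proof (induction rule: Z.R_induct)
    case (relator r)
    have act: "chain_map q p (chain_map q (\<delta> g) c) = chain_map q p c" if "g \<in> carrier G" "Echain q c" for g c
    proof -
      have "chain_map q (p \<circ> \<delta> g) c = chain_map q p c"
        by (rule chain_map_eq[OF that(2)]) (simp add: deck_maps(3)[OF that(1)])
      then show ?thesis by (simp add: chain_map_compose)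
    qed
    from relator show ?case unfolding tensor_relators_def
      by (elim UnE CollectE exE conjE)
        (simp_all add: frag_extend_diff trivial_integers_def frag_cmul_distrib chain_map_add frag_cmul_distrib2 act)
  qed (simp_all add: frag_extend_minus frag_extend_add)
qed

lemma untwist_class: "untwist q p (tensor_class G trivial_integers (CM q) u) = pushforward q u"
proof -
  interpret Z: tensor_setting G trivial_integers "CM q" by (rule tensor_Z)
  have "pushforward q v = pushforward q u" if "v \<in> Z.tc u" for v
    using pushforward_relations[of "v - u" q] that by (simp add: Z.mem_tc frag_extend_diff)
  moreover have "u \<in> Z.tc u" by (simp add: Z.mem_tc Z.R_0)
  ultimately have "(\<lambda>v. pushforward q v) ` Z.tc u = {pushforward q u}" by blast
  then show ?thesis by (simp add: untwist_def)
qed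

text \<open>Translation does not change constants, so the choice of lifts is invisible and the
  ordinary chain of M remains, the same at almost every x.\<close>

lemma EV_const_incl:
  assumes "Poly_Mapping.keys u \<subseteq> UNIV \<times> {c. Echain q c}"
  shows "AE x in \<nu>. EV q (const_incl u) x = pushforward q u"
  using assms
proof (induction u rule: frag_induction)
  case (one a)
  obtain k c where a: "a = (k, c)" by (cases a)
  have "Echain q c" using one a by simp
  from EV_cls[OF L_const this, of k] show ?case
    unfolding a by (simp add: ev_const)
next
  case (diff a b)
  then show ?case by eventually_elim (simp add: frag_extend_diff EV_diff)
qed simp

lemma keys_const_incl:
  "Poly_Mapping.keys u \<subseteq> UNIV \<times> {c. Echain q c} \<Longrightarrow> tensor_chain q (const_incl u)"
  by (rule keys_frag_extend_pair) (auto simp: Linf_carrier L_const)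

lemma keys_bdry:
  "tensor_chain q u \<Longrightarrow> tensor_chain (q - 1) (bdry q u)"
  by (rule keys_frag_extend_pair) (auto simp: singular_chain_boundary)

text \<open>Plays the role of \<open>B\<close> in \<open>integral_INF_fibre_norm\<close>. The
  boundary is taken in E, before simplices are moved to chosen lifts: all faces share one
  coefficient function, and each face brings its own deck element.\<close>

definition boundary_cells :: "nat \<Rightarrow> (int \<times> (real \<Rightarrow> 'a) set \<times> ((nat \<Rightarrow> real) \<Rightarrow> 'a)) list set" where
  "boundary_cells n = (\<lambda>c. chain_cells n (chain_boundary (Suc n) c)) ` {c. Echain (Suc n) c}"

lemma boundary_cells_cells: "boundary_cells n \<subseteq> cells"
  unfolding boundary_cells_def
  using Echain_boundary[of "Suc n"] by (intro image_subsetI chain_cells) simp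

text \<open>Equality holds at every x because the list uses the very representatives
  \<open>rp F\<close> with which \<open>EV\<close> evaluates. The converse
  \<open>fibre_to_bdry\<close> has to accept null sets, since \<open>rp (cls f)\<close> may differ
  from f.\<close>

lemma bdry_to_fibre:
  assumes "tensor_chain (Suc n) u"
  shows "\<exists>w\<in>lists (L \<times> boundary_cells n). \<forall>x. EV n (bdry (Suc n) u) x = fibre \<alpha> w x"
  using assms
proof (induction u rule: frag_induction)
  case zero
  then show ?case by (intro bexI[of _ "[]"]) auto
next
  case (one a)
  obtain F c where a: "a = (F, c)" by (cases a)
  then have "F \<in> carrier LM" "Echain (Suc n) c" using one by auto
  then show ?case
    using rp(1) by (intro bexI[of _ "[(rp F, chain_cells n (chain_boundary (Suc n) c))]"])
      (auto simp: a EV_of ev_cell boundary_cells_def)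
next
  case (diff a b)
  then obtain v w where vw: "v \<in> lists (L \<times> boundary_cells n)" "\<And>x. EV n (bdry (Suc n) a) x = fibre \<alpha> v x"
    "w \<in> lists (L \<times> boundary_cells n)" "\<And>x. EV n (bdry (Suc n) b) x = fibre \<alpha> w x" by blast
  \<comment> \<open>Lists can only be concatenated, so the subtraction is put into the
    coefficients.\<close>
  define w' where "w' = map (\<lambda>(f, l). (\<lambda>x. - 1 * f x, l)) w"
  have "fibre \<alpha> w' x = - fibre \<alpha> w x" for x
    unfolding w'_def
  proof (induction w)
    case (Cons a w)
    obtain f l where a: "a = (f, l)" by (cases a)
    have "cell \<alpha> (\<lambda>x. - 1 * f x) l x = frag_cmul (- 1) (cell \<alpha> f l x)"
      by (rule cell_restrict[of l "\<lambda>_. - 1"]) simp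
    with Cons show ?case by (simp add: a)
  qed simp
  moreover have "w' \<in> lists (L \<times> boundary_cells n)"
    using vw(3) L_cmult[of _ "- 1"] unfolding w'_def by fastforce
  ultimately show ?case using vw
    by (intro bexI[of _ "v @ w'"]) (auto simp: frag_extend_diff EV_diff)
qed

lemma fibre_to_bdry:
  assumes "w \<in> lists (L \<times> boundary_cells n)"
  shows "\<exists>u. tensor_chain (Suc n) u \<and>
    (AE x in \<nu>. EV n (bdry (Suc n) u) x = fibre \<alpha> w x)"
  using assms
proof (induction w)
  case Nil
  then show ?case by (intro exI[of _ 0]) auto
next
  case (Cons a w)
  obtain u where u: "tensor_chain (Suc n) u"
    "AE x in \<nu>. EV n (bdry (Suc n) u) x = fibre \<alpha> w x" using Cons by blast
  obtain f c where a: "a = (f, chain_cells n (chain_boundary (Suc n) c))" "f \<in> L" "Echain (Suc n) c"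
    using Cons by (cases a) (auto simp: boundary_cells_def)
  have "AE x in \<nu>. EV n (frag_of (cls f, chain_boundary (Suc n) c)) x = ev n f x (chain_boundary (Suc n) c)"
    using Echain_boundary[OF a(3)] by (intro EV_cls a(2)) simp
  with u(2) have "AE x in \<nu>. EV n (bdry (Suc n) (frag_of (cls f, c) + u)) x = fibre \<alpha> (a # w) x"
    by eventually_elim (simp add: frag_extend_add EV_add a(1) ev_cell)
  moreover have "tensor_chain (Suc n) (frag_of (cls f, c) + u)"
    using Poly_Mapping.keys_add[of "frag_of (cls f, c)" u] u(1) a by (auto simp: Linf_carrier)
  ultimately show ?case by blast
qed

lemma bdry_bdry:
  assumes "tensor_chain (Suc n) u"
  shows "EV (n - 1) (bdry n (bdry (Suc n) u)) x = 0"
  using assms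
proof (induction u rule: frag_induction)
  case (one a)
  obtain F c where a: "a = (F, c)" by (cases a)
  then have "chain_boundary n (chain_boundary (Suc n) c) = 0"
    using chain_boundary_boundary_alt[of n "top_of_set E" c] one by simp
  then show ?case by (simp add: a EV_of)
qed (simp_all add: frag_extend_diff EV_diff)

text \<open>Not only the infima but the sets of values agree. Each parametrised fundamental cycle
  comes with its own integral cycle z; its difference from the fixed \<open>\<zeta>\<close> is a
  boundary in M, which is lifted to E and enters as one more list entry with coefficient 1.\<close>

theorem simplicial_volume_eq_INF:
  assumes \<zeta>: "Echain n \<zeta>" "singular_relcycle n (top_of_set M) {} (chain_map n p \<zeta>)"
    "homologous_rel_set n (top_of_set M) {} (chain_map n p \<zeta>) = fM"
  shows "parametrised_simplicial_volume n M fM G E p \<delta> \<alpha> \<nu> =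
    (INF w\<in>lists (L \<times> boundary_cells n). fibre_norm \<alpha> \<nu> ((\<lambda>_. 1, chain_cells n \<zeta>) # w))"
proof -
  interpret TZ: tensor_setting G trivial_integers "CM n" by (rule tensor_Z)
  let ?K = "carrier LM \<times> carrier (CM n)"
  have Z_carrier: "carrier (trivial_integers :: ((real \<Rightarrow> 'a) set, int) right_module) = UNIV"
    by (simp add: trivial_integers_def)
  have \<zeta>_fibre: "cell \<alpha> (\<lambda>_. 1) (chain_cells n \<zeta>) x = chain_map n p \<zeta>" for x
    using ev_const[of n 1 x \<zeta>] by (simp add: ev_cell)
  have norm: "parametrised_norm n G E p \<delta> \<alpha> \<nu> (T.tc n u) = fibre_norm \<alpha> \<nu> w"
    if "Poly_Mapping.keys u \<subseteq> ?K" "w \<in> lists (L \<times> cells)" "AE x in \<nu>. EV n u x = fibre \<alpha> w x" for u w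
    unfolding parametrised_norm_eq[OF that(1)] fibre_norm_def
    using that(3) by (intro integral_cong_AE l1_norm_EV_measurable that(1) borel_measurable_integrable integrable_fibre that(2)) auto
  have cells: "(\<lambda>_. 1, chain_cells n \<zeta>) # w \<in> lists (L \<times> cells)" if "w \<in> lists (L \<times> boundary_cells n)" for w
    using that L_const[of 1] chain_cells[OF \<zeta>(1)] boundary_cells_cells[of n] by (auto 4 3)
  have "parametrised_norm n G E p \<delta> \<alpha> \<nu> ` {c. parametrised_fundamental_cycle n M fM G E p \<delta> \<alpha> \<nu> c} =
      (\<lambda>w. fibre_norm \<alpha> \<nu> ((\<lambda>_. 1, chain_cells n \<zeta>) # w)) ` lists (L \<times> boundary_cells n)" (is "?A = ?B")
  proof
    show "?A \<subseteq> ?B"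
    proof (rule image_subsetI, drule CollectD)
      fix c assume "parametrised_fundamental_cycle n M fM G E p \<delta> \<alpha> \<nu> c"
      then obtain z b where z: "z \<in> carrier (tensor G trivial_integers (CM n))"
          "homologous_rel_set n (top_of_set M) {} (untwist n p z) = fM"
        and b: "b \<in> carrier (tensor G LM (CM (Suc n)))"
        and c: "c = tensor_map G LM (CM n) (\<lambda>k. cls (\<lambda>_. k)) id z
               \<otimes>\<^bsub>tensor G LM (CM n)\<^esub> twisted_boundary (Suc n) G E \<delta> LM b"
        unfolding parametrised_fundamental_cycle_def by blast
      obtain uz where uz: "z = TZ.tc uz" "Poly_Mapping.keys uz \<subseteq> UNIV \<times> {c. Echain n c}"
        using z(1) unfolding TZ.carrier_tensor Z_carrier chain_module_simps by blast
      obtain ub where ub: "b = T.tc (Suc n) ub" "tensor_chain (Suc n) ub"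
        using b unfolding T.carrier_tensor by blast
      let ?u = "const_incl uz + bdry (Suc n) ub"
      have cu: "c = T.tc n ?u"
        unfolding c uz(1) ub(1) const_incl_class twisted_boundary_class by (simp add: T.mult_tensor)
      have u: "Poly_Mapping.keys ?u \<subseteq> ?K"
        using Poly_Mapping.keys_add[of "const_incl uz" "bdry (Suc n) ub"] keys_const_incl[OF uz(2)] keys_bdry[OF ub(2)]
        by auto
      have "homologous_rel n (top_of_set M) {} (pushforward n uz) (chain_map n p \<zeta>)"
        using z(2) \<zeta>(3) unfolding uz(1) untwist_class by (metis homologous_rel_set_eq)
      then obtain d where d: "singular_chain (Suc n) (top_of_set M) d"
        "chain_boundary (Suc n) d = pushforward n uz - chain_map n p \<zeta>"
        unfolding homologous_rel_def singular_boundary by blast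
      obtain d' where d': "Echain (Suc n) d'" "chain_map (Suc n) p d' = d"
        using covering_chain_lift[OF cov d(1)] by blast
      let ?d = "chain_boundary (Suc n) d'"
      have dd: "chain_map n p ?d = pushforward n uz - chain_map n p \<zeta>"
        using chain_boundary_chain_map[OF d'(1), of p] d(2) d'(2) by simp
      obtain w where w: "w \<in> lists (L \<times> boundary_cells n)" "\<And>x. EV n (bdry (Suc n) ub) x = fibre \<alpha> w x"
        using bdry_to_fibre[OF ub(2)] by blast
      let ?w = "(\<lambda>_. 1, chain_cells n ?d) # w"
      have w': "?w \<in> lists (L \<times> boundary_cells n)"
        using w(1) d'(1) L_const[of 1] by (auto simp: boundary_cells_def)
      have d_fibre: "cell \<alpha> (\<lambda>_. 1) (chain_cells n ?d) x = pushforward n uz - chain_map n p \<zeta>" for x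
        using ev_const[of n 1 x ?d] dd by (simp add: ev_cell)
      have "AE x in \<nu>. EV n ?u x = fibre \<alpha> ((\<lambda>_. 1, chain_cells n \<zeta>) # ?w) x"
        using EV_const_incl[OF uz(2)] by eventually_elim (simp add: EV_add w(2) \<zeta>_fibre d_fibre)
      from norm[OF u cells[OF w'] this] show "parametrised_norm n G E p \<delta> \<alpha> \<nu> c \<in> ?B"
        using w' cu by blast
    qed
    show "?B \<subseteq> ?A"
    proof (rule image_subsetI)
      fix w assume w: "w \<in> lists (L \<times> boundary_cells n)"
      obtain ub where ub: "tensor_chain (Suc n) ub"
        "AE x in \<nu>. EV n (bdry (Suc n) ub) x = fibre \<alpha> w x"
        using fibre_to_bdry[OF w] by blast
      let ?z = "frag_of (1 :: int, \<zeta>)"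
      let ?u = "const_incl ?z + bdry (Suc n) ub"
      have kz: "Poly_Mapping.keys ?z \<subseteq> UNIV \<times> {c. Echain n c}" using \<zeta>(1) by simp
      have u: "Poly_Mapping.keys ?u \<subseteq> ?K"
        using Poly_Mapping.keys_add[of "const_incl ?z" "bdry (Suc n) ub"] keys_const_incl[OF kz] keys_bdry[OF ub(1)]
        by auto
      have pz: "pushforward n ?z = chain_map n p \<zeta>" by simp
      have "AE x in \<nu>. EV n ?u x = fibre \<alpha> ((\<lambda>_. 1, chain_cells n \<zeta>) # w) x"
        using EV_const_incl[OF kz] ub(2) by eventually_elim (simp only: EV_add pz fibre_simps \<zeta>_fibre)
      note eq = norm[OF u cells[OF w] this]
      \<comment> \<open>In E the chain \<open>\<zeta>\<close> need not be a cycle, only its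
        projection is one. With constant coefficients evaluation sees nothing but the projection, so
        the boundary evaluates to 0 almost everywhere and is a relation.\<close>
      have "bdry n ?u \<in> T.R (n - 1)"
      proof (rule relation_if_EV_0)
        show "tensor_chain (n - 1) (bdry n ?u)" by (rule keys_bdry[OF u])
        have b: "Echain (n - 1) (chain_boundary n \<zeta>)" by (rule Echain_boundary[OF \<zeta>(1)])
        have "chain_map (n - 1) p (chain_boundary n \<zeta>) = 0"
          using chain_boundary_chain_map[OF \<zeta>(1), of p] \<zeta>(2) by (simp add: singular_cycle)
        with EV_cls[OF L_const b, of 1] have "AE x in \<nu>. EV (n - 1) (frag_of (cls (\<lambda>_. 1), chain_boundary n \<zeta>)) x = 0"
          by (simp add: ev_const)
        then show "AE x in \<nu>. EV (n - 1) (bdry n ?u) x = 0"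
          by eventually_elim (simp add: frag_extend_add EV_add bdry_bdry[OF ub(1)] del: One_nat_def)
      qed
      then have cyc: "twisted_boundary n G E \<delta> LM (T.tc n ?u) = \<one>\<^bsub>tensor G LM (CM (n - 1))\<^esub>"
        unfolding twisted_boundary_class T.one_tensor T.tc_eq by simp
      have "parametrised_fundamental_cycle n M fM G E p \<delta> \<alpha> \<nu> (T.tc n ?u)"
        unfolding parametrised_fundamental_cycle_def
      proof (intro conjI bexI[of _ "TZ.tc ?z"] bexI[of _ "T.tc (Suc n) ub"])
        show "T.tc n ?u \<in> carrier (tensor G LM (CM n))" using u unfolding T.carrier_tensor by blast
        show "T.tc (Suc n) ub \<in> carrier (tensor G LM (CM (Suc n)))" using ub(1) unfolding T.carrier_tensor by blast
        show "TZ.tc ?z \<in> carrier (tensor G trivial_integers (CM n))"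
          using kz unfolding TZ.carrier_tensor Z_carrier chain_module_simps by blast
        show "T.tc n ?u = tensor_map G LM (CM n) (\<lambda>k. cls (\<lambda>_. k)) id (TZ.tc ?z)
               \<otimes>\<^bsub>tensor G LM (CM n)\<^esub> twisted_boundary (Suc n) G E \<delta> LM (T.tc (Suc n) ub)"
          unfolding const_incl_class twisted_boundary_class by (simp add: T.mult_tensor)
      qed (use cyc \<zeta>(2,3) pz in \<open>simp_all only: untwist_class\<close>)
      with eq show "fibre_norm \<alpha> \<nu> ((\<lambda>_. 1, chain_cells n \<zeta>) # w) \<in> ?A" by (intro image_eqI[of _ _ "T.tc n ?u"]) auto
    qed
  qed
  then show ?thesis unfolding parametrised_simplicial_volume_def by simp
qed

end

theorem theorem1p1:
  fixes n :: nat
    and M :: "'a::topological_space set"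
    and ori :: "'a \<Rightarrow> 'a chain set"
    and fM :: "'a chain set"
    and E :: "'b::topological_space set"
    and p :: "'b \<Rightarrow> 'a"
    and e0 :: 'b
    and \<delta> :: "(real \<Rightarrow> 'a) set \<Rightarrow> 'b \<Rightarrow> 'b"
    and X :: "'x measure"
    and \<alpha> :: "(real \<Rightarrow> 'a) set \<Rightarrow> 'x \<Rightarrow> 'x"
    and \<mu> :: "'x measure"
    and \<beta> :: "'x \<Rightarrow> 'x measure"
  assumes "closed_manifold n M" and "connected M"
    and "orientation n M ori" and "fundamental_class n M ori fM"
    and "universal_covering E p M" and "e0 \<in> E" and "deck_action M E p e0 \<delta>"
    and "standard_probability_action (fundamental_group M (p e0)) X \<alpha> \<mu>"
    and "ergodic_decomposition (fundamental_group M (p e0)) X \<alpha> \<mu> \<beta>"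
  shows "integrable \<mu> (\<lambda>x. parametrised_simplicial_volume
                              n M fM (fundamental_group M (p e0)) E p \<delta> \<alpha> (\<beta> x)) \<and>
         parametrised_simplicial_volume n M fM (fundamental_group M (p e0)) E p \<delta> \<alpha> \<mu> =
           (\<integral>x. parametrised_simplicial_volume
                  n M fM (fundamental_group M (p e0)) E p \<delta> \<alpha> (\<beta> x) \<partial>\<mu>)"
proof -
  let ?G = "fundamental_group M (p e0)"
  interpret E: ergodic_decomposed ?G X \<alpha> \<mu> \<beta> using assms(8,9) by unfold_locales
  have action: "group_action ?G (space X) \<alpha>"
    using assms(8) by (simp add: standard_probability_action_def standard_action_def)
  then have "group ?G" by (simp add: group_action_def group_hom_def)
  then interpret D: deck_group M E p e0 \<delta> ?G
    using assms(5-7) by (intro deck_group.intro) (simp_all add: universal_covering_def)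
  have pc: "parametrised_chains M E p e0 \<delta> ?G X \<alpha> \<nu>" if "invariant_measure ?G X \<alpha> \<nu>" for \<nu>
    by (intro parametrised_chains.intro D.deck_group_axioms that parametrised_chains_axioms.intro
        group_action.composition_rule[OF action])
  obtain \<zeta>0 where \<zeta>0: "singular_relcycle n (top_of_set M) {} \<zeta>0" "homologous_rel_set n (top_of_set M) {} \<zeta>0 = fM"
    using assms(4) unfolding fundamental_class_def carrier_relative_homology_group by blast
  obtain \<zeta> where \<zeta>: "singular_chain n (top_of_set E) \<zeta>" "chain_map n p \<zeta> = \<zeta>0"
    using covering_chain_lift[OF D.cov] \<zeta>0(1) by (auto simp: singular_relcycle_def)
  \<comment> \<open>\<open>B\<close> and the list of \<open>\<zeta>\<close> come from the covering
    and the chosen lifts alone, so the same data describe the volume for \<open>\<mu>\<close> and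
    for all \<open>\<beta> x\<close>.\<close>
  define B where "B = (\<lambda>c. D.chain_cells n (chain_boundary (Suc n) c)) ` {c. singular_chain (Suc n) (top_of_set E) c}"
  have vol: "parametrised_simplicial_volume n M fM ?G E p \<delta> \<alpha> \<nu> =
      (INF w\<in>lists (Linf_functions \<nu> \<times> B). fibre_norm \<alpha> \<nu> ((\<lambda>_. 1, D.chain_cells n \<zeta>) # w))"
    if \<nu>: "invariant_measure ?G X \<alpha> \<nu>" for \<nu>
  proof -
    interpret P: parametrised_chains M E p e0 \<delta> ?G X \<alpha> \<nu> by (rule pc[OF \<nu>])
    show ?thesis
      using P.simplicial_volume_eq_INF[of n \<zeta> fM] \<zeta> \<zeta>0 by (simp add: P.boundary_cells_def B_def)
  qed
  have "B \<subseteq> lists (UNIV \<times> carrier ?G \<times> UNIV)"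
    unfolding B_def using singular_chain_boundary_alt by (intro image_subsetI D.chain_cells) blast
  note int = E.integral_INF_fibre_norm[OF this D.chain_cells[OF \<zeta>(1)]]
  have cong: "(INF w\<in>lists (Linf_functions (\<beta> x) \<times> B). fibre_norm \<alpha> (\<beta> x) ((\<lambda>_. 1, D.chain_cells n \<zeta>) # w)) =
      parametrised_simplicial_volume n M fM ?G E p \<delta> \<alpha> (\<beta> x)" if "x \<in> space \<mu>" for x
    using vol[OF E.\<beta>_invariant_measure] that by (simp add: E.space_eq)
  show ?thesis
    using int(1) int(2)[folded vol[OF E.invariant_measure_axioms]]
    by (simp add: cong cong: Bochner_Integration.integrable_cong Bochner_Integration.integral_cong)
qed

end
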